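(* Let $S$ be a connected closed oriented surface with a simple triangulation $G$ with sets of vertices, edges and triangles $V,E,F$. The homeomorphism $\Phi:\Omega_k\to\Omega_T$, $\vec k\mapsto(T_v(\vec k))_{v\in V}$, extends continuously to a homeomorphism $\widehat\Phi:\overline\Omega_k\to\widehat\Omega_T$, with $\widehat\Phi(\partial^I\Omega_k)=\partial_0^I\Omega_T$ for any $I\subset V$.
   Context: Generalized circles. A generalized circle of geodesic curvature $k>0$ in $\mathbb H^2$ is: for $k>1$ a circle of radius $r$, $k=\coth r$ (center: its usual center); for $k=1$ a horocycle (center: its ideal point); for $0<k<1$ a hypercycle, i.e. one component of the set of points at distance $r$ from a complete geodesic (its axis, also called its center), $k=\tanh r$. Its convex side is the closed disk, closed horoball, or closed region bounded by the hypercycle containing its axis. Two generalized circles are externally tangent if they are tangent at a point and their convex sides have disjoint interiors. Triangles. For $(k_1,k_2,k_3)\in\mathbb R_{>0}^3$ there is, up to isometry, a unique triple of pairwise externally tangent generalized circles $C_1,C_2,C_3$, arranged counterclockwise, with $C_i$ of geodesic curvature $k_i$. Let $t_{ij}$ be the tangency point of $C_i,C_j$. The edge $e_{ij}$ is the geodesic joining the centers of $C_i,C_j$ through $t_{ij}$ (perpendicular to the axis of any of them that is a hypercycle); the vertex $v_i$ is the center of $C_i$ if $k_i\ge1$ and the segment of the axis of $C_i$ between the two edges if $k_i<1$. The circle packed triangle is the closed polygon bounded by the vertices and edges. Let $l_i$ be the length of the arc of $C_i$ inside this triangle joining its two tangency points, and $T_i(k_1,k_2,k_3)=k_il_i$ its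 total geodesic curvature. For $\vec k=(k_v)\in\mathbb R_{>0}^V$ and $f=(uvw)\in F$, realize $f$ as the circle packed triangle of curvature $(k_u,k_v,k_w)$, let $T_v^f(\vec k)$ be the total geodesic curvature of the arc at $v$ in it, and let $T_v(\vec k)=\sum_{f\ni v}T_v^f(\vec k)$. Sets. $\Omega_k=\mathbb R_{>0}^V$, $\overline\Omega_k=\mathbb R_{\ge0}^V$. For non-empty $I\subset V$, $F_I$ is the set of triangles with at least one vertex in $I$, and $\eta^I(\vec T)=\pi|F_I|-\sum_{i\in I}T_i$. $\Omega_T=\{\vec T\in\mathbb R_{>0}^V:\eta^I(\vec T)>0\ \forall\,\varnothing\ne I\subset V\}$, $\widehat\Omega_T=\{\vec T\in\mathbb R_{\ge0}^V:\eta^I(\vec T)>0\ \forall\,\varnothing\ne I\subset V\}$. For $I\subset V$ (possibly empty), $\partial^I\Omega_k=\{\vec k\in\overline\Omega_k: k_i=0\iff i\in I\}$ and $\partial_0^I\Omega_T=\{\vec T\in\widehat\Omega_T:T_i=0\iff i\in I\}$; so $\partial^\varnothing\Omega_k=\Omega_k$, $\partial_0^\varnothing\Omega_T=\Omega_T$. It is a known earlier result that $\Phi:\Omega_k\to\Omega_T$ is a homeomorphism. *)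

theory Defs
  imports "HOL-Analysis.Analysis"
begin

section \<open>The hyperbolic plane\<close>

text \<open>
  We use the Beltrami--Klein model: the points are those of the open unit disk, the ideal points
  are those of the unit circle, and the geodesics are the Euclidean chords. The metric
  \<open>hinner\<close> has curvature \<open>-1\<close>, and \<open>hdist\<close> is its distance function.
\<close>

definition hplane :: "complex set" where
  "hplane = ball 0 1"

definition ideal_points :: "complex set" where
  "ideal_points = sphere 0 1"

definition hdist :: "complex \<Rightarrow> complex \<Rightarrow> real" where
  "hdist z w = arcosh ((1 - z \<bullet> w) / sqrt ((1 - (cmod z)\<^sup>2) * (1 - (cmod w)\<^sup>2)))"

definition hinner :: "complex \<Rightarrow> complex \<Rightarrow> complex \<Rightarrow> real" where
  "hinner z u v =
     (u \<bullet> v) / (1 - (cmod z)\<^sup>2) + (z \<bullet> u) * (z \<bullet> v) / (1 - (cmod z)\<^sup>2)\<^sup>2"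

definition complete_geodesic :: "complex set \<Rightarrow> bool" where
  "complete_geodesic A \<longleftrightarrow>
     (\<exists>\<xi>\<in>ideal_points. \<exists>\<zeta>\<in>ideal_points. \<xi> \<noteq> \<zeta> \<and> A = open_segment \<xi> \<zeta>)"

definition hdist_set :: "complex \<Rightarrow> complex set \<Rightarrow> real" where
  "hdist_set z A = (INF a\<in>A. hdist z a)"

text \<open>
  The Busemann function of the ideal point \<open>\<xi>\<close>, normalized to vanish at \<open>q\<close>. Its zero set
  is the horocycle centered at \<open>\<xi>\<close> through \<open>q\<close>; it is negative inside the horoball.
\<close>

definition busemann :: "complex \<Rightarrow> complex \<Rightarrow> complex \<Rightarrow> real" where
  "busemann \<xi> q z = Lim (at \<xi> within hplane) (\<lambda>w. hdist z w - hdist q w)"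

text \<open>
  Length with respect to \<open>hdist\<close>, as the supremum of the lengths of inscribed chains. It is
  only meaningful for rectifiable paths, and is only applied to arcs of generalized circles.
\<close>

definition hlength :: "(real \<Rightarrow> complex) \<Rightarrow> real" where
  "hlength \<gamma> = Sup {\<Sum>i<n. hdist (\<gamma> (s i)) (\<gamma> (s (Suc i))) | (n::nat) (s::nat \<Rightarrow> real).
     s 0 = 0 \<and> s n = 1 \<and> (\<forall>i<n. s i \<le> s (Suc i))}"


section \<open>Generalized circles\<close>

text \<open>
  \<open>Circle c r\<close> has center \<open>c\<close> and radius \<open>r\<close>; \<open>Horocycle \<xi> q\<close> has the ideal point \<open>\<xi>\<close> as
  center and passes through \<open>q\<close>; \<open>Hypercycle A r C\<close> has axis \<open>A\<close>, and \<open>C\<close> is one of the two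
  components of the set of points at distance \<open>r\<close> from \<open>A\<close>.
\<close>

datatype gcircle =
    Circle complex real
  | Horocycle complex complex
  | Hypercycle "complex set" real "complex set"

fun gcircle_valid :: "gcircle \<Rightarrow> bool" where
  "gcircle_valid (Circle c r) \<longleftrightarrow> c \<in> hplane \<and> r > 0"
| "gcircle_valid (Horocycle \<xi> q) \<longleftrightarrow> \<xi> \<in> ideal_points \<and> q \<in> hplane"
| "gcircle_valid (Hypercycle A r C) \<longleftrightarrow>
     complete_geodesic A \<and> r > 0 \<and> C \<in> components {z \<in> hplane. hdist_set z A = r}"

fun geod_curvature :: "gcircle \<Rightarrow> real" where
  "geod_curvature (Circle c r) = cosh r / sinh r"
| "geod_curvature (Horocycle \<xi> q) = 1"
| "geod_curvature (Hypercycle A r C) = tanh r"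

fun gcurve :: "gcircle \<Rightarrow> complex set" where
  "gcurve (Circle c r) = {z \<in> hplane. hdist z c = r}"
| "gcurve (Horocycle \<xi> q) = {z \<in> hplane. busemann \<xi> q z = 0}"
| "gcurve (Hypercycle A r C) = C"

fun convex_side :: "gcircle \<Rightarrow> complex set" where
  "convex_side (Circle c r) = {z \<in> hplane. hdist z c \<le> r}"
| "convex_side (Horocycle \<xi> q) = {z \<in> hplane. busemann \<xi> q z \<le> 0}"
| "convex_side (Hypercycle A r C) = C \<union> \<Union>{D \<in> components (hplane - C). A \<subseteq> D}"

text \<open>
  The direction \<open>u\<close> spans the tangent line of the curve \<open>C\<close> at \<open>t\<close>. The quotient below is
  \<open>cmod u\<close> times the sine of the angle from \<open>u\<close> to the secant through \<open>t\<close> and \<open>z\<close>. Since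
  the Klein model is a coordinate chart, tangency may be tested with Euclidean secants.
\<close>

definition tangent_direction :: "complex set \<Rightarrow> complex \<Rightarrow> complex \<Rightarrow> bool" where
  "tangent_direction C t u \<longleftrightarrow> t \<in> C \<and> u \<noteq> 0 \<and>
     ((\<lambda>z. Im (cnj u * (z - t)) / cmod (z - t)) \<longlongrightarrow> 0) (at t within C)"

definition externally_tangent :: "gcircle \<Rightarrow> gcircle \<Rightarrow> complex \<Rightarrow> bool" where
  "externally_tangent C C' t \<longleftrightarrow>
     (\<exists>u. tangent_direction (gcurve C) t u \<and> tangent_direction (gcurve C') t u) \<and>
     interior (convex_side C) \<inter> interior (convex_side C') = {}"


section \<open>Circle packed triangles\<close>

text \<open>
  The cyclic arrangement of three pairwise tangent circles is read off from the tangency points: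
  the circles \<open>C\<^sub>1\<close>, \<open>C\<^sub>2\<close>, \<open>C\<^sub>3\<close> are arranged counterclockwise iff the points \<open>t\<^sub>1\<^sub>2\<close>, \<open>t\<^sub>2\<^sub>3\<close>,
  \<open>t\<^sub>3\<^sub>1\<close> are.
\<close>

definition tangent_triple ::
    "gcircle \<Rightarrow> gcircle \<Rightarrow> gcircle \<Rightarrow> complex \<Rightarrow> complex \<Rightarrow> complex \<Rightarrow> bool" where
  "tangent_triple C1 C2 C3 t12 t23 t31 \<longleftrightarrow>
     gcircle_valid C1 \<and> gcircle_valid C2 \<and> gcircle_valid C3 \<and>
     externally_tangent C1 C2 t12 \<and> externally_tangent C2 C3 t23 \<and> externally_tangent C3 C1 t31 \<and>
     Im (cnj (t23 - t12) * (t31 - t12)) > 0"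

text \<open>
  \<open>edge_end C t p\<close>: the geodesic from \<open>t\<close> to \<open>p\<close> ends at the center of \<open>C\<close>; if the center is an
  axis, \<open>p\<close> lies on the axis and the geodesic is perpendicular to it at \<open>p\<close>.
\<close>

fun edge_end :: "gcircle \<Rightarrow> complex \<Rightarrow> complex \<Rightarrow> bool" where
  "edge_end (Circle c r) t p \<longleftrightarrow> p = c"
| "edge_end (Horocycle \<xi> q) t p \<longleftrightarrow> p = \<xi>"
| "edge_end (Hypercycle A r C) t p \<longleftrightarrow> p \<in> A \<and> (\<forall>a\<in>A. hinner p (a - p) (t - p) = 0)"

text \<open>The edge of two circles tangent at \<open>t\<close> is \<open>closed_segment p p'\<close>.\<close>

definition edge_between ::
    "gcircle \<Rightarrow> gcircle \<Rightarrow> complex \<Rightarrow> complex \<Rightarrow> complex \<Rightarrow> bool" where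
  "edge_between C C' t p p' \<longleftrightarrow>
     edge_end C t p \<and> edge_end C' t p' \<and> t \<in> closed_segment p p'"

text \<open>
  Here \<open>pij\<close> is the endpoint on the side of \<open>C\<^sub>i\<close> of the edge of \<open>C\<^sub>i\<close> and \<open>C\<^sub>j\<close>. Hence the segment
  from \<open>pij\<close> to \<open>pji\<close> is that edge, and the segment from \<open>pij\<close> to \<open>pik\<close> is the vertex at
  \<open>C\<^sub>i\<close>; the latter is a point unless \<open>C\<^sub>i\<close> is a hypercycle. Ideal vertices belong to the polygon.
\<close>

definition triangle_boundary ::
    "complex \<Rightarrow> complex \<Rightarrow> complex \<Rightarrow> complex \<Rightarrow> complex \<Rightarrow> complex \<Rightarrow> complex set" where
  "triangle_boundary p12 p21 p23 p32 p31 p13 =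
     closed_segment p12 p21 \<union> closed_segment p21 p23 \<union>
     closed_segment p23 p32 \<union> closed_segment p32 p31 \<union>
     closed_segment p31 p13 \<union> closed_segment p13 p12"

definition packed_triangle ::
    "complex \<Rightarrow> complex \<Rightarrow> complex \<Rightarrow> complex \<Rightarrow> complex \<Rightarrow> complex \<Rightarrow> complex set" where
  "packed_triangle p12 p21 p23 p32 p31 p13 =
     triangle_boundary p12 p21 p23 p32 p31 p13 \<union>
     inside (triangle_boundary p12 p21 p23 p32 p31 p13)"

text \<open>
  \<open>l\<close> is the length of the arc of the first circle in a circle packed triangle of curvatures
  \<open>(k1, k2, k3)\<close>.
\<close>

definition packed_arc_length :: "real \<Rightarrow> real \<Rightarrow> real \<Rightarrow> real \<Rightarrow> bool" where
  "packed_arc_length k1 k2 k3 l \<longleftrightarrow>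
     (\<exists>C1 C2 C3 t12 t23 t31 p12 p21 p23 p32 p31 p13 \<gamma>.
        tangent_triple C1 C2 C3 t12 t23 t31 \<and>
        geod_curvature C1 = k1 \<and> geod_curvature C2 = k2 \<and> geod_curvature C3 = k3 \<and>
        edge_between C1 C2 t12 p12 p21 \<and>
        edge_between C2 C3 t23 p23 p32 \<and>
        edge_between C3 C1 t31 p31 p13 \<and>
        arc \<gamma> \<and> pathstart \<gamma> = t12 \<and> pathfinish \<gamma> = t31 \<and>
        path_image \<gamma> \<subseteq> gcurve C1 \<inter> packed_triangle p12 p21 p23 p32 p31 p13 \<and>
        l = hlength \<gamma>)"

text \<open>
  The total geodesic curvature \<open>T\<^sub>1(k\<^sub>1, k\<^sub>2, k\<^sub>3)\<close>. The ones at the other two vertices are obtained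
  by cyclic relabelling, e.g. \<open>T\<^sub>2(k\<^sub>1, k\<^sub>2, k\<^sub>3) = T\<^sub>1(k\<^sub>2, k\<^sub>3, k\<^sub>1)\<close>. The length is well defined
  for positive curvatures, as the triple of circles then exists and is unique up to isometry.
\<close>

definition total_geod_curvature :: "real \<Rightarrow> real \<Rightarrow> real \<Rightarrow> real" where
  "total_geod_curvature k1 k2 k3 = k1 * (THE l. packed_arc_length k1 k2 k3 l)"


section \<open>Triangulated oriented surfaces\<close>

definition connected_closed_surface :: "'a topology \<Rightarrow> bool" where
  "connected_closed_surface S \<longleftrightarrow>
     topspace S \<noteq> {} \<and> connected_space S \<and> compact_space S \<and> Hausdorff_space S \<and>
     (\<forall>x\<in>topspace S. \<exists>U. openin S U \<and> x \<in> U \<and>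
        subtopology S U homeomorphic_space (euclidean :: complex topology))"

text \<open>
  The vertices form a finite type; \<open>pos\<close> places them on the surface. Edges and triangles are
  subsets of the surface, given as embedded intervals and triangles (so there are no loops).
\<close>

definition edge_cell :: "'a topology \<Rightarrow> ('v \<Rightarrow> 'a) \<Rightarrow> 'a set \<Rightarrow> bool" where
  "edge_cell S pos e \<longleftrightarrow>
     (\<exists>g. embedding_map (top_of_set {0..1::real}) S g \<and>
          e = g ` {0..1} \<and> e \<inter> range pos = {g 0, g 1})"

definition triangle_cell :: "'a topology \<Rightarrow> ('v \<Rightarrow> 'a) \<Rightarrow> 'a set set \<Rightarrow> 'a set \<Rightarrow> bool" where
  "triangle_cell S pos E f \<longleftrightarrow>
     (\<exists>g. embedding_map (top_of_set (convex hull {0, 1, \<i>})) S g \<and>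
          f = g ` (convex hull {0, 1, \<i>}) \<and> f \<inter> range pos = {g 0, g 1, g \<i>} \<and>
          {g ` closed_segment 0 1, g ` closed_segment 1 \<i>, g ` closed_segment \<i> 0} \<subseteq> E \<and>
          f \<inter> \<Union>E = g ` (closed_segment 0 1 \<union> closed_segment 1 \<i> \<union> closed_segment \<i> 0))"

definition triangulation ::
    "'a topology \<Rightarrow> ('v::finite \<Rightarrow> 'a) \<Rightarrow> 'a set set \<Rightarrow> 'a set set \<Rightarrow> bool" where
  "triangulation S pos E F \<longleftrightarrow>
     inj pos \<and> range pos \<subseteq> topspace S \<and> finite E \<and> finite F \<and>
     (\<forall>e\<in>E. edge_cell S pos e) \<and> (\<forall>f\<in>F. triangle_cell S pos E f) \<and>
     \<Union>F = topspace S \<and>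
     (\<forall>e\<in>E. \<forall>e'\<in>E. e \<noteq> e' \<longrightarrow> e \<inter> e' \<subseteq> range pos) \<and>
     (\<forall>f\<in>F. \<forall>f'\<in>F. f \<noteq> f' \<longrightarrow> f \<inter> f' \<subseteq> \<Union>E)"

text \<open>Loops are already excluded, so simplicity amounts to the absence of multiple edges.\<close>

definition simple_triangulation ::
    "'a topology \<Rightarrow> ('v::finite \<Rightarrow> 'a) \<Rightarrow> 'a set set \<Rightarrow> 'a set set \<Rightarrow> bool" where
  "simple_triangulation S pos E F \<longleftrightarrow> triangulation S pos E F \<and>
     (\<forall>e\<in>E. \<forall>e'\<in>E. e \<inter> range pos = e' \<inter> range pos \<longrightarrow> e = e')"

text \<open>
  An orientation of the surface is given by a coherent orientation of the triangles: \<open>nxt f\<close> maps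
  each vertex of \<open>f\<close> to the next one in counterclockwise order, and the two triangles at an edge
  traverse it in opposite directions.
\<close>

definition surface_orientation ::
    "('v \<Rightarrow> 'a) \<Rightarrow> 'a set set \<Rightarrow> ('a set \<Rightarrow> 'v \<Rightarrow> 'v) \<Rightarrow> bool" where
  "surface_orientation pos F nxt \<longleftrightarrow>
     (\<forall>f\<in>F. \<forall>v. pos v \<in> f \<longrightarrow>
        pos -` f = {v, nxt f v, nxt f (nxt f v)} \<and> nxt f (nxt f (nxt f v)) = v) \<and>
     (\<forall>f\<in>F. \<forall>f'\<in>F. \<forall>v. f \<noteq> f' \<and> pos v \<in> f \<and> pos v \<in> f' \<longrightarrow> nxt f v \<noteq> nxt f' v)"


section \<open>The map \<open>\<Phi>\<close> and its domains\<close>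

definition \<Phi> ::
    "('v::finite \<Rightarrow> 'a) \<Rightarrow> 'a set set \<Rightarrow> ('a set \<Rightarrow> 'v \<Rightarrow> 'v) \<Rightarrow> real ^ 'v \<Rightarrow> real ^ 'v" where
  "\<Phi> pos F nxt k =
     (\<chi> v. \<Sum>f\<in>{f \<in> F. pos v \<in> f}.
        total_geod_curvature (k $ v) (k $ nxt f v) (k $ nxt f (nxt f v)))"

definition \<Omega>\<^sub>k :: "(real ^ 'v::finite) set" where
  "\<Omega>\<^sub>k = {k. \<forall>v. k $ v > 0}"

definition closed_\<Omega>\<^sub>k :: "(real ^ 'v::finite) set" where
  "closed_\<Omega>\<^sub>k = {k. \<forall>v. k $ v \<ge> 0}"

definition triangles_at :: "('v \<Rightarrow> 'a) \<Rightarrow> 'a set set \<Rightarrow> 'v set \<Rightarrow> 'a set set" where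
  "triangles_at pos F I = {f \<in> F. \<exists>i\<in>I. pos i \<in> f}"

definition \<eta> ::
    "('v::finite \<Rightarrow> 'a) \<Rightarrow> 'a set set \<Rightarrow> 'v set \<Rightarrow> real ^ 'v \<Rightarrow> real" where
  "\<eta> pos F I T = pi * real (card (triangles_at pos F I)) - (\<Sum>i\<in>I. T $ i)"

definition \<Omega>\<^sub>T :: "('v::finite \<Rightarrow> 'a) \<Rightarrow> 'a set set \<Rightarrow> (real ^ 'v) set" where
  "\<Omega>\<^sub>T pos F = {T. (\<forall>v. T $ v > 0) \<and> (\<forall>I. I \<noteq> {} \<longrightarrow> \<eta> pos F I T > 0)}"

definition hat_\<Omega>\<^sub>T :: "('v::finite \<Rightarrow> 'a) \<Rightarrow> 'a set set \<Rightarrow> (real ^ 'v) set" where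
  "hat_\<Omega>\<^sub>T pos F = {T. (\<forall>v. T $ v \<ge> 0) \<and> (\<forall>I. I \<noteq> {} \<longrightarrow> \<eta> pos F I T > 0)}"

definition bd_\<Omega>\<^sub>k :: "'v::finite set \<Rightarrow> (real ^ 'v) set" where
  "bd_\<Omega>\<^sub>k I = {k \<in> closed_\<Omega>\<^sub>k. \<forall>i. k $ i = 0 \<longleftrightarrow> i \<in> I}"

definition bd0_\<Omega>\<^sub>T :: "('v::finite \<Rightarrow> 'a) \<Rightarrow> 'a set set \<Rightarrow> 'v set \<Rightarrow> (real ^ 'v) set" where
  "bd0_\<Omega>\<^sub>T pos F I = {T \<in> hat_\<Omega>\<^sub>T pos F. \<forall>i. T $ i = 0 \<longleftrightarrow> i \<in> I}"

end

theory Submission imports Defs begin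

text \<open>
  The total geodesic curvature \<open>T\<^sub>1(k\<^sub>1, k\<^sub>2, k\<^sub>3)\<close> has an explicit formula, and the theorem follows from
  monotonicity properties that can be read off from it.

  In Minkowski space a generalized circle of curvature \<open>k\<close> is the section of the
  hyperboloid by a plane \<open>\<langle>X, N\<rangle> = - k\<close> with \<open>\<langle>N, N\<rangle> = 1 - k\<^sup>2\<close>, whichever of the three kinds it is. Two of
  them are externally tangent at \<open>X\<close> iff \<open>N + N' = (k + k') X\<close> (\<open>externally_tangent_normals\<close>,
  \<open>externally_tangentI\<close>). So three mutually tangent ones satisfy \<open>\<langle>N\<^sub>i, N\<^sub>j\<rangle> = - 1 - k\<^sub>i k\<^sub>j\<close>: the curvatures
  determine the configuration. Put \<open>\<sigma> = k\<^sub>1 k\<^sub>2 + k\<^sub>2 k\<^sub>3 + k\<^sub>3 k\<^sub>1\<close> and \<open>m\<^sup>2 = 1 + \<sigma>\<close>. In a rational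
  parametrization of the first curve the arc of the triangle is the interval from \<open>0\<close> to \<open>1 / m\<close>, and
  its length is the integral of \<open>2 / (1 + (k\<^sub>1\<^sup>2 - 1) u\<^sup>2)\<close> (\<open>triangle_frame\<close>, \<open>packed_arc_length_unique\<close>).
  Integration by parts (\<open>turning_eq_arc_integral\<close>) rewrites \<open>T\<^sub>1\<close> as twice the integral, over \<open>p\<close>
  from \<open>0\<close> to \<open>1\<close>, of \<open>arctan (k\<^sub>1 / max q (sqrt \<sigma>))\<close>, where \<open>q = p / sqrt (1 - p\<^sup>2)\<close>.

  This expression is continuous on the whole closed orthant, vanishes iff \<open>k\<^sub>1 = 0\<close>,
  and decreases in \<open>k\<^sub>2\<close> and \<open>k\<^sub>3\<close>. Since \<open>arctan (k\<^sub>1 / sqrt \<sigma>) + arctan (k\<^sub>2 / sqrt \<sigma>) + arctan (k\<^sub>3 / sqrt \<sigma>)\<close>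
  equals \<open>pi/2\<close> if \<open>\<sigma> > 0\<close>, the integrands of \<open>T\<^sub>1\<close>, \<open>T\<^sub>2\<close>, \<open>T\<^sub>3\<close> add up to the minimum of \<open>pi/2\<close> and the sum of the
  \<open>arctan (k\<^sub>i / q)\<close> (\<open>sum_angle_density\<close>). Hence \<open>T\<^sub>1 + T\<^sub>2 + T\<^sub>3\<close> is strictly increasing in each
  variable, is less than \<open>pi\<close>, and tends to \<open>pi\<close> if some \<open>k\<^sub>i\<close> tends to infinity.

  Summed over the triangles, these properties allow Perron's method
  (\<open>perron_homeomorphism\<close>): if \<open>k'\<close> exceeds \<open>k\<close> exactly on the nonempty set \<open>I\<close> of vertices, then the
  sum of \<open>T\<close> over \<open>I\<close> is larger for \<open>k'\<close>, which gives injectivity; and for a target in the range the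
  largest \<open>k\<close> with \<open>T(k)\<close> below the target is a preimage. It exists because the inequalities
  \<open>\<eta> > 0\<close> keep these \<open>k\<close> bounded. The strata correspond because \<open>T\<^sub>v\<close> vanishes iff \<open>k\<^sub>v\<close> does.
\<close>

section \<open>The turning integral\<close>

text \<open>The cotangent of the angle with cosine \<open>p\<close>.\<close>

definition cotangent :: "real \<Rightarrow> real" where
  "cotangent p = p / sqrt (1 - p\<^sup>2)"

definition angle_density :: "real \<Rightarrow> real \<Rightarrow> real \<Rightarrow> real" where
  "angle_density a s p = arctan (a / max (cotangent p) (sqrt s))"

text \<open>For \<open>s = k\<^sub>1 k\<^sub>2 + k\<^sub>2 k\<^sub>3 + k\<^sub>3 k\<^sub>1\<close> the value \<open>turning k\<^sub>1 s\<close> is the total geodesic curvature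
  \<open>T\<^sub>1(k\<^sub>1, k\<^sub>2, k\<^sub>3)\<close>. Keeping \<open>s\<close> as a separate parameter shows that the other two circles
  enter through \<open>s\<close> only; \<open>s = 0\<close> is meaningful and belongs to the triples with at most one
  nonzero curvature.\<close>

definition turning :: "real \<Rightarrow> real \<Rightarrow> real" where
  "turning a s = 2 * integral {0<..<1} (angle_density a s)"

lemma square_less_one: "0 < p \<Longrightarrow> p < 1 \<Longrightarrow> p\<^sup>2 < (1::real)"
  by (simp add: power_less_one_iff)

lemma cotangent_pos: "0 < p \<Longrightarrow> p < 1 \<Longrightarrow> cotangent p > 0"
  unfolding cotangent_def by (simp add: square_less_one)

lemma cotangent_square: "0 < p \<Longrightarrow> p < 1 \<Longrightarrow> (cotangent p)\<^sup>2 = p\<^sup>2 / (1 - p\<^sup>2)"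
  unfolding cotangent_def using square_less_one[of p] by (simp add: power_divide)

lemma continuous_on_cotangent: "continuous_on {0<..<1} cotangent"
  unfolding cotangent_def using square_less_one
  by (intro continuous_intros) fastforce

lemma denominator_pos:
  assumes "p \<in> {0<..<1}" shows "max (cotangent p) (sqrt s) > 0"
  using cotangent_pos[of p] assms by (auto intro: less_max_iff_disj[THEN iffD2])

lemma angle_density_nonneg:
  assumes "p \<in> {0<..<1}" "0 \<le> a" shows "0 \<le> angle_density a s p"
  unfolding angle_density_def using denominator_pos[OF assms(1), of s] assms(2) by simp

lemma angle_density_norm_le: "norm (angle_density a s p) \<le> pi/2"
  unfolding angle_density_def using arctan_ubound arctan_lbound
  by (metis abs_le_iff less_imp_le minus_le_iff real_norm_def minus_divide_left)

lemma continuous_on_angle_density: "continuous_on {0<..<1} (angle_density a s)"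
proof -
  have "max (cotangent p) (sqrt s) \<noteq> 0" if "p \<in> {0<..<1}" for p
    using denominator_pos[OF that, of s] by simp
  then show ?thesis
    unfolding angle_density_def
    by (intro continuous_intros continuous_on_cotangent) auto
qed

lemma angle_density_integrable: "angle_density a s integrable_on {0<..<1}"
proof (rule measurable_bounded_by_integrable_imp_integrable)
  show "angle_density a s \<in> borel_measurable (lebesgue_on {0<..<1})"
    by (intro continuous_imp_measurable_on_sets_lebesgue continuous_on_angle_density) auto
  show "(\<lambda>p. pi/2) integrable_on {0<..<1::real}"
    by (simp add: integrable_on_open_interval_real integrable_const_ivl)
qed (use angle_density_norm_le in auto)

lemma turning_nonneg: "0 \<le> a \<Longrightarrow> 0 \<le> turning a s"
  unfolding turning_def
  by (auto intro!: integral_nonneg angle_density_integrable angle_density_nonneg)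

lemma turning_zero [simp]: "turning 0 s = 0"
  unfolding turning_def angle_density_def by simp

text \<open>A strict inequality near the right end already separates the integrals: on the middle third of
  \<open>{b..1}\<close> both integrands are continuous up to the boundary.\<close>

lemma integral_strict_mono_unit:
  fixes f g :: "real \<Rightarrow> real"
  assumes int: "f integrable_on {0<..<1}" "g integrable_on {0<..<1}"
    and cont: "continuous_on {0<..<1} f" "continuous_on {0<..<1} g"
    and le: "\<And>p. p \<in> {0<..<1} \<Longrightarrow> f p \<le> g p"
    and less: "\<And>p. p \<in> {b<..<1} \<Longrightarrow> f p < g p" and b: "0 \<le> b" "b < 1"
  shows "integral {0<..<1} f < integral {0<..<1} g"
proof -
  define c d where "c = (1 + 2*b)/3" and "d = (2 + b)/3"
  have cd: "0 < c" "b < c" "c < d" "d < 1" "{c..d} \<subseteq> {0<..<1}"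
    using b unfolding c_def d_def by (auto simp: field_simps)
  have sub: "{c..d} \<subseteq> {0<..<1}" by (fact cd(5))
  have intcd: "f integrable_on {c..d}" "g integrable_on {c..d}"
    using cont continuous_on_subset sub by (blast intro: integrable_continuous_real)+
  have "integral {c..d} f < integral {c..d} g"
    by (rule integral_less_real) (use cd cont less in \<open>auto intro: continuous_on_subset\<close>)
  then have "0 < integral {c..d} (\<lambda>p. g p - f p)"
    using intcd by (simp add: integral_diff)
  also have "\<dots> \<le> integral {0<..<1} (\<lambda>p. g p - f p)"
    using sub int intcd le by (intro integral_subset_le) (auto intro: integrable_diff)
  finally show ?thesis using int by (simp add: integral_diff)
qed

lemma turning_pos:
  assumes "0 < a" shows "0 < turning a s"
proof -
  have "integral {0<..<1::real} (\<lambda>p. 0::real) < integral {0<..<1} (angle_density a s)"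
  proof (rule integral_strict_mono_unit[where b=0])
    show "0 \<le> angle_density a s p" if "p \<in> {0<..<1}" for p
      using angle_density_nonneg[OF that] assms by simp
    show "0 < angle_density a s p" if "p \<in> {0<..<1}" for p
      unfolding angle_density_def using denominator_pos[OF that, of s] assms by simp
  qed (auto intro: integrable_0 angle_density_integrable continuous_on_angle_density)
  then show ?thesis by (simp add: turning_def)
qed

lemma turning_antimono:
  assumes "0 \<le> a" "0 \<le> s" "s \<le> t" shows "turning a t \<le> turning a s"
proof -
  have "angle_density a t p \<le> angle_density a s p" if "p \<in> {0<..<1}" for p
    unfolding angle_density_def arctan_le_iff
    using denominator_pos[OF that, of s] assms
    by (intro divide_left_mono mult_pos_pos denominator_pos[OF that] max.mono) auto
  then show ?thesis
    unfolding turning_def by (intro mult_left_mono integral_le angle_density_integrable) auto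
qed

text \<open>For every \<open>p\<close> the denominator of the density is at least \<open>cotangent p > 0\<close>, also in the limit
  \<open>s = 0\<close>. Hence the density depends continuously on both parameters, and \<open>pi/2\<close> dominates it.\<close>

lemma turning_tendsto:
  assumes a: "a \<longlonglongrightarrow> a0" and s: "s \<longlonglongrightarrow> s0"
  shows "(\<lambda>n. turning (a n) (s n)) \<longlonglongrightarrow> turning a0 s0"
proof -
  have "(\<lambda>n. integral {0<..<1} (angle_density (a n) (s n)))
    \<longlonglongrightarrow> integral {0<..<1} (angle_density a0 s0)"
  proof (rule dominated_convergence(2)[where h = "\<lambda>_. pi/2"])
    show "(\<lambda>p. pi/2) integrable_on {0<..<1::real}"
      by (simp add: integrable_on_open_interval_real integrable_const_ivl)
    show "(\<lambda>n. angle_density (a n) (s n) p) \<longlonglongrightarrow> angle_density a0 s0 p"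
      if "p \<in> {0<..<1}" for p
      unfolding angle_density_def using denominator_pos[OF that, of s0]
      by (intro tendsto_intros a s) auto
  qed (use angle_density_norm_le angle_density_integrable in auto)
  then show ?thesis unfolding turning_def by (intro tendsto_intros)
qed

lemma continuous_on_turning:
  fixes f g :: "'a::metric_space \<Rightarrow> real"
  assumes "continuous_on S f" "continuous_on S g"
  shows "continuous_on S (\<lambda>x. turning (f x) (g x))"
  using assms unfolding continuous_on_sequentially o_def
  by (auto intro!: turning_tendsto)

text \<open>Used with large \<open>s\<close>: a circle of bounded curvature contributes little when one of its
  neighbours has a huge curvature.\<close>

lemma turning_le:
  assumes "0 \<le> a" "0 < s" shows "turning a s \<le> 2 * a / sqrt s"
proof -
  have "angle_density a s p \<le> a / sqrt s" if "p \<in> {0<..<1}" for p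
  proof -
    have "arctan (a / max (cotangent p) (sqrt s)) \<le> arctan (a / sqrt s)"
      unfolding arctan_le_iff using assms
      by (intro divide_left_mono mult_pos_pos denominator_pos[OF that]) auto
    also have "\<dots> \<le> a / sqrt s" using assms by (intro arctan_le_self) simp
    finally show ?thesis by (simp add: angle_density_def)
  qed
  moreover have "(\<lambda>p. a / sqrt s) integrable_on {0<..<1::real}"
    by (simp add: integrable_on_open_interval_real integrable_const_ivl)
  ultimately have "integral {0<..<1} (angle_density a s) \<le> integral {0<..<1::real} (\<lambda>p. a / sqrt s)"
    by (intro integral_le angle_density_integrable)
  also have "\<dots> = a / sqrt s" by (simp flip: integral_open_interval_real)
  finally show ?thesis unfolding turning_def by simp
qed

lemma arctan_add_cot:
  assumes "0 \<le> x" "0 \<le> y" "0 < x + (y::real)"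
  shows "arctan x + arctan y = pi/2 - arctan ((1 - x*y) / (x + y))"
proof -
  define \<theta> where "\<theta> = arctan x + arctan y"
  have "0 < \<theta>" using assms unfolding \<theta>_def
    by (cases "x = 0") (auto intro: add_pos_nonneg)
  moreover have "\<theta> < pi" using arctan_ubound[of x] arctan_ubound[of y] unfolding \<theta>_def by simp
  ultimately have bounds: "-(pi/2) < pi/2 - \<theta>" "pi/2 - \<theta> < pi/2" by simp_all
  have "cos \<theta> = (1 - x*y) / (sqrt (1+x\<^sup>2) * sqrt (1+y\<^sup>2))"
    unfolding \<theta>_def by (simp add: cos_add cos_arctan sin_arctan diff_divide_distrib)
  moreover have "sin \<theta> = (x + y) / (sqrt (1+x\<^sup>2) * sqrt (1+y\<^sup>2))"
    unfolding \<theta>_def by (simp add: sin_add cos_arctan sin_arctan add_divide_distrib)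
  moreover have "sqrt (1+x\<^sup>2) * sqrt (1+y\<^sup>2) \<noteq> 0"
  proof -
    have "0 < sqrt (1+x\<^sup>2)" "0 < sqrt (1+y\<^sup>2)" by (simp_all add: add_pos_nonneg)
    then show ?thesis by simp
  qed
  ultimately have "tan (pi/2 - \<theta>) = (1 - x*y) / (x + y)"
    by (simp add: tan_def sin_diff cos_diff)
  then show ?thesis using arctan_tan[OF bounds] unfolding \<theta>_def by simp
qed

text \<open>The cotangent of \<open>arctan x + arctan y\<close> is \<open>(1 - x y) / (x + y)\<close>; compare it with \<open>z\<close>.\<close>

lemma arctan_sum_iff:
  assumes "0 \<le> x" "0 \<le> y" "0 \<le> (z::real)"
  shows "arctan x + arctan y + arctan z \<le> pi/2 \<longleftrightarrow> x*y + y*z + z*x \<le> 1"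
    and "arctan x + arctan y + arctan z < pi/2 \<longleftrightarrow> x*y + y*z + z*x < 1"
proof -
  have "(arctan x + arctan y + arctan z \<le> pi/2 \<longleftrightarrow> x*y + y*z + z*x \<le> 1)
     \<and> (arctan x + arctan y + arctan z < pi/2 \<longleftrightarrow> x*y + y*z + z*x < 1)"
  proof (cases "x + y = 0")
    case True
    then have "x = 0" "y = 0" using assms by auto
    then show ?thesis using arctan_ubound[of z] by simp
  next
    case False
    then have "0 < x + y" using assms by auto
    note xy = this
    have "z \<le> (1 - x*y) / (x + y) \<longleftrightarrow> x*y + y*z + z*x \<le> 1"
      using xy by (simp add: pos_le_divide_eq) (auto simp: algebra_simps)
    moreover have "z < (1 - x*y) / (x + y) \<longleftrightarrow> x*y + y*z + z*x < 1"
      using xy by (simp add: pos_less_divide_eq) (auto simp: algebra_simps)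
    moreover have "arctan x + arctan y + arctan z \<le> pi/2 \<longleftrightarrow> arctan z \<le> arctan ((1 - x*y) / (x + y))"
      "arctan x + arctan y + arctan z < pi/2 \<longleftrightarrow> arctan z < arctan ((1 - x*y) / (x + y))"
      using arctan_add_cot[OF assms(1,2) xy] by linarith+
    ultimately show ?thesis by (simp add: arctan_le_iff arctan_less_iff)
  qed
  then show "arctan x + arctan y + arctan z \<le> pi/2 \<longleftrightarrow> x*y + y*z + z*x \<le> 1"
    and "arctan x + arctan y + arctan z < pi/2 \<longleftrightarrow> x*y + y*z + z*x < 1" by auto
qed

lemma arctan_scaled_sum_iff:
  assumes "0 \<le> a" "0 \<le> b" "0 \<le> (c::real)" "0 < Q"
  shows "arctan (a/Q) + arctan (b/Q) + arctan (c/Q) \<le> pi/2 \<longleftrightarrow> a*b + b*c + c*a \<le> Q\<^sup>2"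
    and "arctan (a/Q) + arctan (b/Q) + arctan (c/Q) < pi/2 \<longleftrightarrow> a*b + b*c + c*a < Q\<^sup>2"
proof -
  have "(a/Q)*(b/Q) + (b/Q)*(c/Q) + (c/Q)*(a/Q) = (a*b + b*c + c*a) / Q\<^sup>2"
    using assms(4) by (simp add: field_simps power2_eq_square)
  then show "arctan (a/Q) + arctan (b/Q) + arctan (c/Q) \<le> pi/2 \<longleftrightarrow> a*b + b*c + c*a \<le> Q\<^sup>2"
    and "arctan (a/Q) + arctan (b/Q) + arctan (c/Q) < pi/2 \<longleftrightarrow> a*b + b*c + c*a < Q\<^sup>2"
    using arctan_sum_iff[of "a/Q" "b/Q" "c/Q"] assms by simp_all
qed

definition sigma2 :: "real \<Rightarrow> real \<Rightarrow> real \<Rightarrow> real" where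
  "sigma2 a b c = a*b + b*c + c*a"

lemma sigma2_nonneg: "0 \<le> a \<Longrightarrow> 0 \<le> b \<Longrightarrow> 0 \<le> c \<Longrightarrow> 0 \<le> sigma2 a b c"
  unfolding sigma2_def by simp

lemma sigma2_mono:
  "0 \<le> a \<Longrightarrow> 0 \<le> b \<Longrightarrow> 0 \<le> c \<Longrightarrow> a \<le> a' \<Longrightarrow> b \<le> b' \<Longrightarrow> c \<le> c' \<Longrightarrow> sigma2 a b c \<le> sigma2 a' b' c'"
  unfolding sigma2_def by (intro add_mono mult_mono) auto

text \<open>For the denominator \<open>sqrt \<sigma>\<close>, where \<open>\<sigma> = a b + b c + c a > 0\<close>, the three arctangents add up to
  exactly \<open>pi/2\<close>: for positive \<open>a\<close>, \<open>b\<close>, \<open>c\<close> they are the half angles of the Euclidean triangle with three mutually tangent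
  circles at its vertices, with the radii \<open>1 / a\<close>, \<open>1 / b\<close>, \<open>1 / c\<close>. Since the sum decreases in
  the denominator, capping the denominator from below by \<open>sqrt \<sigma>\<close> caps the sum by \<open>pi/2\<close>.
  The right-hand side is visibly monotone in \<open>a\<close>, \<open>b\<close>, \<open>c\<close>, which the single summands are not.\<close>

lemma sum_angle_density:
  assumes "0 \<le> a" "0 \<le> b" "0 \<le> c" and p: "p \<in> {0<..<1}"
  defines "q \<equiv> cotangent p" and "s \<equiv> sigma2 a b c"
  shows "angle_density a s p + angle_density b s p + angle_density c s p
    = min (pi/2) (arctan (a/q) + arctan (b/q) + arctan (c/q))"
proof (cases "sqrt s \<le> q")
  case True
  have q: "0 < q" using p cotangent_pos by (simp add: q_def)
  have "s \<le> q\<^sup>2" using True q by (simp add: real_le_lsqrt sqrt_le_D)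
  then show ?thesis
    using arctan_scaled_sum_iff(1)[OF assms(1-3) q] True
    by (simp add: angle_density_def s_def sigma2_def max_def q_def min_def)
next
  case False
  have q: "0 < q" using p cotangent_pos by (simp add: q_def)
  have s: "0 < sqrt s" using False q by linarith
  have "arctan (a/sqrt s) + arctan (b/sqrt s) + arctan (c/sqrt s) = pi/2"
    using arctan_scaled_sum_iff[OF assms(1-3) s] s by (simp add: s_def sigma2_def)
  moreover have "\<not> s \<le> q\<^sup>2" using False q real_sqrt_le_iff[of s "q\<^sup>2"] by simp
  ultimately show ?thesis
    using arctan_scaled_sum_iff(1)[OF assms(1-3) q] False
    by (simp add: angle_density_def s_def sigma2_def max_def q_def min_def)
qed

definition total_turning :: "real \<Rightarrow> real \<Rightarrow> real \<Rightarrow> real" where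
  "total_turning a b c =
     turning a (sigma2 a b c) + turning b (sigma2 a b c) + turning c (sigma2 a b c)"

lemma sum_density_integrable:
  "(\<lambda>p. angle_density a s p + angle_density b s p + angle_density c s p) integrable_on {0<..<1}"
  by (intro integrable_add angle_density_integrable)

lemma sum_density_continuous:
  "continuous_on {0<..<1} (\<lambda>p. angle_density a s p + angle_density b s p + angle_density c s p)"
  by (intro continuous_intros continuous_on_angle_density)

lemma total_turning_integral:
  "total_turning a b c = 2 * integral {0<..<1} (\<lambda>p. angle_density a (sigma2 a b c) p
      + angle_density b (sigma2 a b c) p + angle_density c (sigma2 a b c) p)"
  unfolding total_turning_def turning_def
  by (simp add: integral_add angle_density_integrable integrable_add)

lemma cotangent_large:
  assumes "0 \<le> s" "p \<in> {sqrt (s / (1 + s))<..<1}"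
  shows "s < (cotangent p)\<^sup>2"
proof -
  have "0 \<le> sqrt (s/(1+s))" using assms by simp
  then have p: "0 < p" "p < 1" using assms(2) unfolding greaterThanLessThan_iff by linarith+
  have "s/(1+s) < p\<^sup>2"
    using assms p by (metis greaterThanLessThan_iff less_le_not_le not_le real_le_lsqrt real_sqrt_le_mono
        real_sqrt_unique linorder_not_less less_eq_real_def)
  then have "s * (1 - p\<^sup>2) < p\<^sup>2" using assms by (simp add: field_simps)
  then show ?thesis unfolding cotangent_square[OF p] using square_less_one[OF p]
    by (simp add: pos_less_divide_eq)
qed

text \<open>The integrands are ordered by \<open>sum_angle_density\<close>. The order is strict for \<open>p\<close> close to \<open>1\<close>,
  where the cap \<open>pi/2\<close> is not reached.\<close>

lemma total_turning_strict_mono: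
  assumes "0 \<le> a" "0 \<le> b" "0 \<le> c" "a \<le> a'" "b \<le> b'" "c \<le> c'"
    and ne: "a < a' \<or> b < b' \<or> c < c'"
  shows "total_turning a b c < total_turning a' b' c'"
proof -
  let ?s = "sigma2 a b c" and ?s' = "sigma2 a' b' c'"
  have nn: "0 \<le> a'" "0 \<le> b'" "0 \<le> c'" using assms by auto
  define b0 where "b0 = sqrt (?s' / (1 + ?s'))"
  have s': "0 \<le> ?s'" using nn by (rule sigma2_nonneg)
  have b0: "0 \<le> b0" "b0 < 1" unfolding b0_def using s' by (auto simp: real_sqrt_lt_1_iff)
  have q: "0 < cotangent p" if "p \<in> {0<..<1}" for p using that cotangent_pos by simp
  have mono: "arctan (x / cotangent p) \<le> arctan (y / cotangent p)"
    if "x \<le> y" "p \<in> {0<..<1}" for x y p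
    using q[OF that(2)] that(1) by (simp add: arctan_le_iff divide_right_mono)
  have smono: "arctan (x / cotangent p) < arctan (y / cotangent p)"
    if "x < y" "p \<in> {0<..<1}" for x y p
    using q[OF that(2)] that(1) by (simp add: arctan_less_iff divide_strict_right_mono)
  have "integral {0<..<1} (\<lambda>p. angle_density a ?s p + angle_density b ?s p + angle_density c ?s p)
      < integral {0<..<1} (\<lambda>p. angle_density a' ?s' p + angle_density b' ?s' p + angle_density c' ?s' p)"
  proof (rule integral_strict_mono_unit[OF sum_density_integrable sum_density_integrable
        sum_density_continuous sum_density_continuous _ _ b0])
    fix p :: real assume p: "p \<in> {0<..<1}"
    show "angle_density a ?s p + angle_density b ?s p + angle_density c ?s p
      \<le> angle_density a' ?s' p + angle_density b' ?s' p + angle_density c' ?s' p"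
      unfolding sum_angle_density[OF assms(1-3) p] sum_angle_density[OF nn p]
      using mono[OF assms(4) p] mono[OF assms(5) p] mono[OF assms(6) p] by (intro min.mono) auto
  next
    fix p assume "p \<in> {b0<..<1}"
    then have p: "p \<in> {0<..<1}" and "?s' < (cotangent p)\<^sup>2"
      using b0(1) cotangent_large[OF s'] unfolding b0_def[symmetric] by auto
    then have "arctan (a'/cotangent p) + arctan (b'/cotangent p) + arctan (c'/cotangent p) < pi/2"
      using arctan_scaled_sum_iff(2)[OF nn q[OF p]] by (simp add: sigma2_def)
    moreover have "arctan (a/cotangent p) + arctan (b/cotangent p) + arctan (c/cotangent p)
        < arctan (a'/cotangent p) + arctan (b'/cotangent p) + arctan (c'/cotangent p)"
      using ne mono[OF assms(4) p] mono[OF assms(5) p] mono[OF assms(6) p]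
        smono[OF _ p, of a a'] smono[OF _ p, of b b'] smono[OF _ p, of c c'] by linarith
    ultimately show "angle_density a ?s p + angle_density b ?s p + angle_density c ?s p
      < angle_density a' ?s' p + angle_density b' ?s' p + angle_density c' ?s' p"
      unfolding sum_angle_density[OF assms(1-3) p] sum_angle_density[OF nn p] by simp
  qed
  then show ?thesis unfolding total_turning_integral by simp
qed

lemma total_turning_mono:
  assumes "0 \<le> a" "0 \<le> b" "0 \<le> c" "a \<le> a'" "b \<le> b'" "c \<le> c'"
  shows "total_turning a b c \<le> total_turning a' b' c'"
  using total_turning_strict_mono[OF assms] assms
  by (cases "a = a' \<and> b = b' \<and> c = c'") auto

lemma total_turning_less_pi:
  assumes "0 \<le> a" "0 \<le> b" "0 \<le> c"
  shows "total_turning a b c < pi"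
proof -
  let ?s = "sigma2 a b c"
  have "total_turning a b c < total_turning (a+1) b c"
    using assms by (intro total_turning_strict_mono) auto
  also have "\<dots> \<le> 2 * integral {0<..<1::real} (\<lambda>p. pi/2)"
    unfolding total_turning_integral
  proof (intro mult_left_mono integral_le sum_density_integrable)
    show "(\<lambda>p. pi/2) integrable_on {0<..<1::real}"
      by (simp add: integrable_on_open_interval_real integrable_const_ivl)
    fix p :: real assume "p \<in> {0<..<1}"
    then show "angle_density (a+1) (sigma2 (a+1) b c) p + angle_density b (sigma2 (a+1) b c) p
        + angle_density c (sigma2 (a+1) b c) p \<le> pi/2"
      using assms sum_angle_density[of "a+1" b c p] min.cobounded1[of "pi/2"] by simp
  qed auto
  also have "\<dots> = pi" by (simp flip: integral_open_interval_real)
  finally show ?thesis .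
qed

lemma turning_at_infinity: "(\<lambda>n. turning (real n) 0) \<longlonglongrightarrow> pi"
proof -
  have "(\<lambda>n. integral {0<..<1} (angle_density (real n) 0)) \<longlonglongrightarrow> integral {0<..<1::real} (\<lambda>p. pi/2)"
  proof (rule dominated_convergence(2)[where h = "\<lambda>_. pi/2"])
    show "(\<lambda>p. pi/2) integrable_on {0<..<1::real}"
      by (simp add: integrable_on_open_interval_real integrable_const_ivl)
    fix p :: real assume "p \<in> {0<..<1}"
    then have "0 < max (cotangent p) (sqrt 0)" by (rule denominator_pos)
    then have "filterlim (\<lambda>n. real n / max (cotangent p) (sqrt 0)) at_top sequentially"
      unfolding divide_inverse
      by (intro filterlim_at_top_mult_tendsto_pos[OF tendsto_const] filterlim_real_sequentially) auto
    then show "(\<lambda>n. angle_density (real n) 0 p) \<longlonglongrightarrow> pi/2"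
      unfolding angle_density_def by (rule filterlim_compose[OF tendsto_arctan_at_top])
  qed (use angle_density_norm_le angle_density_integrable in auto)
  then have "(\<lambda>n. turning (real n) 0) \<longlonglongrightarrow> 2 * integral {0<..<1::real} (\<lambda>p. pi/2)"
    unfolding turning_def by (intro tendsto_intros)
  then show ?thesis by (simp flip: integral_open_interval_real)
qed

text \<open>By monotonicity it suffices to let one curvature tend to infinity while the other two vanish.\<close>

lemma total_turning_near_pi:
  assumes "0 < e"
  obtains R where "\<And>a b c. 0 \<le> a \<Longrightarrow> 0 \<le> b \<Longrightarrow> 0 \<le> c \<Longrightarrow> R \<le> a \<or> R \<le> b \<or> R \<le> c
     \<Longrightarrow> pi - e < total_turning a b c"
proof -
  have "\<forall>\<^sub>F n in sequentially. pi - e < turning (real n) 0"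
    using turning_at_infinity assms by (intro order_tendstoD) auto
  then obtain n where n: "pi - e < turning (real n) 0"
    unfolding eventually_sequentially by blast
  have eq: "total_turning (real n) 0 0 = turning (real n) 0"
       "total_turning 0 (real n) 0 = turning (real n) 0"
       "total_turning 0 0 (real n) = turning (real n) 0"
    by (simp_all add: total_turning_def sigma2_def)
  show thesis
  proof (rule that[of "real n"])
    fix a b c :: real assume nn: "0 \<le> a" "0 \<le> b" "0 \<le> c" "real n \<le> a \<or> real n \<le> b \<or> real n \<le> c"
    then show "pi - e < total_turning a b c"
      using n eq total_turning_mono[of "real n" 0 0 a b c] total_turning_mono[of 0 "real n" 0 a b c]
        total_turning_mono[of 0 0 "real n" a b c] by auto
  qed
qed

text \<open>This is an integration by parts. The density is the constant \<open>arctan (k / sqrt s)\<close> up to the point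
  \<open>p\<^sub>0\<close> where the cotangent reaches \<open>sqrt s\<close>; beyond it, partial integration with
  \<open>u = sqrt (1 - p\<^sup>2)\<close> produces the integrand on the right, and the boundary terms at \<open>p\<^sub>0\<close> cancel.\<close>

lemma turning_eq_arc_integral:
  assumes k: "0 < k" and s: "0 < s"
  shows "turning k s = k * integral {0..1/sqrt (1+s)} (\<lambda>u. 2 / (1 + (k\<^sup>2 - 1) * u\<^sup>2))"
proof -
  \<comment> \<open>The cotangent takes the value \<open>sqrt s\<close> at \<open>p0\<close>, the cosine of the angle with sine \<open>u0\<close>.\<close>
  define p0 where "p0 = sqrt (s/(1+s))"
  define u0 where "u0 = 1/sqrt (1+s)"
  have p0: "0 < p0" "p0 < 1" using s by (auto simp: p0_def real_sqrt_lt_1_iff)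
  have p0sq: "p0\<^sup>2 = s/(1+s)" using s by (simp add: p0_def)
  have u0: "0 < u0" "u0 < 1" using s by (auto simp: u0_def)
  have u0p0: "sqrt (1 - p0\<^sup>2) = u0"
    unfolding p0sq u0_def using s by (simp add: field_simps real_sqrt_divide)
  have denpos: "0 < 1 + (k\<^sup>2 - 1) * u\<^sup>2" if "0 \<le> u" "u < 1" for u
  proof -
    have "u\<^sup>2 < 1" using that by (simp add: power_less_one_iff abs_square_less_1)
    moreover have "1 + (k\<^sup>2 - 1) * u\<^sup>2 = (1 - u\<^sup>2) + k\<^sup>2 * u\<^sup>2" by (simp add: algebra_simps)
    ultimately show ?thesis using zero_le_power2[of "k*u"] unfolding power_mult_distrib by linarith
  qed
  define g where "g = (\<lambda>u. 1 / (1 + (k\<^sup>2 - 1) * u\<^sup>2))"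
  define G where "G = (\<lambda>x. integral {0..x} g)"
  have contg: "continuous_on {0..u0} g"
    unfolding g_def using denpos u0 by (intro continuous_intros) (auto simp: less_imp_neq[symmetric])
  have Gd: "(G has_real_derivative g x) (at x within {0..u0})" if "x \<in> {0..u0}" for x
    unfolding G_def by (rule integral_has_real_derivative[OF contg that])
  have Gd': "(G has_real_derivative g x) (at x)" if "0 < x" "x < u0" for x
    using Gd[of x] that by (simp add: at_within_Icc_at)
  have contG: "continuous_on {0..u0} G"
    using Gd DERIV_continuous unfolding continuous_on_eq_continuous_within by blast
  define H where "H = (\<lambda>p. p * arctan (k * sqrt (1 - p\<^sup>2) / p) - k * G (sqrt (1 - p\<^sup>2)))"
  have range: "sqrt (1 - p\<^sup>2) \<in> {0..u0}" if "p \<in> {p0..1}" for p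
  proof -
    have "p0\<^sup>2 \<le> p\<^sup>2" "p\<^sup>2 \<le> 1" using that p0 by (auto intro: power_mono power_le_one)
    then show ?thesis unfolding u0p0[symmetric] by simp
  qed
  have Hd: "(H has_vector_derivative arctan (k * sqrt (1 - p\<^sup>2) / p)) (at p)" if "p \<in> {p0<..<1}" for p
  proof -
    define u where "u = sqrt (1 - p\<^sup>2)"
    have p: "0 < p" "p < 1" using that p0 by auto
    have psq: "p0\<^sup>2 < p\<^sup>2" "p\<^sup>2 < 1"
      using that p0 by (auto intro: power_strict_mono square_less_one)
    have u: "0 < u" "u < u0" "u\<^sup>2 = 1 - p\<^sup>2"
      using psq unfolding u_def u0p0[symmetric] by auto
    have du: "((\<lambda>p. sqrt (1 - p\<^sup>2)) has_real_derivative - p / u) (at p)"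
      unfolding u_def using psq by (auto intro!: derivative_eq_intros simp: field_simps)
    have dG: "((\<lambda>p. G (sqrt (1 - p\<^sup>2))) has_real_derivative g u * (- p / u)) (at p)"
      using DERIV_chain2[OF Gd'[OF u(1,2), unfolded u_def] du] unfolding u_def .
    have den: "1 + (k * u / p)\<^sup>2 = (1 + (k\<^sup>2 - 1) * u\<^sup>2) / p\<^sup>2"
      using p u(3) by (simp add: power_mult_distrib power_divide field_simps)
    have dpos: "0 < 1 + (k\<^sup>2 - 1) * u\<^sup>2" using denpos[of u] u(1,2) u0 by linarith
    have dq: "((\<lambda>p. k * sqrt (1 - p\<^sup>2) / p) has_real_derivative - k / (u * p\<^sup>2)) (at p)"
    proof -
      have "(k * (- p / u) * p - k * u) / (p * p) = - k / (u * p\<^sup>2)"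
      proof -
        have "k * (- p / u) * p - k * u = - k * (p\<^sup>2 + u\<^sup>2) / u"
          using u(1) by (simp add: field_simps power2_eq_square)
        also have "p\<^sup>2 + u\<^sup>2 = 1" using u(3) by simp
        finally show ?thesis by (simp add: power2_eq_square)
      qed
      moreover have "((\<lambda>p. k * sqrt (1 - p\<^sup>2) / p) has_real_derivative (k * (- p / u) * p - k * u * 1) / (p * p)) (at p)"
        unfolding u_def
        by (rule DERIV_divide[OF DERIV_cmult[OF du[unfolded u_def]] DERIV_ident]) (use p in auto)
      ultimately show ?thesis by simp
    qed
    have "(H has_real_derivative (1 * arctan (k * u / p)
        + (inverse (1 + (k * u / p)\<^sup>2) * (- k / (u * p\<^sup>2))) * p) - k * (g u * (- p / u))) (at p)"
      unfolding H_def u_def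
      by (rule DERIV_diff[OF DERIV_mult[OF DERIV_ident DERIV_chain2[OF DERIV_arctan dq[unfolded u_def]]]
            DERIV_cmult[OF dG[unfolded u_def]]])
    moreover have "inverse (1 + (k * u / p)\<^sup>2) * (- k / (u * p\<^sup>2)) * p - k * (g u * (- p / u)) = 0"
    proof -
      have "inverse (D / p\<^sup>2) * (- k / (u * p\<^sup>2)) * p - k * (1 / D * (- p / u)) = 0" if "0 < D" for D
        using p u(1) that by (simp add: field_simps)
      then show ?thesis unfolding den g_def using dpos by blast
    qed
    ultimately show ?thesis
      by (simp add: has_real_derivative_iff_has_vector_derivative u_def)
  qed
  have contH: "continuous_on {p0..1} H"
    unfolding H_def using p0 range
    by (intro continuous_intros continuous_on_compose2[OF contG]) auto
  have intH: "((\<lambda>p. arctan (k * sqrt (1 - p\<^sup>2) / p)) has_integral (H 1 - H p0)) {p0..1}"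
    using p0 Hd contH by (intro fundamental_theorem_of_calculus_interior) auto
  have ang2: "angle_density k s p = arctan (k * sqrt (1 - p\<^sup>2) / p)" if "p \<in> {p0..1} - {1}" for p
  proof -
    have p: "0 < p" "p < 1" using that p0 by auto
    have "p0\<^sup>2 \<le> p\<^sup>2" using that p0 by (auto intro: power_mono)
    then have "s \<le> (cotangent p)\<^sup>2"
      unfolding p0sq cotangent_square[OF p] using square_less_one[OF p] s by (simp add: field_simps)
    then have "sqrt s \<le> cotangent p"
      using cotangent_pos[OF p] by (simp add: real_le_lsqrt)
    then show ?thesis unfolding angle_density_def by (simp add: cotangent_def max_absorb1)
  qed
  have int2: "(angle_density k s has_integral (H 1 - H p0)) {p0..1}"
    by (rule has_integral_spike_finite[of "{1}", OF _ ang2 intH]) auto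
  have ang1: "angle_density k s p = arctan (k / sqrt s)" if "p \<in> {0..p0} - {0}" for p
  proof -
    have p: "0 < p" "p < 1" using that p0 by auto
    have "p\<^sup>2 \<le> p0\<^sup>2" using that p0 by (auto intro: power_mono)
    then have "(cotangent p)\<^sup>2 \<le> s"
      unfolding p0sq cotangent_square[OF p] using square_less_one[OF p] s by (simp add: field_simps)
    then have "cotangent p \<le> sqrt s" by (rule real_le_rsqrt)
    then show ?thesis unfolding angle_density_def by (simp add: max_absorb2)
  qed
  have intc: "((\<lambda>p. arctan (k / sqrt s)) has_integral p0 * arctan (k / sqrt s)) {0..p0}"
    using has_integral_const_real[of "arctan (k / sqrt s)" 0 p0] p0 by simp
  have int1: "(angle_density k s has_integral p0 * arctan (k / sqrt s)) {0..p0}"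
    by (rule has_integral_spike_finite[of "{0}", OF _ ang1 intc]) auto
  have "(angle_density k s has_integral p0 * arctan (k / sqrt s) + (H 1 - H p0)) {0..1}"
    by (rule has_integral_combine[OF _ _ int1 int2]) (use p0 in auto)
  moreover have "k * u0 / p0 = k / sqrt s"
    unfolding p0_def u0_def using s by (simp add: real_sqrt_divide)
  moreover have "G 0 = 0" unfolding G_def by simp
  ultimately have "(angle_density k s has_integral k * G u0) {0..1}"
    unfolding H_def u0p0 by simp
  then have "integral {0<..<1} (angle_density k s) = k * G u0"
    unfolding integral_open_interval_real[symmetric] by (rule integral_unique)
  moreover have "integral {0..u0} (\<lambda>u. 2 / (1 + (k\<^sup>2 - 1) * u\<^sup>2)) = 2 * G u0"
    unfolding G_def g_def integral_mult_right[symmetric] by simp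
  ultimately show ?thesis unfolding turning_def u0_def by simp
qed

section \<open>Perron's method for monotone maps of the orthant\<close>

text \<open>Perron's method. For a target \<open>t\<close> consider the set \<open>sub t\<close> of all \<open>k\<close> with \<open>\<Theta> k \<le> t\<close>. By
  monotonicity it is closed under componentwise maxima. It is bounded: otherwise all coordinates
  in some set \<open>I\<close> could be made large simultaneously, and then the sum of \<open>\<Theta> k\<close> over \<open>I\<close> would
  approach \<open>c I\<close>, which exceeds the sum of \<open>t\<close>. So \<open>sub t\<close> is compact, and at a point with maximal
  coordinate sum equality holds, since a coordinate with strict inequality could still be raised.
  The comparison hypothesis on the sums over \<open>{i. k i < k' i}\<close> gives injectivity, and the boundedness
  of \<open>sub t'\<close> for \<open>t'\<close> slightly above \<open>t\<close> reduces the continuity of the inverse to the compact case.\<close>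

lemma perron_homeomorphism:
  fixes \<Theta> :: "real ^ 'v::finite \<Rightarrow> real ^ 'v" and c :: "'v set \<Rightarrow> real"
  defines "T \<equiv> {t. (\<forall>v. 0 \<le> t $ v) \<and> (\<forall>I. I \<noteq> {} \<longrightarrow> (\<Sum>i\<in>I. t $ i) < c I)}"
  assumes cont: "continuous_on closed_\<Omega>\<^sub>k \<Theta>"
    and less: "\<And>k k' i. k \<in> closed_\<Omega>\<^sub>k \<Longrightarrow> k' \<in> closed_\<Omega>\<^sub>k \<Longrightarrow> k $ i < k' $ i \<Longrightarrow>
      (\<Sum>i\<in>{i. k $ i < k' $ i}. \<Theta> k $ i) < (\<Sum>i\<in>{i. k $ i < k' $ i}. \<Theta> k' $ i)"
    and anti: "\<And>k k' i. k \<in> closed_\<Omega>\<^sub>k \<Longrightarrow> k' \<in> closed_\<Omega>\<^sub>k \<Longrightarrow> (\<And>j. k $ j \<le> k' $ j) \<Longrightarrow>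
      k $ i = k' $ i \<Longrightarrow> \<Theta> k' $ i \<le> \<Theta> k $ i"
    and nonneg: "\<And>k i. k \<in> closed_\<Omega>\<^sub>k \<Longrightarrow> 0 \<le> \<Theta> k $ i"
    and zero: "\<And>k i. k \<in> closed_\<Omega>\<^sub>k \<Longrightarrow> k $ i = 0 \<Longrightarrow> \<Theta> k $ i = 0"
    and bound: "\<And>k I. k \<in> closed_\<Omega>\<^sub>k \<Longrightarrow> I \<noteq> {} \<Longrightarrow> (\<Sum>i\<in>I. \<Theta> k $ i) < c I"
    and limit: "\<And>I M e. I \<noteq> {} \<Longrightarrow> 0 < e \<Longrightarrow> \<exists>R. \<forall>k\<in>closed_\<Omega>\<^sub>k.
      (\<forall>i\<in>I. R \<le> k $ i) \<longrightarrow> (\<forall>i. i \<notin> I \<longrightarrow> k $ i \<le> M) \<longrightarrow> c I - e < (\<Sum>i\<in>I. \<Theta> k $ i)"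
  shows "\<exists>\<Psi>. homeomorphism closed_\<Omega>\<^sub>k T \<Theta> \<Psi>"
proof -
  let ?K = "closed_\<Omega>\<^sub>k :: (real ^ 'v) set"
  define sub where "sub = (\<lambda>t. {k \<in> ?K. \<forall>i. \<Theta> k $ i \<le> t $ i})"
  have inj: "inj_on \<Theta> ?K"
  proof (rule inj_onI, rule ccontr)
    fix k k' assume k: "k \<in> ?K" "k' \<in> ?K" "\<Theta> k = \<Theta> k'" "k \<noteq> k'"
    then obtain i where "k $ i \<noteq> k' $ i" by (metis vec_eq_iff)
    then have "k $ i < k' $ i \<or> k' $ i < k $ i" by linarith
    then show False using less[of k k' i] less[of k' k i] k by auto
  qed
  have max_closed: "(\<chi> i. max (k $ i) (k' $ i)) \<in> sub t" if "k \<in> sub t" "k' \<in> sub t" for t k k'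
  proof -
    let ?m = "(\<chi> i. max (k $ i) (k' $ i)) :: real ^ 'v"
    have k: "k \<in> ?K" "k' \<in> ?K" and m: "?m \<in> ?K"
      using that by (auto simp: sub_def closed_\<Omega>\<^sub>k_def le_max_iff_disj)
    have "\<Theta> ?m $ i \<le> t $ i" for i
    proof (cases "k' $ i \<le> k $ i")
      case True
      then have "\<Theta> ?m $ i \<le> \<Theta> k $ i" by (intro anti[OF k(1) m]) auto
      also have "\<dots> \<le> t $ i" using that by (simp add: sub_def)
      finally show ?thesis .
    next
      case False
      then have "\<Theta> ?m $ i \<le> \<Theta> k' $ i" by (intro anti[OF k(2) m]) auto
      also have "\<dots> \<le> t $ i" using that by (simp add: sub_def)
      finally show ?thesis .
    qed
    then show ?thesis using m by (simp add: sub_def)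
  qed
  have bounded_sub: "\<exists>B. \<forall>k\<in>sub t. \<forall>i. k $ i \<le> B"
    if t: "\<And>I. I \<noteq> {} \<Longrightarrow> (\<Sum>i\<in>I. t $ i) < c I" for t
  proof -
    \<comment> \<open>The coordinates that are unbounded on \<open>sub t\<close>; maxima make them large at the same time.\<close>
    define I where "I = {i. \<forall>R. \<exists>k\<in>sub t. R \<le> k $ i}"
    have "\<forall>i. \<exists>b. i \<notin> I \<longrightarrow> (\<forall>k\<in>sub t. k $ i \<le> b)"
      unfolding I_def by (auto simp: not_le) (meson less_imp_le)
    then obtain b where b: "\<And>i k. i \<notin> I \<Longrightarrow> k \<in> sub t \<Longrightarrow> k $ i \<le> b i" by metis
    define M where "M = Max (range b)"
    have M: "k $ i \<le> M" if "i \<notin> I" "k \<in> sub t" for i k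
      using b[OF that] unfolding M_def by (meson Max_ge finite finite_imageI order_trans rangeI)
    have "I = {}"
    proof (rule ccontr)
      assume "I \<noteq> {}"
      then have "0 < c I - (\<Sum>i\<in>I. t $ i)" using t by simp
      then obtain R where R: "\<And>k. k \<in> ?K \<Longrightarrow> (\<And>i. i \<in> I \<Longrightarrow> R \<le> k $ i) \<Longrightarrow>
          (\<And>i. i \<notin> I \<Longrightarrow> k $ i \<le> M) \<Longrightarrow> c I - (c I - (\<Sum>i\<in>I. t $ i)) < (\<Sum>i\<in>I. \<Theta> k $ i)"
        using limit[OF \<open>I \<noteq> {}\<close>] by metis
      have "\<exists>k\<in>sub t. \<forall>i\<in>J. R \<le> k $ i" if "finite J" "J \<noteq> {}" "J \<subseteq> I" for J
        using that
      proof (induction J rule: finite_ne_induct)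
        case (singleton i)
        then show ?case by (auto simp: I_def)
      next
        case (insert i J)
        then obtain k where "k \<in> sub t" "\<forall>i\<in>J. R \<le> k $ i" by blast
        moreover obtain k' where "k' \<in> sub t" "R \<le> k' $ i"
          using insert.prems unfolding I_def by blast
        ultimately show ?case
          by (intro bexI[OF _ max_closed[of k t k']]) (auto simp: le_max_iff_disj)
      qed
      from this[of I] obtain k where k: "k \<in> sub t" "\<forall>i\<in>I. R \<le> k $ i"
        using \<open>I \<noteq> {}\<close> by auto
      then have "(\<Sum>i\<in>I. t $ i) < (\<Sum>i\<in>I. \<Theta> k $ i)"
        using R[of k] M by (auto simp: sub_def)
      moreover have "(\<Sum>i\<in>I. \<Theta> k $ i) \<le> (\<Sum>i\<in>I. t $ i)"
        using k by (intro sum_mono) (simp add: sub_def)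
      ultimately show False by simp
    qed
    then show ?thesis using M by blast
  qed
  have closedK: "closed ?K"
    unfolding closed_\<Omega>\<^sub>k_def Collect_all_eq
    by (intro closed_INT ballI closed_Collect_le continuous_intros)
  have compact_sub: "compact (sub t)" if t: "\<And>I. I \<noteq> {} \<Longrightarrow> (\<Sum>i\<in>I. t $ i) < c I" for t
  proof -
    obtain B where B: "\<And>k i. k \<in> sub t \<Longrightarrow> k $ i \<le> B" using bounded_sub[OF t] by blast
    have eq: "sub t = ?K \<inter> \<Theta> -` {s. \<forall>i. s $ i \<le> t $ i}" by (auto simp: sub_def)
    have "closed {s :: real ^ 'v. \<forall>i. s $ i \<le> t $ i}"
      unfolding Collect_all_eq by (intro closed_INT ballI closed_Collect_le continuous_intros)
    then have "closed (sub t)"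
      unfolding eq by (rule continuous_closed_preimage[OF cont closedK])
    moreover have "sub t \<subseteq> cbox 0 (\<chi> i. B)"
      using B by (auto simp: sub_def mem_box_cart closed_\<Omega>\<^sub>k_def)
    ultimately show ?thesis
      by (meson bounded_cbox bounded_subset compact_eq_bounded_closed)
  qed
  have image: "\<Theta> ` ?K = T"
  proof
    show "\<Theta> ` ?K \<subseteq> T" using nonneg bound unfolding T_def image_subset_iff mem_Collect_eq by simp
    show "T \<subseteq> \<Theta> ` ?K"
    proof
      fix t assume t: "t \<in> T"
      have "compact (sub t)" by (rule compact_sub) (use t in \<open>auto simp: T_def\<close>)
      moreover have "0 \<in> sub t"
        using t zero[of 0] by (auto simp: sub_def T_def closed_\<Omega>\<^sub>k_def)
      moreover have "continuous_on (sub t) (\<lambda>k. \<Sum>i\<in>UNIV. k $ i)" by (intro continuous_intros)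
      ultimately obtain k where k: "k \<in> sub t"
        and max: "\<And>k'. k' \<in> sub t \<Longrightarrow> (\<Sum>i\<in>UNIV. k' $ i) \<le> (\<Sum>i\<in>UNIV. k $ i)"
        using continuous_attains_sup[of "sub t" "\<lambda>k. \<Sum>i\<in>UNIV. k $ i"] by blast
      have kK: "k \<in> ?K" using k by (simp add: sub_def)
      have "\<Theta> k $ i = t $ i" for i
      proof (rule ccontr)
        assume "\<Theta> k $ i \<noteq> t $ i"
        then have lt: "\<Theta> k $ i < t $ i" using k by (simp add: sub_def order_less_le)
        \<comment> \<open>Raising \<open>k $ i\<close> slightly stays in \<open>sub t\<close>: the other components of \<open>\<Theta>\<close> decrease.\<close>
        define g where "g = (\<lambda>d::real. k + d *\<^sub>R axis i 1)"
        have gK: "g d \<in> ?K" if "0 \<le> d" for d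
          using kK that by (auto simp: g_def closed_\<Omega>\<^sub>k_def axis_def)
        have "continuous_on {0..} (\<lambda>d. \<Theta> (g d))"
        proof (rule continuous_on_compose2[OF cont])
          show "continuous_on {0..} g" unfolding g_def by (intro continuous_intros)
        qed (use gK in auto)
        then have "continuous_on {0..} (\<lambda>d. \<Theta> (g d) $ i)" by (intro continuous_intros)
        then have "((\<lambda>d. \<Theta> (g d) $ i) \<longlongrightarrow> \<Theta> (g 0) $ i) (at 0 within {0..})"
          by (simp add: continuous_on)
        then have "((\<lambda>d. \<Theta> (g d) $ i) \<longlongrightarrow> \<Theta> k $ i) (at_right 0)"
          by (rule tendsto_within_subset[THEN tendsto_eq_rhs]) (auto simp: g_def)
        then have "\<forall>\<^sub>F d in at_right 0. \<Theta> (g d) $ i < t $ i"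
          by (rule order_tendstoD(2)[OF _ lt])
        moreover have "\<forall>\<^sub>F d in at_right (0::real). 0 < d"
          by (auto simp: eventually_at_right_less)
        ultimately have "\<forall>\<^sub>F d in at_right 0. \<Theta> (g d) $ i < t $ i \<and> 0 < d"
          by (rule eventually_conj)
        then obtain d where d: "\<Theta> (g d) $ i < t $ i" "0 < d"
          using eventually_happens' trivial_limit_at_right_real by blast
        have "\<Theta> (g d) $ j \<le> t $ j" for j
        proof (cases "j = i")
          case False
          then have "\<Theta> (g d) $ j \<le> \<Theta> k $ j"
            using d by (intro anti[OF kK gK]) (auto simp: g_def axis_def)
          also have "\<dots> \<le> t $ j" using k by (simp add: sub_def)
          finally show ?thesis .
        qed (use d in simp)
        then have "g d \<in> sub t" using gK[of d] d by (simp add: sub_def)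
        from max[OF this] have "d * (\<Sum>j\<in>UNIV. axis i 1 $ j) \<le> 0"
          by (simp add: g_def sum.distrib sum_distrib_left)
        then show False using d by (simp add: axis_def)
      qed
      then have "\<Theta> k = t" by (simp add: vec_eq_iff)
      then show "t \<in> \<Theta> ` ?K" using kK by blast
    qed
  qed
  define \<Psi> where "\<Psi> = inv_into ?K \<Theta>"
  have \<Psi>: "\<Psi> (\<Theta> k) = k" if "k \<in> ?K" for k using that inj by (simp add: \<Psi>_def)
  have "continuous_on T \<Psi>"
    unfolding continuous_on_eq_continuous_within
  proof
    fix t assume t: "t \<in> T"
    \<comment> \<open>Adding \<open>e\<close> to every coordinate of \<open>t\<close> preserves the finitely many strict inequalities.\<close>
    define e where "e = Min ((\<lambda>I. (c I - (\<Sum>i\<in>I. t $ i)) / (real (card I) + 1)) ` {I. I \<noteq> {}})"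
    have fin: "finite {I :: 'v set. I \<noteq> {}}" by simp
    have ne: "{I :: 'v set. I \<noteq> {}} \<noteq> {}" by auto
    have "0 < e" unfolding e_def using t
      by (subst Min_gr_iff) (auto simp: T_def intro!: divide_pos_pos)
    define t' where "t' = t + (\<chi> i. e)"
    have t': "(\<Sum>i\<in>I. t' $ i) < c I" if "I \<noteq> {}" for I
    proof -
      have "e \<le> (c I - (\<Sum>i\<in>I. t $ i)) / (real (card I) + 1)"
        unfolding e_def using that by (intro Min_le) auto
      then have "e * (real (card I) + 1) \<le> c I - (\<Sum>i\<in>I. t $ i)"
        by (simp add: pos_le_divide_eq add_nonneg_pos)
      then show ?thesis using \<open>0 < e\<close> by (simp add: t'_def sum.distrib algebra_simps)
    qed
    define U where "U = {s. \<forall>i. s $ i < t' $ i}"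
    have "open U" unfolding U_def Collect_all_eq
      by (intro open_INT ballI open_Collect_less continuous_intros) auto
    have "t \<in> U" using \<open>0 < e\<close> by (simp add: U_def t'_def)
    have "continuous_on (\<Theta> ` sub t') \<Psi>"
      by (rule continuous_on_inv[OF continuous_on_subset[OF cont] compact_sub[OF t']])
        (auto simp: sub_def \<Psi>)
    moreover have "T \<inter> U \<subseteq> \<Theta> ` sub t'"
    proof
      fix s assume s: "s \<in> T \<inter> U"
      then obtain k where "k \<in> ?K" "s = \<Theta> k" using image by blast
      then show "s \<in> \<Theta> ` sub t'" using s by (auto simp: sub_def U_def less_imp_le)
    qed
    ultimately have "continuous_on (T \<inter> U) \<Psi>" by (rule continuous_on_subset)
    then have "continuous (at t within (T \<inter> U)) \<Psi>"
      using t \<open>t \<in> U\<close> by (simp add: continuous_on_eq_continuous_within)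
    moreover have "at t within (T \<inter> U) = at t within T"
      by (rule at_within_nhd[OF \<open>t \<in> U\<close> \<open>open U\<close>]) auto
    ultimately show "continuous (at t within T) \<Psi>" by simp
  qed
  then have "homeomorphism ?K T \<Theta> \<Psi>"
    using cont image \<Psi> by (auto simp: homeomorphism_def image_iff)
  then show ?thesis by blast
qed

section \<open>Turning at the vertices of a triangulation\<close>

text \<open>The second elementary symmetric function of the coordinates in \<open>A\<close>. Written with power sums it
  does not refer to an enumeration of \<open>A\<close>.\<close>

definition elementary2 :: "'v set \<Rightarrow> real ^ 'v::finite \<Rightarrow> real" where
  "elementary2 A k = ((\<Sum>i\<in>A. k $ i)\<^sup>2 - (\<Sum>i\<in>A. (k $ i)\<^sup>2)) / 2"

lemma elementary2_triple:
  assumes "a \<noteq> b" "b \<noteq> c" "c \<noteq> a"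
  shows "elementary2 {a, b, c} k = sigma2 (k $ a) (k $ b) (k $ c)"
  using assms unfolding elementary2_def sigma2_def
  by (simp add: power2_eq_square algebra_simps)

lemma sum_turning_triple:
  assumes "a \<noteq> b" "b \<noteq> c" "c \<noteq> a"
  shows "(\<Sum>i\<in>{a, b, c}. turning (k $ i) (elementary2 {a, b, c} k))
    = total_turning (k $ a) (k $ b) (k $ c)"
  using assms by (simp add: elementary2_triple total_turning_def)

lemma card_3_cyclic:
  assumes "card A = 3"
  obtains a b c where "A = {a, b, c}" "a \<noteq> b" "b \<noteq> c" "c \<noteq> a"
  using assms by (metis card_3_iff)

lemma elementary2_nonneg_mono:
  assumes "card A = 3" "k \<in> closed_\<Omega>\<^sub>k" "k' \<in> closed_\<Omega>\<^sub>k" "\<And>i. i \<in> A \<Longrightarrow> k $ i \<le> k' $ i"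
  shows "0 \<le> elementary2 A k" "elementary2 A k \<le> elementary2 A k'"
proof -
  obtain a b c where A: "A = {a, b, c}" "a \<noteq> b" "b \<noteq> c" "c \<noteq> a"
    using card_3_cyclic[OF assms(1)] .
  have "0 \<le> elementary2 A k \<and> elementary2 A k \<le> elementary2 A k'"
    unfolding A(1) elementary2_triple[OF A(2-4)]
    using assms(2-4) A(1) by (auto intro!: sigma2_nonneg sigma2_mono simp: closed_\<Omega>\<^sub>k_def)
  then show "0 \<le> elementary2 A k" "elementary2 A k \<le> elementary2 A k'" by auto
qed

text \<open>Raising the other curvatures in a triangle lowers the turning at a vertex: it only raises \<open>s\<close>.\<close>

lemma turning_face_antimono:
  assumes A: "card A = 3" and k: "k \<in> closed_\<Omega>\<^sub>k" "k' \<in> closed_\<Omega>\<^sub>k"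
    and le: "\<And>j. j \<in> A \<Longrightarrow> k $ j \<le> k' $ j" and eq: "k $ i = k' $ i"
  shows "turning (k' $ i) (elementary2 A k') \<le> turning (k $ i) (elementary2 A k)"
  using elementary2_nonneg_mono[OF A k le] k eq
  by (auto intro!: turning_antimono simp: closed_\<Omega>\<^sub>k_def)

lemma face_sum_strict_mono:
  assumes A: "card A = 3" and k: "k \<in> closed_\<Omega>\<^sub>k" "k' \<in> closed_\<Omega>\<^sub>k"
    and le: "\<And>j. j \<in> A \<Longrightarrow> k $ j \<le> k' $ j" and less: "i \<in> A" "k $ i < k' $ i"
  shows "(\<Sum>i\<in>A. turning (k $ i) (elementary2 A k)) < (\<Sum>i\<in>A. turning (k' $ i) (elementary2 A k'))"
proof -
  obtain a b c where abc: "A = {a, b, c}" "a \<noteq> b" "b \<noteq> c" "c \<noteq> a"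
    using card_3_cyclic[OF A] .
  show ?thesis
    unfolding abc(1) sum_turning_triple[OF abc(2-4)]
    using le less k abc(1) by (intro total_turning_strict_mono) (auto simp: closed_\<Omega>\<^sub>k_def)
qed

text \<open>Pass from \<open>k\<close> to the maximum of \<open>k\<close> and \<open>k'\<close>: the sum over the whole face grows while the terms
  outside \<open>I\<close> shrink. Then pass down to \<open>k'\<close>: only coordinates outside \<open>I\<close> decrease, so the terms
  in \<open>I\<close> grow again.\<close>

lemma face_partial_sum_strict_mono:
  assumes A: "card A = 3" and k: "k \<in> closed_\<Omega>\<^sub>k" "k' \<in> closed_\<Omega>\<^sub>k"
    and i: "i \<in> A" "k $ i < k' $ i"
  defines "I \<equiv> {i. k $ i < k' $ i}"
  shows "(\<Sum>i\<in>A \<inter> I. turning (k $ i) (elementary2 A k))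
    < (\<Sum>i\<in>A \<inter> I. turning (k' $ i) (elementary2 A k'))"
proof -
  define m where "m = (\<chi> i. max (k $ i) (k' $ i))"
  have m: "m \<in> closed_\<Omega>\<^sub>k" using k by (auto simp: m_def closed_\<Omega>\<^sub>k_def le_max_iff_disj)
  have fin: "finite A" using A by (metis card.infinite zero_neq_numeral)
  have split: "(\<Sum>i\<in>A \<inter> I. f i) = (\<Sum>i\<in>A. f i) - (\<Sum>i\<in>A - I. f i)" for f :: "'a \<Rightarrow> real"
    using sum.Int_Diff[OF fin, of f I] by simp
  have "(\<Sum>i\<in>A. turning (k $ i) (elementary2 A k)) < (\<Sum>i\<in>A. turning (m $ i) (elementary2 A m))"
    using i by (intro face_sum_strict_mono[OF A k(1) m]) (auto simp: m_def)
  moreover have "(\<Sum>i\<in>A - I. turning (m $ i) (elementary2 A m))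
      \<le> (\<Sum>i\<in>A - I. turning (k $ i) (elementary2 A k))"
    by (intro sum_mono turning_face_antimono[OF A k(1) m]) (auto simp: m_def I_def)
  moreover have "(\<Sum>i\<in>A \<inter> I. turning (m $ i) (elementary2 A m))
      \<le> (\<Sum>i\<in>A \<inter> I. turning (k' $ i) (elementary2 A k'))"
    by (intro sum_mono turning_face_antimono[OF A k(2) m]) (auto simp: m_def I_def)
  ultimately show ?thesis using split[of "\<lambda>i. turning (k $ i) (elementary2 A k)"]
      split[of "\<lambda>i. turning (m $ i) (elementary2 A m)"] by linarith
qed

lemma face_partial_sum_less_pi:
  assumes A: "card A = 3" and k: "k \<in> closed_\<Omega>\<^sub>k"
  shows "(\<Sum>i\<in>A \<inter> I. turning (k $ i) (elementary2 A k)) < pi"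
proof -
  obtain a b c where abc: "A = {a, b, c}" "a \<noteq> b" "b \<noteq> c" "c \<noteq> a"
    using card_3_cyclic[OF A] .
  have "(\<Sum>i\<in>A \<inter> I. turning (k $ i) (elementary2 A k)) \<le> (\<Sum>i\<in>A. turning (k $ i) (elementary2 A k))"
    using k by (intro sum_mono2) (auto simp: abc(1) closed_\<Omega>\<^sub>k_def intro!: turning_nonneg)
  also have "\<dots> < pi"
    unfolding abc(1) sum_turning_triple[OF abc(2-4)]
    using k by (intro total_turning_less_pi) (auto simp: closed_\<Omega>\<^sub>k_def)
  finally show ?thesis .
qed

lemma turning_le_sqrt_ratio:
  assumes "0 \<le> a" "a \<le> M" "0 < R" "a * R \<le> s"
  shows "turning a s \<le> 2 * sqrt (M / R)"
proof (cases "a = 0")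
  case False
  then have a: "0 < a" using assms by simp
  then have s: "0 < a * R" using assms by simp
  have "turning a s \<le> turning a (a * R)" using assms s by (intro turning_antimono) auto
  also have "\<dots> \<le> 2 * a / sqrt (a * R)" using a s by (intro turning_le) auto
  also have "\<dots> = 2 * sqrt (a / R)"
    using a assms by (simp add: real_sqrt_mult real_sqrt_divide field_simps)
  also have "\<dots> \<le> 2 * sqrt (M / R)" using assms by (simp add: divide_right_mono)
  finally show ?thesis .
qed (use assms in simp)

text \<open>The sum over the whole face is close to \<open>pi\<close>, and a term outside \<open>I\<close> is small because \<open>s\<close> is at
  least the product of its curvature with one that exceeds \<open>R\<close>.\<close>

lemma face_partial_sum_near_pi:
  assumes A: "card A = 3" and e: "0 < e"
  shows "\<exists>R0. \<forall>R\<ge>R0. \<forall>k\<in>closed_\<Omega>\<^sub>k. \<forall>i\<in>A \<inter> I. (\<forall>i\<in>I. R \<le> k $ i) \<longrightarrow>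
    (\<forall>i. i \<notin> I \<longrightarrow> k $ i \<le> M) \<longrightarrow> pi - e < (\<Sum>i\<in>A \<inter> I. turning (k $ i) (elementary2 A k))"
proof -
  obtain a b c where abc: "A = {a, b, c}" "a \<noteq> b" "b \<noteq> c" "c \<noteq> a"
    using card_3_cyclic[OF A] .
  obtain R1 where R1: "\<And>a b c. 0 \<le> a \<Longrightarrow> 0 \<le> b \<Longrightarrow> 0 \<le> c \<Longrightarrow> R1 \<le> a \<or> R1 \<le> b \<or> R1 \<le> c
     \<Longrightarrow> pi - e/2 < total_turning a b c"
    using total_turning_near_pi[of "e/2"] e by auto
  define M' where "M' = max M 0"
  \<comment> \<open>For \<open>R \<ge> R0\<close> each of the at most three terms outside \<open>I\<close> is at most \<open>2 sqrt (M' / R) \<le> e / 6\<close>.\<close>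
  define R0 where "R0 = max R1 (max 1 (144 * M' / e\<^sup>2))"
  show ?thesis
  proof (intro exI[of _ R0] allI ballI impI)
    fix R k i assume R: "R0 \<le> R" and k: "k \<in> closed_\<Omega>\<^sub>k" and i: "i \<in> A \<inter> I"
      and large: "\<forall>i\<in>I. R \<le> k $ i" and small: "\<forall>i. i \<notin> I \<longrightarrow> k $ i \<le> M"
    have Rpos: "1 \<le> R" "R1 \<le> R" "144 * M' / e\<^sup>2 \<le> R" using R by (auto simp: R0_def)
    have knn: "0 \<le> k $ j" for j using k by (simp add: closed_\<Omega>\<^sub>k_def)
    have iR: "R \<le> k $ i" using i large by blast
    have total: "pi - e/2 < (\<Sum>i\<in>A. turning (k $ i) (elementary2 A k))"
      unfolding abc(1) sum_turning_triple[OF abc(2-4)]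
      using i abc(1) iR Rpos by (intro R1 knn) auto
    have "M' / R \<le> (e/12)\<^sup>2"
      using Rpos e by (simp add: field_simps)
    then have "sqrt (M' / R) \<le> e/12" using e real_le_lsqrt[of "e/12" "M'/R"] by simp
    have "(\<Sum>j\<in>A - I. turning (k $ j) (elementary2 A k)) \<le> (\<Sum>j\<in>A - I. 2 * (e/12))"
    proof (rule sum_mono)
      fix j assume j: "j \<in> A - I"
      have "k $ j * R \<le> elementary2 A k"
      proof -
        have "k $ j * R \<le> k $ j * k $ i" using iR knn by (intro mult_left_mono) auto
        also have "\<dots> \<le> elementary2 A k"
          unfolding abc(1) elementary2_triple[OF abc(2-4)] sigma2_def
          using i j abc knn by (auto simp: mult.commute)
        finally show ?thesis .
      qed
      then have "turning (k $ j) (elementary2 A k) \<le> 2 * sqrt (M' / R)"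
        using j small knn Rpos by (intro turning_le_sqrt_ratio) (auto simp: M'_def le_max_iff_disj)
      also have "\<dots> \<le> 2 * (e/12)" using \<open>sqrt (M' / R) \<le> e/12\<close> by simp
      finally show "turning (k $ j) (elementary2 A k) \<le> 2 * (e/12)" .
    qed
    also have "\<dots> \<le> 3 * (2 * (e/12))"
    proof -
      have "card (A - I) \<le> 3" using A card_mono[of A "A - I"] by (simp add: abc(1))
      then show ?thesis using e by simp
    qed
    finally have "(\<Sum>j\<in>A - I. turning (k $ j) (elementary2 A k)) \<le> e/2" by simp
    moreover have "(\<Sum>i\<in>A \<inter> I. turning (k $ i) (elementary2 A k)) + (\<Sum>j\<in>A - I. turning (k $ j) (elementary2 A k))
       = (\<Sum>i\<in>A. turning (k $ i) (elementary2 A k))"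
      by (rule sum.Int_Diff[symmetric]) (simp add: abc(1))
    ultimately show "pi - e < (\<Sum>i\<in>A \<inter> I. turning (k $ i) (elementary2 A k))"
      using total by linarith
  qed
qed

text \<open>Exchanging the order of summation turns the sum over a set \<open>I\<close> of vertices into a sum over the
  faces that meet \<open>I\<close>, so that the hypotheses of Perron's method become statements about one face.\<close>

lemma turning_map_homeomorphism:
  fixes F :: "'f set" and vs :: "'f \<Rightarrow> 'v::finite set"
  assumes fin: "finite F" and card: "\<And>f. f \<in> F \<Longrightarrow> card (vs f) = 3"
    and cover: "\<And>v. \<exists>f\<in>F. v \<in> vs f"
  defines "\<Theta> \<equiv> \<lambda>k. \<chi> v. \<Sum>f\<in>{f \<in> F. v \<in> vs f}. turning (k $ v) (elementary2 (vs f) k)"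
  shows "\<exists>\<Psi>. homeomorphism closed_\<Omega>\<^sub>k {t. (\<forall>v. 0 \<le> t $ v) \<and>
      (\<forall>I. I \<noteq> {} \<longrightarrow> (\<Sum>i\<in>I. t $ i) < pi * real (card {f \<in> F. vs f \<inter> I \<noteq> {}}))} \<Theta> \<Psi>"
    and "\<And>k v. k \<in> closed_\<Omega>\<^sub>k \<Longrightarrow> \<Theta> k $ v = 0 \<longleftrightarrow> k $ v = 0"
proof -
  have sum_I: "(\<Sum>i\<in>I. \<Theta> k $ i)
      = (\<Sum>f\<in>{f \<in> F. vs f \<inter> I \<noteq> {}}. \<Sum>i\<in>vs f \<inter> I. turning (k $ i) (elementary2 (vs f) k))" for I k
  proof -
    have "(\<Sum>i\<in>I. \<Theta> k $ i) = (\<Sum>f\<in>F. \<Sum>i\<in>{i \<in> I. i \<in> vs f}. turning (k $ i) (elementary2 (vs f) k))"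
      unfolding \<Theta>_def vec_lambda_beta by (rule sum.swap_restrict) (use fin in auto)
    also have "\<dots> = (\<Sum>f\<in>F. \<Sum>i\<in>vs f \<inter> I. turning (k $ i) (elementary2 (vs f) k))"
      by (intro sum.cong) auto
    also have "\<dots> = (\<Sum>f\<in>{f \<in> F. vs f \<inter> I \<noteq> {}}. \<Sum>i\<in>vs f \<inter> I. turning (k $ i) (elementary2 (vs f) k))"
      by (rule sum.mono_neutral_right) (use fin in auto)
    finally show ?thesis .
  qed
  have nonneg: "0 \<le> \<Theta> k $ v" if "k \<in> closed_\<Omega>\<^sub>k" for k v
    using that unfolding \<Theta>_def by (auto intro!: sum_nonneg turning_nonneg simp: closed_\<Omega>\<^sub>k_def)
  show zero: "\<Theta> k $ v = 0 \<longleftrightarrow> k $ v = 0" if "k \<in> closed_\<Omega>\<^sub>k" for k v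
  proof
    assume "\<Theta> k $ v = 0"
    moreover obtain f where f: "f \<in> F" "v \<in> vs f" using cover by blast
    ultimately have "turning (k $ v) (elementary2 (vs f) k) = 0"
      using that fin unfolding \<Theta>_def
      by (simp add: sum_nonneg_eq_0_iff turning_nonneg closed_\<Omega>\<^sub>k_def)
    then show "k $ v = 0" using turning_pos[of "k $ v"] that
      by (fastforce simp: closed_\<Omega>\<^sub>k_def order_less_le)
  qed (simp add: \<Theta>_def)
  show "\<exists>\<Psi>. homeomorphism closed_\<Omega>\<^sub>k {t. (\<forall>v. 0 \<le> t $ v) \<and>
      (\<forall>I. I \<noteq> {} \<longrightarrow> (\<Sum>i\<in>I. t $ i) < pi * real (card {f \<in> F. vs f \<inter> I \<noteq> {}}))} \<Theta> \<Psi>"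
  proof (rule perron_homeomorphism)
    show "continuous_on closed_\<Omega>\<^sub>k \<Theta>"
      unfolding \<Theta>_def elementary2_def by (intro continuous_intros continuous_on_turning) auto
  next
    fix k k' :: "real ^ 'v" and i
    assume k: "k \<in> closed_\<Omega>\<^sub>k" "k' \<in> closed_\<Omega>\<^sub>k" "k $ i < k' $ i"
    obtain f where "f \<in> F" "i \<in> vs f" using cover by blast
    then have "{f \<in> F. vs f \<inter> {i. k $ i < k' $ i} \<noteq> {}} \<noteq> {}" using k by auto
    then show "(\<Sum>i\<in>{i. k $ i < k' $ i}. \<Theta> k $ i) < (\<Sum>i\<in>{i. k $ i < k' $ i}. \<Theta> k' $ i)"
      unfolding sum_I
    proof (rule sum_strict_mono[rotated])
      fix f assume "f \<in> {f \<in> F. vs f \<inter> {i. k $ i < k' $ i} \<noteq> {}}"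
      then obtain j where "f \<in> F" "j \<in> vs f" "k $ j < k' $ j" by blast
      then show "(\<Sum>i\<in>vs f \<inter> {i. k $ i < k' $ i}. turning (k $ i) (elementary2 (vs f) k))
        < (\<Sum>i\<in>vs f \<inter> {i. k $ i < k' $ i}. turning (k' $ i) (elementary2 (vs f) k'))"
        using face_partial_sum_strict_mono[OF card k(1,2)] by blast
    qed (use fin in auto)
  next
    fix k k' :: "real ^ 'v" and i
    assume k: "k \<in> closed_\<Omega>\<^sub>k" "k' \<in> closed_\<Omega>\<^sub>k" "\<And>j. k $ j \<le> k' $ j" "k $ i = k' $ i"
    then show "\<Theta> k' $ i \<le> \<Theta> k $ i"
      unfolding \<Theta>_def vec_lambda_beta using card by (intro sum_mono turning_face_antimono) auto
  next
    fix k :: "real ^ 'v" and I :: "'v set"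
    assume k: "k \<in> closed_\<Omega>\<^sub>k" and "I \<noteq> {}"
    then have "{f \<in> F. vs f \<inter> I \<noteq> {}} \<noteq> {}" using cover by blast
    then have "(\<Sum>i\<in>I. \<Theta> k $ i) < (\<Sum>f\<in>{f \<in> F. vs f \<inter> I \<noteq> {}}. pi)"
      unfolding sum_I using fin card k by (intro sum_strict_mono face_partial_sum_less_pi) auto
    then show "(\<Sum>i\<in>I. \<Theta> k $ i) < pi * real (card {f \<in> F. vs f \<inter> I \<noteq> {}})"
      by (simp add: mult.commute)
  next
    fix I :: "'v set" and M e :: real
    assume I: "I \<noteq> {}" and e: "0 < e"
    define N where "N = {f \<in> F. vs f \<inter> I \<noteq> {}}"
    have N: "finite N" "N \<noteq> {}" using fin cover I unfolding N_def by (simp, blast)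
    define e' where "e' = e / card N"
    have e': "0 < e'" using e N by (simp add: e'_def card_gt_0_iff)
    have "\<forall>f\<in>N. \<exists>R0. \<forall>R\<ge>R0. \<forall>k\<in>closed_\<Omega>\<^sub>k. \<forall>i\<in>vs f \<inter> I. (\<forall>i\<in>I. R \<le> k $ i) \<longrightarrow>
        (\<forall>i. i \<notin> I \<longrightarrow> k $ i \<le> M) \<longrightarrow> pi - e' < (\<Sum>i\<in>vs f \<inter> I. turning (k $ i) (elementary2 (vs f) k))"
      using face_partial_sum_near_pi[OF card e'] unfolding N_def by blast
    then obtain r where r: "\<forall>f\<in>N. \<forall>R\<ge>r f. \<forall>k\<in>closed_\<Omega>\<^sub>k. \<forall>i\<in>vs f \<inter> I. (\<forall>i\<in>I. R \<le> k $ i) \<longrightarrow>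
        (\<forall>i. i \<notin> I \<longrightarrow> k $ i \<le> M) \<longrightarrow> pi - e' < (\<Sum>i\<in>vs f \<inter> I. turning (k $ i) (elementary2 (vs f) k))"
      unfolding bchoice_iff by blast
    show "\<exists>R. \<forall>k\<in>closed_\<Omega>\<^sub>k. (\<forall>i\<in>I. R \<le> k $ i) \<longrightarrow> (\<forall>i. i \<notin> I \<longrightarrow> k $ i \<le> M) \<longrightarrow>
        pi * real (card {f \<in> F. vs f \<inter> I \<noteq> {}}) - e < (\<Sum>i\<in>I. \<Theta> k $ i)"
    proof (intro exI[of _ "Max (r ` N)"] ballI impI)
      fix k :: "real ^ 'v"
      assume k: "k \<in> closed_\<Omega>\<^sub>k" "\<forall>i\<in>I. Max (r ` N) \<le> k $ i" "\<forall>i. i \<notin> I \<longrightarrow> k $ i \<le> M"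
      have "(\<Sum>f\<in>N. pi - e') < (\<Sum>f\<in>N. \<Sum>i\<in>vs f \<inter> I. turning (k $ i) (elementary2 (vs f) k))"
      proof (rule sum_strict_mono[OF N])
        fix f assume f: "f \<in> N"
        then obtain i where "i \<in> vs f \<inter> I" by (auto simp: N_def)
        moreover have "r f \<le> Max (r ` N)" using f N by simp
        ultimately show "pi - e' < (\<Sum>i\<in>vs f \<inter> I. turning (k $ i) (elementary2 (vs f) k))"
          using r f k by blast
      qed
      moreover have "(\<Sum>f\<in>N. pi - e') = pi * real (card N) - e"
        using N by (simp add: e'_def right_diff_distrib card_gt_0_iff algebra_simps)
      ultimately show "pi * real (card {f \<in> F. vs f \<inter> I \<noteq> {}}) - e < (\<Sum>i\<in>I. \<Theta> k $ i)"
        unfolding sum_I N_def by simp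
    qed
  qed (use nonneg zero in auto)
qed

section \<open>Minkowski space\<close>

text \<open>The Minkowski form of signature \<open>(2, 1)\<close>, with the time coordinate first.\<close>

definition mink :: "real \<times> complex \<Rightarrow> real \<times> complex \<Rightarrow> real" where
  "mink V W = snd V \<bullet> snd W - fst V * fst W"

definition hyperboloid :: "(real \<times> complex) set" where
  "hyperboloid = {X. mink X X = -1 \<and> fst X > 0}"

text \<open>The point of the hyperboloid over the point \<open>z\<close> of the Klein model, whose inverse is the central projection \<open>klein\<close>.\<close>

definition lift :: "complex \<Rightarrow> real \<times> complex" where
  "lift z = (1 / sqrt (1 - (cmod z)\<^sup>2)) *\<^sub>R (1, z)"

definition klein :: "real \<times> complex \<Rightarrow> complex" where
  "klein V = (1 / fst V) *\<^sub>R snd V"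

lemma mink_linear [simp]:
  "mink (U + V) W = mink U W + mink V W" "mink W (U + V) = mink W U + mink W V"
  "mink (U - V) W = mink U W - mink V W" "mink W (U - V) = mink W U - mink W V"
  "mink (r *\<^sub>R V) W = r * mink V W" "mink V (r *\<^sub>R W) = r * mink V W"
  "mink (- V) W = - mink V W" "mink V (- W) = - mink V W"
  "mink 0 W = 0" "mink W 0 = 0"
  by (simp_all add: mink_def inner_add_left inner_add_right inner_diff_left inner_diff_right algebra_simps)

lemma mink_commute: "mink V W = mink W V"
  by (simp add: mink_def inner_commute mult.commute)

lemma continuous_on_mink [continuous_intros]:
  "continuous_on S f \<Longrightarrow> continuous_on S g \<Longrightarrow> continuous_on S (\<lambda>x. mink (f x) (g x))"
  unfolding mink_def by (intro continuous_intros)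

lemma hplane_iff: "z \<in> hplane \<longleftrightarrow> (cmod z)\<^sup>2 < 1"
  by (simp add: hplane_def abs_square_less_1)

lemma root_pos: "z \<in> hplane \<Longrightarrow> 0 < sqrt (1 - (cmod z)\<^sup>2)"
  by (simp add: hplane_iff)

lemma mink_homogeneous: "mink (1, z) (1, w) = z \<bullet> w - 1"
  by (simp add: mink_def)

lemma mink_lift: "mink (lift z) N = (snd N \<bullet> z - fst N) / sqrt (1 - (cmod z)\<^sup>2)"
  unfolding lift_def by (simp add: mink_def inner_commute divide_simps)

lemma lift_hyperboloid: "z \<in> hplane \<Longrightarrow> lift z \<in> hyperboloid"
  unfolding hyperboloid_def lift_def mem_Collect_eq mink_linear mink_homogeneous
  by (simp add: dot_square_norm hplane_iff divide_simps)

lemma klein_lift [simp]: "z \<in> hplane \<Longrightarrow> klein (lift z) = z"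
  using root_pos[of z] unfolding klein_def lift_def by simp

lemma hyperboloidD:
  assumes "X \<in> hyperboloid" shows "mink X X = -1" "0 < fst X"
  using assms by (auto simp: hyperboloid_def)

lemma klein_hplane:
  assumes "mink V V < 0" "0 < fst V" shows "klein V \<in> hplane"
proof -
  have "snd V \<bullet> snd V < (fst V)\<^sup>2" using assms by (simp add: mink_def power2_eq_square)
  then show ?thesis
    using assms by (simp add: hplane_iff klein_def power_divide dot_square_norm pos_divide_less_eq
        power_mult_distrib)
qed

lemma scaled_klein: "fst V \<noteq> 0 \<Longrightarrow> V = fst V *\<^sub>R (1, klein V)"
  by (simp add: klein_def prod_eq_iff)

lemma lift_klein [simp]:
  assumes "X \<in> hyperboloid" shows "lift (klein X) = X"
proof -
  have "(fst X)\<^sup>2 - (cmod (snd X))\<^sup>2 = 1"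
    using hyperboloidD(1)[OF assms] unfolding mink_def power2_norm_eq_inner power2_eq_square[of "fst X"]
    by linarith
  then have "1 - (cmod (klein X))\<^sup>2 = (1 / fst X)\<^sup>2"
    using hyperboloidD(2)[OF assms] unfolding klein_def
    by (simp add: power_divide divide_simps)
  then have "sqrt (1 - (cmod (klein X))\<^sup>2) = 1 / fst X"
    using hyperboloidD(2)[OF assms] by simp
  then show ?thesis
    using scaled_klein[of X] hyperboloidD(2)[OF assms] by (simp add: lift_def)
qed

lemma klein_inj_hyperboloid:
  "X \<in> hyperboloid \<Longrightarrow> Y \<in> hyperboloid \<Longrightarrow> klein X = klein Y \<Longrightarrow> X = Y"
  by (metis lift_klein)

lemma klein_hyperboloid_hplane [simp]: "X \<in> hyperboloid \<Longrightarrow> klein X \<in> hplane"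
  using klein_hplane hyperboloidD by simp

lemma klein_scale: "r \<noteq> 0 \<Longrightarrow> klein (r *\<^sub>R V) = klein V"
  by (simp add: klein_def)

lemma continuous_on_lift: "continuous_on hplane lift"
  unfolding lift_def using root_pos
  by (intro continuous_intros) (auto simp: hplane_iff)

lemma continuous_on_klein: "(\<And>V. V \<in> S \<Longrightarrow> fst V \<noteq> 0) \<Longrightarrow> continuous_on S klein"
  unfolding klein_def by (intro continuous_intros) auto

lemma hdist_lift: "hdist z w = arcosh (- mink (lift z) (lift w))"
  unfolding hdist_def lift_def mink_linear mink_homogeneous
  by (simp add: real_sqrt_mult diff_divide_distrib)

text \<open>Subtracting from \<open>V\<close> a multiple of the timelike vector \<open>X\<close> removes the time coordinate. In terms
  of the remainder, the form is a sum of squares, up to the square of \<open>mink V X\<close>.\<close>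

lemma spacelike_complement:
  assumes "mink X X = -1" "fst X \<noteq> 0"
  defines "w \<equiv> \<lambda>V. snd V - (fst V / fst X) *\<^sub>R snd X"
  shows "mink V V + (mink V X)\<^sup>2 = (cmod (w V))\<^sup>2 + (w V \<bullet> snd X)\<^sup>2"
    and "mink V X = w V \<bullet> snd X - fst V / fst X"
proof -
  define r where "r = fst V / fst X"
  have v: "snd V = w V + r *\<^sub>R snd X" "fst V = r * fst X" using assms by (auto simp: w_def r_def)
  have x: "snd X \<bullet> snd X = fst X * fst X - 1" using assms(1) by (simp add: mink_def)
  have 1: "mink V X = w V \<bullet> snd X - r"
    unfolding mink_def v by (simp add: inner_add_left x algebra_simps)
  have 2: "mink V V = (cmod (w V))\<^sup>2 + 2 * r * (w V \<bullet> snd X) - r\<^sup>2"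
    unfolding mink_def v power2_norm_eq_inner
    by (simp add: inner_add_left inner_add_right x inner_commute[of "snd X" "w V"] algebra_simps power2_eq_square)
  show "mink V V + (mink V X)\<^sup>2 = (cmod (w V))\<^sup>2 + (w V \<bullet> snd X)\<^sup>2"
    unfolding 1 2 by (simp add: power2_eq_square algebra_simps)
  show "mink V X = w V \<bullet> snd X - fst V / fst X" using 1 by (simp add: r_def)
qed

lemma reverse_cauchy_schwarz:
  assumes "X \<in> hyperboloid"
  shows "- mink V V \<le> (mink V X)\<^sup>2"
    and "- mink V V = (mink V X)\<^sup>2 \<Longrightarrow> V = - mink V X *\<^sub>R X"
proof -
  note X = hyperboloidD[OF assms]
  define w where "w = snd V - (fst V / fst X) *\<^sub>R snd X"
  have e: "mink V V + (mink V X)\<^sup>2 = (cmod w)\<^sup>2 + (w \<bullet> snd X)\<^sup>2"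
    "mink V X = w \<bullet> snd X - fst V / fst X"
    using spacelike_complement[of X V] X by (auto simp: w_def)
  have "0 \<le> mink V V + (mink V X)\<^sup>2" unfolding e(1) by simp
  then show "- mink V V \<le> (mink V X)\<^sup>2" by linarith
  assume "- mink V V = (mink V X)\<^sup>2"
  then have "(cmod w)\<^sup>2 + (w \<bullet> snd X)\<^sup>2 = 0" using e(1) by linarith
  then have w: "w = 0" by (simp add: sum_power2_eq_zero_iff)
  then have m: "- mink V X = fst V / fst X" using e(2) by simp
  show "V = - mink V X *\<^sub>R X"
  proof (rule prod_eqI)
    show "fst V = fst (- mink V X *\<^sub>R X)" unfolding m using X(2) by simp
    show "snd V = snd (- mink V X *\<^sub>R X)"
      unfolding m snd_scaleR using w unfolding w_def by (rule eq_iff_diff_eq_0[THEN iffD2])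
  qed
qed

lemma mink_future:
  assumes X: "X \<in> hyperboloid" and P: "mink P P \<le> 0" "0 < fst P"
  shows "mink P X < 0"
proof -
  note X' = hyperboloidD[OF X]
  have "(cmod (snd P))\<^sup>2 \<le> (fst P)\<^sup>2"
    using P(1) unfolding mink_def power2_norm_eq_inner power2_eq_square[of "fst P"] by linarith
  then have "cmod (snd P) \<le> fst P" using P(2) power2_le_imp_le[of "cmod (snd P)" "fst P"] by simp
  have "(cmod (snd X))\<^sup>2 < (fst X)\<^sup>2"
    using X'(1) unfolding mink_def power2_norm_eq_inner power2_eq_square[of "fst X"] by linarith
  then have "cmod (snd X) < fst X" using X'(2) power2_less_imp_less[of "cmod (snd X)" "fst X"] by simp
  with \<open>cmod (snd P) \<le> fst P\<close> have "cmod (snd P) * cmod (snd X) < fst P * fst X"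
    using P(2) mult_right_mono[of "cmod (snd P)" "fst P" "cmod (snd X)"]
      mult_strict_left_mono[of "cmod (snd X)" "fst X" "fst P"] norm_ge_zero[of "snd X"] by linarith
  then show ?thesis
    using Cauchy_Schwarz_ineq2[of "snd P" "snd X"] by (simp add: mink_def)
qed

lemma mink_hyperboloid_le:
  assumes "X \<in> hyperboloid" "Y \<in> hyperboloid" shows "mink X Y \<le> -1"
proof -
  have "1 \<le> (mink X Y)\<^sup>2" using reverse_cauchy_schwarz(1)[OF assms(2), of X] hyperboloidD[OF assms(1)] by simp
  moreover have "mink X Y < 0" using mink_future[OF assms(2), of X] hyperboloidD[OF assms(1)] by simp
  ultimately show ?thesis using abs_square_less_1[of "mink X Y"] by linarith
qed

lemma mink_hyperboloid_eq:
  assumes "X \<in> hyperboloid" "Y \<in> hyperboloid" "mink X Y = -1" shows "X = Y"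
  using reverse_cauchy_schwarz(2)[OF assms(2), of X] hyperboloidD[OF assms(1)] assms(3) by simp

lemma future_if_mink_neg:
  assumes X: "X \<in> hyperboloid" and P: "mink P P \<le> 0" "mink P X < 0"
  shows "0 < fst P"
proof (rule ccontr)
  assume "\<not> 0 < fst P"
  moreover have "fst P \<noteq> 0"
  proof
    assume "fst P = 0"
    then have "snd P = 0" using P(1) by (simp add: mink_def dot_square_norm)
    then show False using P(2) \<open>fst P = 0\<close> by (simp add: mink_def)
  qed
  ultimately have "0 < fst (- P)" by simp
  then show False using mink_future[OF X, of "- P"] P by simp
qed

lemma hyperboloidI:
  "X \<in> hyperboloid \<Longrightarrow> mink P P = -1 \<Longrightarrow> mink P X < 0 \<Longrightarrow> P \<in> hyperboloid"
  using future_if_mink_neg[of X P] by (simp add: hyperboloid_def)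

text \<open>The Lorentzian cross product: \<open>mink (lcross A B) V\<close> is the determinant of \<open>A\<close>, \<open>B\<close>, \<open>V\<close>.\<close>

definition lcross :: "real \<times> complex \<Rightarrow> real \<times> complex \<Rightarrow> real \<times> complex" where
  "lcross A B = (Im (snd A) * Re (snd B) - Re (snd A) * Im (snd B),
     Complex (Im (snd A) * fst B - fst A * Im (snd B)) (fst A * Re (snd B) - Re (snd A) * fst B))"

lemma lcross_orthogonal [simp]: "mink (lcross A B) A = 0" "mink (lcross A B) B = 0"
  by (simp_all add: mink_def lcross_def inner_complex_def algebra_simps)

lemma lcross_norm: "mink (lcross A B) (lcross A B) = (mink A B)\<^sup>2 - mink A A * mink B B"
  by (simp add: mink_def lcross_def inner_complex_def algebra_simps power2_eq_square)

lemma lcross_expansion: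
  "(mink A A * mink B B - (mink A B)\<^sup>2) *\<^sub>R V =
     (mink V A * mink B B - mink V B * mink A B) *\<^sub>R A
   + (mink V B * mink A A - mink V A * mink A B) *\<^sub>R B - mink V (lcross A B) *\<^sub>R lcross A B"
  by (simp add: prod_eq_iff complex_eq_iff mink_def lcross_def inner_complex_def algebra_simps power2_eq_square)

text \<open>A Lorentz orthonormal basis with a point of the hyperboloid as its timelike vector. The last
  clause says that the three vectors span.\<close>

definition frame :: "real \<times> complex \<Rightarrow> real \<times> complex \<Rightarrow> real \<times> complex \<Rightarrow> bool" where
  "frame X \<nu> \<tau> \<longleftrightarrow> X \<in> hyperboloid \<and> mink \<nu> \<nu> = 1 \<and> mink \<tau> \<tau> = 1 \<and>
     mink X \<nu> = 0 \<and> mink X \<tau> = 0 \<and> mink \<nu> \<tau> = 0 \<and>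
     (\<forall>V. V = - mink V X *\<^sub>R X + mink V \<nu> *\<^sub>R \<nu> + mink V \<tau> *\<^sub>R \<tau>)"

lemma frame_exists:
  assumes "X \<in> hyperboloid" "mink X \<nu> = 0" "mink \<nu> \<nu> = 1"
  shows "frame X \<nu> (lcross X \<nu>)"
proof -
  have "V = - mink V X *\<^sub>R X + mink V \<nu> *\<^sub>R \<nu> + mink V (lcross X \<nu>) *\<^sub>R lcross X \<nu>" for V
    using arg_cong[OF lcross_expansion[of X \<nu> V], of uminus] assms hyperboloidD[OF assms(1)]
    by (simp add: algebra_simps)
  then show ?thesis
    using assms hyperboloidD[OF assms(1)]
    by (auto simp: frame_def lcross_norm mink_commute[of X "lcross X \<nu>"] mink_commute[of \<nu> "lcross X \<nu>"])
qed

lemma frame_minus: "frame X \<nu> \<tau> \<Longrightarrow> frame X \<nu> (- \<tau>)"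
  by (simp add: frame_def)

lemma frameD:
  assumes "frame X \<nu> \<tau>"
  shows "X \<in> hyperboloid" "mink X X = -1" "mink \<nu> \<nu> = 1" "mink \<tau> \<tau> = 1"
    "mink X \<nu> = 0" "mink \<nu> X = 0" "mink X \<tau> = 0" "mink \<tau> X = 0" "mink \<nu> \<tau> = 0" "mink \<tau> \<nu> = 0"
  using assms hyperboloidD by (auto simp: frame_def mink_commute)

lemma frame_expand:
  "frame X \<nu> \<tau> \<Longrightarrow> V = - mink V X *\<^sub>R X + mink V \<nu> *\<^sub>R \<nu> + mink V \<tau> *\<^sub>R \<tau>"
  unfolding frame_def by blast

section \<open>Rational parametrization of curves of constant curvature\<close>

definition arc_denom :: "real \<Rightarrow> real \<Rightarrow> real" where
  "arc_denom k u = 1 + (k\<^sup>2 - 1) * u\<^sup>2"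

text \<open>Let \<open>c = k\<^sup>2 - 1\<close>. The curve of constant curvature \<open>k\<close> through \<open>X\<close> with unit tangent \<open>\<tau>\<close> and unit
  normal \<open>\<nu>\<close> solves \<open>\<gamma>'' = \<gamma> + k \<nu>\<close>, \<open>\<nu>' = - k \<tau>\<close>. The parameter \<open>u\<close> is the tangent of half the
  arc length: for \<open>k > 1\<close> and arc length \<open>t\<close>, \<open>u = tan (sqrt c t / 2) / sqrt c\<close>, with the hyperbolic
  tangent for \<open>k < 1\<close> and \<open>u = t / 2\<close> for \<open>k = 1\<close>. It makes the curve rational and treats the three
  kinds of generalized circles alike.\<close>

definition arc_point :: "real \<Rightarrow> real \<times> complex \<Rightarrow> real \<times> complex \<Rightarrow> real \<times> complex \<Rightarrow> real \<Rightarrow> real \<times> complex" where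
  "arc_point k X \<nu> \<tau> u = X + (2 * u / arc_denom k u) *\<^sub>R \<tau> + (2 * u\<^sup>2 / arc_denom k u) *\<^sub>R (X + k *\<^sub>R \<nu>)"

definition arc_param :: "real \<Rightarrow> real \<times> complex \<Rightarrow> real \<times> complex \<Rightarrow> real \<times> complex \<Rightarrow> real" where
  "arc_param k X \<tau> Y = mink Y \<tau> / (2 + (k\<^sup>2 - 1) * (mink Y X + 1))"

context
  fixes k X \<nu> \<tau> N
  assumes fr: "frame X \<nu> \<tau>" and N: "N = k *\<^sub>R X + \<nu>"
begin

lemma mink_arc_point_frame:
  "mink (arc_point k X \<nu> \<tau> u) X = -1 - 2 * u\<^sup>2 / arc_denom k u"
  "mink (arc_point k X \<nu> \<tau> u) \<tau> = 2 * u / arc_denom k u"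
  "mink (arc_point k X \<nu> \<tau> u) N = - k"
  unfolding arc_point_def N by (simp_all add: frameD[OF fr] algebra_simps)

lemma mink_arc_points:
  assumes "0 < arc_denom k u" "0 < arc_denom k v"
  shows "mink (arc_point k X \<nu> \<tau> u) (arc_point k X \<nu> \<tau> v)
     = -1 - 2 * (u - v)\<^sup>2 / (arc_denom k u * arc_denom k v)"
proof -
  define A B where "A = arc_denom k u" and "B = arc_denom k v"
  have AB: "0 < A" "0 < B" using assms by (auto simp: A_def B_def)
  have c: "A = 1 + (k\<^sup>2 - 1) * u\<^sup>2" "B = 1 + (k\<^sup>2 - 1) * v\<^sup>2" by (auto simp: A_def B_def arc_denom_def)
  have "mink (arc_point k X \<nu> \<tau> u) (arc_point k X \<nu> \<tau> v)
     = - (1 + 2*u\<^sup>2/A) * (1 + 2 * v\<^sup>2/B) + (2*u/A) * (2 * v/B) + k\<^sup>2 * (2*u\<^sup>2/A) * (2 * v\<^sup>2/B)"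
    unfolding arc_point_def A_def[symmetric] B_def[symmetric]
    by (simp add: frameD[OF fr] algebra_simps power2_eq_square)
  also have "\<dots> = (- (A + 2*u\<^sup>2) * (B + 2 * v\<^sup>2) + 4 * u * v + 4*k\<^sup>2*u\<^sup>2 * v\<^sup>2) / (A * B)"
    using AB by (simp add: field_simps)
  also have "- (A + 2*u\<^sup>2) * (B + 2 * v\<^sup>2) + 4 * u * v + 4*k\<^sup>2*u\<^sup>2 * v\<^sup>2 = - (A * B) - 2 * (u - v)\<^sup>2"
    unfolding c by (simp add: power2_eq_square algebra_simps)
  finally show ?thesis using AB by (simp add: A_def B_def diff_divide_distrib)
qed

lemma arc_point_hyperboloid:
  assumes "0 < arc_denom k u" shows "arc_point k X \<nu> \<tau> u \<in> hyperboloid"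
proof (rule hyperboloidI[OF frameD(1)[OF fr]])
  show "mink (arc_point k X \<nu> \<tau> u) (arc_point k X \<nu> \<tau> u) = -1"
    using mink_arc_points[OF assms assms] by simp
  have "0 \<le> 2 * u\<^sup>2 / arc_denom k u" using assms by simp
  then show "mink (arc_point k X \<nu> \<tau> u) X < 0" unfolding mink_arc_point_frame by linarith
qed

lemma arc_param_denom:
  assumes "0 < arc_denom k u"
  shows "2 + (k\<^sup>2 - 1) * (mink (arc_point k X \<nu> \<tau> u) X + 1) = 2 / arc_denom k u"
  unfolding mink_arc_point_frame using assms
  by (simp add: field_simps) (simp add: arc_denom_def algebra_simps)

lemma arc_param_arc_point:
  assumes "0 < arc_denom k u" shows "arc_param k X \<tau> (arc_point k X \<nu> \<tau> u) = u"
  unfolding arc_param_def arc_param_denom[OF assms] using assms by (simp add: mink_arc_point_frame)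

text \<open>The parametrization misses one point at most: the point antipodal to \<open>X\<close> on a circle, which
  belongs to \<open>u = \<infinity>\<close>. In frame coordinates the curve is the conic \<open>g\<^sup>2 = e (2 - c e)\<close>.\<close>

lemma arc_point_surj:
  assumes Y: "Y \<in> hyperboloid" "mink Y N = - k"
  obtains "arc_denom k (arc_param k X \<tau> Y) > 0" "0 < 2 + (k\<^sup>2 - 1) * (mink Y X + 1)"
      "Y = arc_point k X \<nu> \<tau> (arc_param k X \<tau> Y)"
  | "k\<^sup>2 > 1" "Y = X + (2 / (k\<^sup>2 - 1)) *\<^sub>R (X + k *\<^sub>R \<nu>)"
proof -
  define e g c where "e = - mink Y X - 1" and "g = mink Y \<tau>" and "c = k\<^sup>2 - 1"
  have e0: "0 \<le> e" using mink_hyperboloid_le[OF Y(1) frameD(1)[OF fr]] by (simp add: e_def)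
  have nu: "mink Y \<nu> = k * e" using Y(2) unfolding N by (simp add: e_def algebra_simps)
  have Yx: "Y = (1 + e) *\<^sub>R X + (k * e) *\<^sub>R \<nu> + g *\<^sub>R \<tau>"
    using frame_expand[OF fr, of Y] unfolding nu by (simp add: e_def g_def)
  then have Yx': "Y = X + g *\<^sub>R \<tau> + e *\<^sub>R (X + k *\<^sub>R \<nu>)" by (simp add: algebra_simps)
  have "mink Y Y = - (1 + e)\<^sup>2 + k\<^sup>2 * e\<^sup>2 + g\<^sup>2"
    unfolding Yx by (simp add: frameD[OF fr] power2_eq_square algebra_simps)
  then have g2: "g\<^sup>2 = e * (2 - c * e)"
    using hyperboloidD(1)[OF Y(1)] by (simp add: c_def power2_eq_square algebra_simps)
  have d: "2 + (k\<^sup>2 - 1) * (mink Y X + 1) = 2 - c * e" by (simp add: c_def e_def algebra_simps)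
  have u: "arc_param k X \<tau> Y = g / (2 - c * e)" unfolding arc_param_def d g_def ..
  show thesis
  proof (cases "2 - c * e = 0")
    case True
    then have "c * e = 2" by simp
    then have "0 < c" using e0 by (metis less_eq_real_def mult_nonpos_nonneg not_le zero_less_numeral linorder_not_le)
    then have "e = 2 / c" using \<open>c * e = 2\<close> by (simp add: field_simps)
    moreover have "g = 0" using g2 True by simp
    ultimately show thesis using that(2) Yx' \<open>0 < c\<close> by (simp add: c_def)
  next
    case False
    have pos: "0 < 2 - c * e"
    proof (cases "e = 0")
      case False
      then have "0 < e" using e0 by simp
      moreover have "0 \<le> e * (2 - c * e)" using g2 by (metis zero_le_power2)
      ultimately have "0 \<le> 2 - c * e" by (simp add: zero_le_mult_iff)
      then show ?thesis using \<open>2 - c * e \<noteq> 0\<close> by simp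
    qed simp
    define w where "w = g / (2 - c * e)"
    have "w\<^sup>2 = e / (2 - c * e)" using pos g2 by (simp add: w_def power_divide power2_eq_square)
    then have den: "arc_denom k w = 2 / (2 - c * e)"
      using pos unfolding arc_denom_def c_def[symmetric] by (simp add: field_simps)
    have "2 * w / arc_denom k w = g" "2 * w\<^sup>2 / arc_denom k w = e"
      unfolding den \<open>w\<^sup>2 = _\<close> using pos by (simp_all add: w_def)
    then have "Y = arc_point k X \<nu> \<tau> w" unfolding arc_point_def using Yx' by simp
    then show thesis using that(1) pos den u d by (simp add: w_def)
  qed
qed

lemma continuous_on_arc_point:
  "(\<And>u. u \<in> S \<Longrightarrow> 0 < arc_denom k u) \<Longrightarrow> continuous_on S (arc_point k X \<nu> \<tau>)"
  unfolding arc_point_def arc_denom_def by (intro continuous_intros) force+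

lemma continuous_on_klein_arc_point:
  assumes "\<And>u. u \<in> S \<Longrightarrow> 0 < arc_denom k u"
  shows "continuous_on S (\<lambda>u. klein (arc_point k X \<nu> \<tau> u))"
proof (rule continuous_on_compose2[OF _ continuous_on_arc_point[OF assms]])
  show "continuous_on hyperboloid klein"
    by (rule continuous_on_klein) (use hyperboloidD(2) in force)
qed (use arc_point_hyperboloid assms in auto)

end

section \<open>Length of arcs\<close>

definition arc_integral :: "real \<Rightarrow> real \<Rightarrow> real" where
  "arc_integral k U = integral {0..U} (\<lambda>u. 2 / arc_denom k u)"

lemma arc_denom_pos_below:
  assumes "0 < arc_denom k U" "0 \<le> u" "u \<le> U"
  shows "0 < arc_denom k u"
proof (cases "1 \<le> k\<^sup>2")
  case True
  then show ?thesis by (simp add: arc_denom_def add_pos_nonneg)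
next
  case False
  then have "(k\<^sup>2 - 1) * U\<^sup>2 \<le> (k\<^sup>2 - 1) * u\<^sup>2"
    using assms by (intro mult_left_mono_neg power_mono) auto
  then show ?thesis using assms by (simp add: arc_denom_def)
qed

lemma arc_mixed_pos:
  assumes "0 < arc_denom k U" "0 \<le> u" "u \<le> U" "0 \<le> v" "v \<le> U"
  shows "min 1 (arc_denom k U) \<le> 1 + (k\<^sup>2 - 1) * (u * v)"
proof (cases "1 \<le> k\<^sup>2")
  case True
  then show ?thesis using assms by (simp add: min.coboundedI1)
next
  case False
  then have "(k\<^sup>2 - 1) * U\<^sup>2 \<le> (k\<^sup>2 - 1) * (u * v)"
    using assms unfolding power2_eq_square[of U] by (intro mult_left_mono_neg mult_mono) auto
  then show ?thesis by (simp add: arc_denom_def min.coboundedI2)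
qed

text \<open>The hyperbolic sine of half the distance of the points with parameters \<open>v\<close> and \<open>u\<close>.\<close>

definition chord_half :: "real \<Rightarrow> real \<Rightarrow> real \<Rightarrow> real" where
  "chord_half k v u = (u - v) / sqrt (arc_denom k u * arc_denom k v)"

text \<open>The factor in front of the arc length element \<open>2 / arc_denom k u\<close> is the cosine of the angle
  between chord and curve.\<close>

lemma chord_derivative:
  assumes "0 < arc_denom k u" "0 < arc_denom k v"
  shows "((\<lambda>u. 2 * arsinh (chord_half k v u)) has_real_derivative
     (1 + (k\<^sup>2 - 1) * (u * v)) / sqrt ((1 + (k\<^sup>2 - 1) * (u * v))\<^sup>2 + (k * (u - v))\<^sup>2) * (2 / arc_denom k u)) (at u)"
proof -
  define A B S where "A = arc_denom k u" and "B = arc_denom k v" and "S = sqrt (A * B)"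
  define Q where "Q = sqrt ((1 + (k\<^sup>2 - 1) * (u * v))\<^sup>2 + (k * (u - v))\<^sup>2)"
  have AB: "0 < A" "0 < B" using assms by (auto simp: A_def B_def)
  then have S: "0 < S" "S * S = A * B" by (auto simp: S_def)
  have Q: "A * B + (u - v)\<^sup>2 = (1 + (k\<^sup>2 - 1) * (u * v))\<^sup>2 + (k * (u - v))\<^sup>2"
    unfolding A_def B_def arc_denom_def by (simp add: power2_eq_square algebra_simps)
  have dA: "(arc_denom k has_real_derivative 2 * (k\<^sup>2 - 1) * u) (at u)"
    unfolding arc_denom_def by (auto intro!: derivative_eq_intros)
  have dS: "((\<lambda>u. sqrt (arc_denom k u * B)) has_real_derivative (k\<^sup>2 - 1) * u * B / S) (at u)"
  proof -
    have "((\<lambda>u. sqrt (arc_denom k u * B)) has_real_derivative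
        inverse (sqrt (A * B)) / 2 * (2 * (k\<^sup>2 - 1) * u * B)) (at u)"
      unfolding A_def by (rule DERIV_chain2[OF DERIV_real_sqrt DERIV_cmult_right[OF dA]])
        (use AB in \<open>simp add: A_def\<close>)
    moreover have "inverse s / 2 * (2 * x * y * z) = x * y * z / s" for s x y z :: real
      by (simp add: inverse_eq_divide)
    ultimately show ?thesis unfolding S_def by metis
  qed
  have dw: "((\<lambda>u. chord_half k v u) has_real_derivative B * (1 + (k\<^sup>2 - 1) * (u * v)) / (S * S * S)) (at u)"
  proof -
    have "((\<lambda>u. chord_half k v u) has_real_derivative
        (1 * sqrt (arc_denom k u * B) - (u - v) * ((k\<^sup>2 - 1) * u * B / S)) /
        (sqrt (arc_denom k u * B) * sqrt (arc_denom k u * B))) (at u)"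
      unfolding chord_half_def B_def[symmetric]
    proof (rule DERIV_divide[OF _ dS])
      show "((\<lambda>u. u - v) has_real_derivative 1) (at u)" by (auto intro!: derivative_eq_intros)
    qed (use AB in \<open>simp add: A_def\<close>)
    moreover have "(1 * sqrt (arc_denom k u * B) - (u - v) * ((k\<^sup>2 - 1) * u * B / S)) /
        (sqrt (arc_denom k u * B) * sqrt (arc_denom k u * B)) = (S * S - (u - v) * ((k\<^sup>2 - 1) * u * B)) / (S * S * S)"
      using S(1) unfolding A_def[symmetric] S_def[symmetric] by (simp add: field_simps)
    moreover have "S * S - (u - v) * ((k\<^sup>2 - 1) * u * B) = B * (1 + (k\<^sup>2 - 1) * (u * v))"
      unfolding S(2) A_def arc_denom_def by (simp add: power2_eq_square algebra_simps)
    ultimately show ?thesis by simp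
  qed
  have cw: "chord_half k v u = (u - v) / S" by (simp add: chord_half_def S_def A_def B_def)
  have "sqrt ((chord_half k v u)\<^sup>2 + 1) = Q / S"
  proof -
    have "(chord_half k v u)\<^sup>2 + 1 = (A * B + (u - v)\<^sup>2) / (S * S)"
      unfolding cw using S AB by (simp add: power_divide power2_eq_square add_divide_distrib)
    then show ?thesis unfolding Q Q_def using S(1) by (simp add: real_sqrt_divide)
  qed
  then have "((\<lambda>u. 2 * arsinh (chord_half k v u)) has_real_derivative
     2 * (1 / (Q / S) * (B * (1 + (k\<^sup>2 - 1) * (u * v)) / (S * S * S)))) (at u)"
    using DERIV_cmult[OF DERIV_chain2[OF arsinh_real_has_field_derivative dw], of 2] by simp
  moreover have "2 * (1 / (Q / S) * (B * (1 + (k\<^sup>2 - 1) * (u * v)) / (S * S * S)))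
      = (1 + (k\<^sup>2 - 1) * (u * v)) / Q * (2 / A)"
  proof -
    have "2 * (1 / (Q / S) * (B * x / (S * S * S))) = x / Q * (2 / A)" for x
    proof -
      have "2 * (1 / (Q / S) * (B * x / (S * S * S))) = 2 * (B * x / (Q * (S * S)))"
        using S(1) by (cases "Q = 0") (simp_all add: field_simps)
      also have "\<dots> = x / Q * (2 / A)" unfolding S(2) using AB by simp
      finally show ?thesis .
    qed
    then show ?thesis .
  qed
  ultimately show ?thesis by (simp add: Q_def A_def)
qed

lemma arc_integral_derivative:
  assumes "0 < arc_denom k U" "u \<in> {0..U}"
  shows "(arc_integral k has_real_derivative 2 / arc_denom k u) (at u within {0..U})"
proof -
  have "continuous_on {0..U} (\<lambda>u. 2 / arc_denom k u)"
    using arc_denom_pos_below[OF assms(1)] unfolding arc_denom_def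
    by (intro continuous_intros) force
  from integral_has_real_derivative[OF this assms(2)] show ?thesis
    unfolding arc_integral_def[abs_def] .
qed

lemma nondecreasing_within:
  fixes f :: "real \<Rightarrow> real"
  assumes "a \<le> b"
    and d: "\<And>x. x \<in> {a..b} \<Longrightarrow> (f has_real_derivative D x) (at x within {a..b})"
    and nonneg: "\<And>x. x \<in> {a..b} \<Longrightarrow> 0 \<le> D x"
  shows "f a \<le> f b"
proof (cases "a = b")
  case False
  then have "a < b" using assms by simp
  have d': "(f has_real_derivative D x) (at x)" if "a < x" "x < b" for x
    using d[of x] that by (simp add: at_within_Icc_at)
  obtain l z where z: "a < z" "z < b" "(f has_real_derivative l) (at z)" "f b - f a = (b - a) * l"
  proof -
    have "\<exists>l z. a < z \<and> z < b \<and> DERIV f z :> l \<and> f b - f a = (b - a) * l"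
      by (rule MVT[OF \<open>a < b\<close> DERIV_continuous_on[OF d]])
        (use d' in \<open>auto simp: real_differentiable_def\<close>)
    then show thesis using that by blast
  qed
  then have "l = D z" using DERIV_unique[OF z(3) d'[OF z(1,2)]] by simp
  then have "0 \<le> (b - a) * l" using nonneg[of z] z \<open>a < b\<close> by simp
  then show ?thesis using z by simp
qed simp

text \<open>Chords are shorter than arcs, and their ratio tends to \<open>1\<close> uniformly as the parameters approach
  each other. Both follow from bounds for the factor in \<open>chord_derivative\<close>, as
  \<open>x / sqrt (x\<^sup>2 + y\<^sup>2)\<close> lies between \<open>1 - y / x\<close> and \<open>1\<close>.\<close>

lemma chord_le_arc:
  assumes U: "0 < arc_denom k U" and k: "0 < k" and uv: "0 \<le> v" "v \<le> u" "u \<le> U"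
  defines "a \<equiv> min 1 (arc_denom k U)"
  shows "2 * arsinh (chord_half k v u) \<le> arc_integral k u - arc_integral k v"
    and "(1 - k * (u - v) / a) * (arc_integral k u - arc_integral k v) \<le> 2 * arsinh (chord_half k v u)"
proof -
  have a: "0 < a" using U by (simp add: a_def)
  have pos: "0 < arc_denom k t" if "t \<in> {v..u}" for t
    using arc_denom_pos_below[OF U] that uv by simp
  define r where "r = (\<lambda>t. (1 + (k\<^sup>2 - 1) * (t * v)) / sqrt ((1 + (k\<^sup>2 - 1) * (t * v))\<^sup>2 + (k * (t - v))\<^sup>2))"
  have r: "r t \<le> 1" "1 - k * (u - v) / a \<le> r t" if t: "t \<in> {v..u}" for t
  proof -
    define x y where "x = 1 + (k\<^sup>2 - 1) * (t * v)" and "y = k * (t - v)"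
    have x: "a \<le> x" "0 < x"
      using arc_mixed_pos[OF U, of t v] t uv a by (auto simp: x_def a_def)
    have y: "0 \<le> y" "y \<le> k * (u - v)" using t k by (auto simp: y_def)
    have "0 < x\<^sup>2 + y\<^sup>2" using x by (simp add: add_pos_nonneg)
    then have s: "0 < sqrt (x\<^sup>2 + y\<^sup>2)" by simp
    have "x \<le> sqrt (x\<^sup>2 + y\<^sup>2)" by (rule real_le_rsqrt) simp
    then show "r t \<le> 1" using s unfolding r_def x_def[symmetric] y_def[symmetric] by simp
    have "sqrt (x\<^sup>2 + y\<^sup>2) \<le> x + y" using x y by (intro sqrt_sum_squares_le_sum) auto
    then have "x / (x + y) \<le> x / sqrt (x\<^sup>2 + y\<^sup>2)" using x y s
      by (intro divide_left_mono mult_pos_pos) auto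
    moreover have "1 - y / x \<le> x / (x + y)"
      using x y by (simp add: field_simps)
    moreover have "y / x \<le> k * (u - v) / a" using x y a by (intro frac_le) auto
    ultimately show "1 - k * (u - v) / a \<le> r t"
      unfolding r_def x_def[symmetric] y_def[symmetric] by linarith
  qed
  have d1: "((\<lambda>t. 2 * arsinh (chord_half k v t)) has_real_derivative r t * (2 / arc_denom k t)) (at t within {v..u})"
    if "t \<in> {v..u}" for t
    using chord_derivative[OF pos[OF that] pos[of v]] uv that unfolding r_def
    by (auto intro: has_field_derivative_at_within)
  have d2: "(arc_integral k has_real_derivative 2 / arc_denom k t) (at t within {v..u})"
    if "t \<in> {v..u}" for t
    by (rule has_field_derivative_subset[OF arc_integral_derivative[OF U]]) (use that uv in auto)
  have c0: "chord_half k v v = 0" by (simp add: chord_half_def)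
  have "(\<lambda>t. arc_integral k t - 2 * arsinh (chord_half k v t)) v \<le> (\<lambda>t. arc_integral k t - 2 * arsinh (chord_half k v t)) u"
  proof (rule nondecreasing_within[OF uv(2)])
    fix t assume t: "t \<in> {v..u}"
    show "((\<lambda>t. arc_integral k t - 2 * arsinh (chord_half k v t)) has_real_derivative
        2 / arc_denom k t - r t * (2 / arc_denom k t)) (at t within {v..u})"
      by (rule DERIV_diff[OF d2[OF t] d1[OF t]])
    show "0 \<le> 2 / arc_denom k t - r t * (2 / arc_denom k t)"
      using mult_right_mono[OF r(1)[OF t], of "2 / arc_denom k t"] pos[OF t] by simp
  qed
  then show "2 * arsinh (chord_half k v u) \<le> arc_integral k u - arc_integral k v"
    by (simp add: c0)
  define q where "q = 1 - k * (u - v) / a"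
  have "(\<lambda>t. 2 * arsinh (chord_half k v t) - q * arc_integral k t) v \<le> (\<lambda>t. 2 * arsinh (chord_half k v t) - q * arc_integral k t) u"
  proof (rule nondecreasing_within[OF uv(2)])
    fix t assume t: "t \<in> {v..u}"
    show "((\<lambda>t. 2 * arsinh (chord_half k v t) - q * arc_integral k t) has_real_derivative
        r t * (2 / arc_denom k t) - q * (2 / arc_denom k t)) (at t within {v..u})"
      by (rule DERIV_diff[OF d1[OF t] DERIV_cmult[OF d2[OF t]]])
    show "0 \<le> r t * (2 / arc_denom k t) - q * (2 / arc_denom k t)"
      using mult_right_mono[OF r(2)[OF t], of "2 / arc_denom k t"] pos[OF t] by (simp add: q_def)
  qed
  then show "(1 - k * (u - v) / a) * (arc_integral k u - arc_integral k v) \<le> 2 * arsinh (chord_half k v u)"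
    unfolding q_def[symmetric] by (simp add: c0 right_diff_distrib)
qed

lemma hdist_arc_points:
  assumes fr: "frame X \<nu> \<tau>" and pos: "0 < arc_denom k u" "0 < arc_denom k v" and le: "v \<le> u"
  shows "hdist (klein (arc_point k X \<nu> \<tau> v)) (klein (arc_point k X \<nu> \<tau> u)) = 2 * arsinh (chord_half k v u)"
proof -
  define w where "w = chord_half k v u"
  have w0: "0 \<le> w" using le pos by (simp add: w_def chord_half_def)
  have w2: "w\<^sup>2 = (u - v)\<^sup>2 / (arc_denom k v * arc_denom k u)"
    using pos by (simp add: w_def chord_half_def power_divide mult.commute)
  have "hdist (klein (arc_point k X \<nu> \<tau> v)) (klein (arc_point k X \<nu> \<tau> u)) = arcosh (1 + 2 * w\<^sup>2)"
    unfolding hdist_lift lift_klein[OF arc_point_hyperboloid[OF fr refl pos(1)]]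
      lift_klein[OF arc_point_hyperboloid[OF fr refl pos(2)]]
    unfolding mink_arc_points[OF fr refl pos(2,1)] w2 power2_commute[of v u]
    by (simp add: add.commute)
  also have "1 + 2 * w\<^sup>2 = cosh (2 * arsinh w)"
    by (simp add: cosh_double cosh_square_eq)
  also have "arcosh (cosh (2 * arsinh w)) = 2 * arsinh w"
    using w0 sinh_real_nonneg_iff[of "arsinh w"] by (intro arcosh_cosh_real) simp
  finally show ?thesis by (simp add: w_def)
qed

text \<open>A continuous injective parameter change from \<open>0\<close> to \<open>U\<close> is increasing, so every chain of points
  on the arc is monotone in the parameter \<open>u\<close>. The upper bound for its length telescopes; the
  equidistant chains in \<open>u\<close> come arbitrarily close to it.\<close>

lemma hlength_arc:
  assumes fr: "frame X \<nu> \<tau>" and k: "0 < k" and U: "0 < U" "0 < arc_denom k U"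
    and g: "continuous_on {0..1} g" "inj_on g {0..1}" "g 0 = 0" "g 1 = U"
    and \<gamma>: "\<And>t. t \<in> {0..1} \<Longrightarrow> \<gamma> t = klein (arc_point k X \<nu> \<tau> (g t))"
  shows "hlength \<gamma> = arc_integral k U"
proof -
  have g_strict: "g s < g t" if "0 \<le> s" "s < t" "t \<le> 1" for s t
  proof -
    have pos: "0 < g t" if "0 < t" "t \<le> 1" for t
      using continuous_inj_imp_mono[OF _ _ g(1,2), of t] g(3,4) U that by (cases "t = 1") auto
    show ?thesis
    proof (cases "s = 0")
      case False
      then show ?thesis
        using continuous_inj_imp_mono[of 0 s t g] continuous_on_subset[OF g(1), of "{0..t}"]
          inj_on_subset[OF g(2), of "{0..t}"] that g(3) pos[of t] by auto
    qed (use g(3) pos that in simp)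
  qed
  have g_mono: "g s \<le> g t" if "0 \<le> s" "s \<le> t" "t \<le> 1" for s t
    using g_strict[of s t] that by (cases "s = t") auto
  have g_range: "0 \<le> g t" "g t \<le> U" if "0 \<le> t" "t \<le> 1" for t
    using g_mono[of 0 t] g_mono[of t 1] that g(3,4) by auto
  have step: "hdist (\<gamma> s) (\<gamma> t) = 2 * arsinh (chord_half k (g s) (g t))"
    if "0 \<le> s" "s \<le> t" "t \<le> 1" for s t
    using that g_mono[OF that] g_range[of s] g_range[of t]
    by (simp add: \<gamma> hdist_arc_points[OF fr] arc_denom_pos_below[OF U(2)])
  let ?S = "{\<Sum>i<n. hdist (\<gamma> (s i)) (\<gamma> (s (Suc i))) | (n::nat) (s::nat \<Rightarrow> real).
     s 0 = 0 \<and> s n = 1 \<and> (\<forall>i<n. s i \<le> s (Suc i))}"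
  define a where "a = min 1 (arc_denom k U)"
  have a: "0 < a" using U by (simp add: a_def)
  have G0: "arc_integral k 0 = 0" by (simp add: arc_integral_def)
  have upper: "x \<le> arc_integral k U" if x: "x \<in> ?S" for x
  proof -
    obtain n s where xs: "x = (\<Sum>i<n. hdist (\<gamma> (s i)) (\<gamma> (s (Suc i))))"
      and s: "s 0 = 0" "s n = 1" "\<And>i. i < n \<Longrightarrow> s i \<le> s (Suc i)" using x by auto
    have s0: "i \<le> n \<Longrightarrow> 0 \<le> s i" for i
      by (induction i) (use s in \<open>auto intro: order_trans[OF _ s(3)]\<close>)
    have s1: "s i \<le> 1" if "i \<le> n" for i
      using that
    proof (induction rule: inc_induct)
      case (step i)
      then show ?case using s(3)[of i] by linarith
    qed (simp add: s)
    have "x \<le> (\<Sum>i<n. arc_integral k (g (s (Suc i))) - arc_integral k (g (s i)))"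
      unfolding xs
    proof (rule sum_mono)
      fix i assume "i \<in> {..<n}"
      then have i: "0 \<le> s i" "s i \<le> s (Suc i)" "s (Suc i) \<le> 1" using s0 s1 s(3) by auto
      show "hdist (\<gamma> (s i)) (\<gamma> (s (Suc i))) \<le> arc_integral k (g (s (Suc i))) - arc_integral k (g (s i))"
        unfolding step[OF i] using i g_mono[OF i] g_range[of "s i"] g_range[of "s (Suc i)"]
        by (intro chord_le_arc(1)[OF U(2) k]) auto
    qed
    also have "\<dots> = arc_integral k (g (s n)) - arc_integral k (g (s 0))"
      by (rule sum_lessThan_telescope)
    finally show ?thesis using s g G0 by simp
  qed
  have "\<exists>t\<in>{0..1}. g t = u" if "u \<in> {0..U}" for u
    using IVT'[of g 0 u 1] g that by auto
  then obtain h where h: "\<And>u. u \<in> {0..U} \<Longrightarrow> h u \<in> {0..1} \<and> g (h u) = u" by metis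
  have h_mono: "h u \<le> h v" if "u \<in> {0..U}" "v \<in> {0..U}" "u \<le> v" for u v
    using g_strict[of "h v" "h u"] h[OF that(1)] h[OF that(2)] that(3) by force
  have h01: "h 0 = 0" "h U = 1"
    using h[of 0] h[of U] U g(2-4) by (auto simp: inj_on_def) 
  \<comment> \<open>The chain with \<open>n\<close> equal parameter steps has at least the fraction \<open>1 - k U / (a n)\<close> of the length.\<close>
  have lower: "(1 - k * U / a / real n) * arc_integral k U \<le> y"
    if y: "\<And>x. x \<in> ?S \<Longrightarrow> x \<le> y" and n: "0 < n" for y n
  proof -
    define u where "u = (\<lambda>i. U * real i / real n)"
    have u: "u i \<in> {0..U}" if "i \<le> n" for i
      using that U n by (auto simp: u_def divide_le_eq)
    have ud: "u (Suc i) - u i = U / real n" for i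
      by (simp add: u_def add_divide_distrib algebra_simps)
    have un: "u n = U" "u 0 = 0" using n by (auto simp: u_def)
    have umono: "u i \<le> u (Suc i)" for i using ud[of i] U n by (smt (verit) divide_nonneg_nonneg of_nat_0_le_iff)
    have "(\<Sum>i<n. hdist (\<gamma> (h (u i))) (\<gamma> (h (u (Suc i))))) \<in> ?S"
      by (rule CollectI, intro exI[of _ n] exI[of _ "\<lambda>i. h (u i)"])
        (use u umono h_mono h01 un in auto)
    then have "(\<Sum>i<n. hdist (\<gamma> (h (u i))) (\<gamma> (h (u (Suc i))))) \<le> y" by (rule y)
    moreover have "(\<Sum>i<n. (1 - k * U / a / real n) * (arc_integral k (u (Suc i)) - arc_integral k (u i)))
        \<le> (\<Sum>i<n. hdist (\<gamma> (h (u i))) (\<gamma> (h (u (Suc i)))))"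
    proof (rule sum_mono)
      fix i assume "i \<in> {..<n}"
      then have i: "u i \<in> {0..U}" "u (Suc i) \<in> {0..U}" using u by auto
      have eq: "hdist (\<gamma> (h (u i))) (\<gamma> (h (u (Suc i)))) = 2 * arsinh (chord_half k (u i) (u (Suc i)))"
        using step[of "h (u i)" "h (u (Suc i))"] h[OF i(1)] h[OF i(2)] h_mono[OF i umono] by auto
      have "k * (u (Suc i) - u i) / a = k * U / a / real n" unfolding ud by simp
      then show "(1 - k * U / a / real n) * (arc_integral k (u (Suc i)) - arc_integral k (u i))
          \<le> hdist (\<gamma> (h (u i))) (\<gamma> (h (u (Suc i))))"
        unfolding eq using chord_le_arc(2)[OF U(2) k _ umono, of i] i by (simp add: a_def)
    qed
    moreover have "(\<Sum>i<n. (1 - k * U / a / real n) * (arc_integral k (u (Suc i)) - arc_integral k (u i)))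
        = (1 - k * U / a / real n) * arc_integral k U"
      using sum_lessThan_telescope[of "\<lambda>i. arc_integral k (u i)" n]
      unfolding sum_distrib_left[symmetric] un G0 by simp
    ultimately show ?thesis by linarith
  qed
  have "Sup ?S = arc_integral k U"
  proof (rule cSup_eq_non_empty)
    have "(\<Sum>i<1. hdist (\<gamma> (real i)) (\<gamma> (real (Suc i)))) \<in> ?S"
      by (rule CollectI, intro exI[of _ "1::nat"] exI[of _ "\<lambda>i. real i"]) auto
    then show "?S \<noteq> {}" by blast
    show "x \<le> arc_integral k U" if "x \<in> ?S" for x using upper[OF that] .
    fix y assume y: "\<And>x. x \<in> ?S \<Longrightarrow> x \<le> y"
    have "(\<lambda>n. (1 - k * U / a / real n) * arc_integral k U) \<longlonglongrightarrow> (1 - 0) * arc_integral k U"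
      by (intro tendsto_intros lim_const_over_n)
    then have "(1 - 0) * arc_integral k U \<le> y"
      by (rule LIMSEQ_le_const2) (use lower[OF y] in \<open>auto intro!: exI[of _ "1::nat"]\<close>)
    then show "arc_integral k U \<le> y" by simp
  qed
  then show ?thesis unfolding hlength_def .
qed

definition hcurve :: "real \<times> complex \<Rightarrow> real \<Rightarrow> complex set" where
  "hcurve N k = {z \<in> hplane. mink (lift z) N = - k}"

text \<open>Two points of a circle bound two arcs. Avoiding the point antipodal to \<open>X\<close> selects the one that is
  covered by the parametrization.\<close>

lemma hlength_arc_in_hcurve:
  assumes fr: "frame X \<nu> \<tau>" and N: "N = k *\<^sub>R X + \<nu>" and k: "0 < k"
    and U: "0 < U" "0 < arc_denom k U"
    and \<gamma>: "arc \<gamma>" "path_image \<gamma> \<subseteq> hcurve N k"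
    and ends: "pathstart \<gamma> = klein X" "pathfinish \<gamma> = klein (arc_point k X \<nu> \<tau> U)"
    and antipode: "1 < k\<^sup>2 \<Longrightarrow> klein (X + (2 / (k\<^sup>2 - 1)) *\<^sub>R (X + k *\<^sub>R \<nu>)) \<notin> path_image \<gamma>"
  shows "hlength \<gamma> = arc_integral k U"
proof -
  define g where "g = (\<lambda>t. arc_param k X \<tau> (lift (\<gamma> t)))"
  have on: "\<gamma> t \<in> hplane" "mink (lift (\<gamma> t)) N = - k" if "t \<in> {0..1}" for t
    using subsetD[OF \<gamma>(2), of "\<gamma> t"] that by (auto simp: hcurve_def path_image_def)
  have param: "0 < 2 + (k\<^sup>2 - 1) * (mink (lift (\<gamma> t)) X + 1) \<and>
      lift (\<gamma> t) = arc_point k X \<nu> \<tau> (g t)" if t: "t \<in> {0..1}" for t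
  proof (rule arc_point_surj[OF fr N lift_hyperboloid[OF on(1)[OF t]] on(2)[OF t]], goal_cases)
    case 1
    then show ?case by (simp add: g_def)
  next
    case 2
    then have "\<gamma> t = klein (X + (2 / (k\<^sup>2 - 1)) *\<^sub>R (X + k *\<^sub>R \<nu>))"
      using klein_lift[OF on(1)[OF t]] by simp
    moreover have "\<gamma> t \<in> path_image \<gamma>" using t by (simp add: path_image_def)
    ultimately show ?case using antipode[OF 2(1)] by simp
  qed
  have \<gamma>eq: "\<gamma> t = klein (arc_point k X \<nu> \<tau> (g t))" if "t \<in> {0..1}" for t
    using param[OF that] klein_lift[OF on(1)[OF that]] by simp
  have cont\<gamma>: "continuous_on {0..1} \<gamma>" and inj: "inj_on \<gamma> {0..1}"
    using \<gamma>(1) by (auto simp: arc_def path_def)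
  have contl: "continuous_on {0..1} (\<lambda>t. lift (\<gamma> t))"
    by (rule continuous_on_compose2[OF continuous_on_lift cont\<gamma>]) (use on in auto)
  have "continuous_on {0..1} g"
    unfolding g_def arc_param_def using param
    by (intro continuous_intros contl) force
  moreover have "inj_on g {0..1}"
    using inj \<gamma>eq by (metis inj_on_def)
  moreover have "g 0 = 0"
    using ends(1) lift_klein[OF frameD(1)[OF fr]] frameD[OF fr]
    by (simp add: g_def pathstart_def arc_param_def)
  moreover have "g 1 = U"
    using ends(2) lift_klein[OF arc_point_hyperboloid[OF fr N U(2)]] arc_param_arc_point[OF fr N U(2)]
    by (simp add: g_def pathfinish_def)
  ultimately show ?thesis by (rule hlength_arc[OF fr k U _ _ _ _ \<gamma>eq])
qed

section \<open>Generalized circles as plane sections of the hyperboloid\<close>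

text \<open>The convex side of \<open>hcurve N k\<close>.\<close>

definition hside :: "real \<times> complex \<Rightarrow> real \<Rightarrow> complex set" where
  "hside N k = {z \<in> hplane. - k \<le> mink (lift z) N}"

text \<open>The point at distance \<open>artanh (min k (1 / k))\<close> from \<open>X\<close> in the direction of the unit normal
  \<open>N - k X\<close>, up to scaling. For \<open>k \<ge> 1\<close> this is a multiple of \<open>N\<close>, that is, the center; for \<open>k < 1\<close> it
  is the foot of the perpendicular from \<open>X\<close> to the axis.\<close>

definition foot :: "real \<times> complex \<Rightarrow> real \<Rightarrow> real \<times> complex \<Rightarrow> real \<times> complex" where
  "foot N k X = X + min k (1 / k) *\<^sub>R (N - k *\<^sub>R X)"

text \<open>A generalized circle as a plane section of the hyperboloid. The vector \<open>N\<close> is timelike, lightlike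
  or spacelike for a circle, a horocycle or a hypercycle, respectively. For hypercycles the sign of \<open>N\<close>
  distinguishes the two components; for the others \<open>N\<close> has to point to the future.\<close>

definition represents :: "gcircle \<Rightarrow> real \<times> complex \<Rightarrow> real \<Rightarrow> bool" where
  "represents C N k \<longleftrightarrow> 0 < k \<and> mink N N = 1 - k\<^sup>2 \<and> (1 \<le> k \<longrightarrow> 0 < fst N) \<and>
     gcurve C = hcurve N k \<and> convex_side C = hside N k \<and>
     (\<forall>t\<in>hcurve N k. \<forall>p. edge_end C t p \<longleftrightarrow> p = klein (foot N k (lift t)))"

lemma hdist_le_iff:
  assumes "z \<in> hplane" "w \<in> hplane" "0 \<le> r"
  shows "hdist z w \<le> r \<longleftrightarrow> - cosh r \<le> mink (lift z) (lift w)"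
    and "hdist z w = r \<longleftrightarrow> mink (lift z) (lift w) = - cosh r"
proof -
  define x where "x = - mink (lift z) (lift w)"
  have x: "1 \<le> x" using mink_hyperboloid_le[OF lift_hyperboloid lift_hyperboloid] assms by (force simp: x_def)
  have h: "hdist z w = arcosh x" by (simp add: hdist_lift x_def)
  have 1: "arcosh x \<le> r \<longleftrightarrow> x \<le> cosh r"
    using cosh_real_nonneg_le_iff[of "arcosh x" r] x assms(3) by simp
  have 2: "arcosh x = r \<longleftrightarrow> x = cosh r"
    using x assms(3) by (metis arcosh_cosh_real cosh_arcosh_real)
  show "hdist z w \<le> r \<longleftrightarrow> - cosh r \<le> mink (lift z) (lift w)"
    "hdist z w = r \<longleftrightarrow> mink (lift z) (lift w) = - cosh r"
    unfolding h 1 2 by (auto simp: x_def)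
qed

lemma min_reciprocal:
  fixes k :: real assumes "0 < k"
  shows "k \<le> 1 \<Longrightarrow> min k (1 / k) = k" "1 \<le> k \<Longrightarrow> min k (1 / k) = 1 / k"
proof -
  show "min k (1 / k) = k" if "k \<le> 1"
  proof -
    have "k * k \<le> 1" using assms that by (intro mult_le_one) auto
    then have "k \<le> 1 / k" using assms by (simp add: le_divide_eq)
    then show ?thesis by simp
  qed
  show "min k (1 / k) = 1 / k" if "1 \<le> k"
  proof -
    have "1 * 1 \<le> k * k" using assms that by (intro mult_mono) auto
    then have "1 / k \<le> k" using assms by (simp add: divide_le_eq)
    then show ?thesis by simp
  qed
qed

lemma divide_eq_neg_iff:
  fixes s :: real assumes "0 < s"
  shows "x / s = - (c / s) \<longleftrightarrow> x = - c" "- (c / s) \<le> x / s \<longleftrightarrow> - c \<le> x"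
proof -
  have "- (c / s) = (- c) / s" by simp
  then show "x / s = - (c / s) \<longleftrightarrow> x = - c" "- (c / s) \<le> x / s \<longleftrightarrow> - c \<le> x"
    using assms by (simp_all only: divide_cancel_right divide_le_cancel) auto
qed

lemma sech_square: "1 / cosh r * (1 / cosh r) = 1 - (tanh (r::real))\<^sup>2"
proof -
  have "1 - (tanh r)\<^sup>2 = ((cosh r)\<^sup>2 - (sinh r)\<^sup>2) / (cosh r)\<^sup>2"
    by (simp add: tanh_def power_divide diff_divide_distrib)
  then show ?thesis using hyperbolic_pythagoras[of r] by (simp add: power2_eq_square)
qed

lemma circle_represents:
  assumes c: "c \<in> hplane" and r: "0 < r"
  shows "represents (Circle c r) ((1 / sinh r) *\<^sub>R lift c) (cosh r / sinh r)"
proof -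
  have s: "0 < sinh r" using r by simp
  have k: "1 < cosh r / sinh r" using s sinh_less_cosh_real[of r] by simp
  have k2: "(cosh r / sinh r)\<^sup>2 = 1 + 1 / (sinh r)\<^sup>2"
    using s by (simp add: power_divide cosh_square_eq add_divide_distrib)
  have on: "mink (lift z) ((1 / sinh r) *\<^sub>R lift c) = mink (lift z) (lift c) / sinh r" for z by simp
  have eq: "hdist z c = r \<longleftrightarrow> mink (lift z) ((1 / sinh r) *\<^sub>R lift c) = - (cosh r / sinh r)"
    "hdist z c \<le> r \<longleftrightarrow> - (cosh r / sinh r) \<le> mink (lift z) ((1 / sinh r) *\<^sub>R lift c)"
    if "z \<in> hplane" for z
    unfolding hdist_le_iff[OF that c less_imp_le[OF r]] on divide_eq_neg_iff[OF s] by auto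
  have foot: "foot ((1 / sinh r) *\<^sub>R lift c) (cosh r / sinh r) X = (1 / cosh r) *\<^sub>R lift c" for X
  proof -
    have "min (cosh r / sinh r) (1 / (cosh r / sinh r)) = sinh r / cosh r"
      using k by (subst min_reciprocal(2)) auto
    then show ?thesis unfolding foot_def using s by (simp add: scaleR_diff_right)
  qed
  show ?thesis
    unfolding represents_def
    using k k2 s eq lift_hyperboloid[OF c] c
    by (auto simp: hyperboloid_def hcurve_def hside_def foot klein_scale power2_eq_square)
qed

text \<open>The horocycles centered at \<open>\<xi>\<close> are the level sets of this function.\<close>

definition ideal_height :: "complex \<Rightarrow> complex \<Rightarrow> real" where
  "ideal_height \<xi> z = - mink (lift z) (1, \<xi>)"

lemma ideal_height_pos:
  assumes "z \<in> hplane" "cmod \<xi> = 1" shows "0 < ideal_height \<xi> z"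
  unfolding ideal_height_def
  using mink_future[OF lift_hyperboloid[OF assms(1)], of "(1, \<xi>)"] assms(2)
  by (simp add: mink_homogeneous dot_square_norm mink_commute[of "lift z"])

lemma arcosh_scaled:
  assumes "0 < s" "s \<le> x" shows "arcosh (x / s) = ln ((x + sqrt (x\<^sup>2 - s\<^sup>2)) / s)"
proof -
  have "sqrt ((x / s)\<^sup>2 - 1) = sqrt ((x\<^sup>2 - s\<^sup>2) / s\<^sup>2)"
    using assms by (simp add: power_divide diff_divide_distrib)
  also have "\<dots> = sqrt (x\<^sup>2 - s\<^sup>2) / s" using assms by (simp add: real_sqrt_divide)
  finally show ?thesis using assms by (simp add: arcosh_real_def add_divide_distrib)
qed

text \<open>Near \<open>\<xi>\<close> the distance is \<open>ln (f z w / s w)\<close> with a factor \<open>s\<close> that vanishes at \<open>\<xi>\<close> but depends on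
  \<open>w\<close> only. It cancels in the difference of two distances.\<close>

lemma busemann_eq:
  assumes xi: "cmod \<xi> = 1" and q: "q \<in> hplane" and z: "z \<in> hplane"
  shows "busemann \<xi> q z = ln (ideal_height \<xi> z / ideal_height \<xi> q)"
proof -
  let ?F = "at \<xi> within hplane"
  define s where "s = (\<lambda>w. sqrt (1 - (cmod w)\<^sup>2))"
  define x where "x = (\<lambda>z w. - mink (lift z) (1, w))"
  have xcont: "((\<lambda>w. x z w) \<longlongrightarrow> ideal_height \<xi> z) ?F" for z
    unfolding x_def ideal_height_def mink_def by (auto intro!: tendsto_intros)
  have "((\<lambda>w. s w) \<longlongrightarrow> s \<xi>) ?F" unfolding s_def by (intro tendsto_intros)
  then have s0: "((\<lambda>w. s w) \<longlongrightarrow> 0) ?F" using xi by (simp add: s_def)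
  define f where "f = (\<lambda>z w. x z w + sqrt ((x z w)\<^sup>2 - (s w)\<^sup>2))"
  have flim: "((\<lambda>w. f z w) \<longlongrightarrow> 2 * ideal_height \<xi> z) ?F" if "z \<in> hplane" for z
  proof -
    have "((\<lambda>w. f z w) \<longlongrightarrow> ideal_height \<xi> z + sqrt ((ideal_height \<xi> z)\<^sup>2 - 0\<^sup>2)) ?F"
      unfolding f_def by (intro tendsto_intros xcont s0)
    then show ?thesis using ideal_height_pos[OF that xi] by simp
  qed
  have dist: "hdist z w = ln (f z w / s w)" "0 < f z w" "0 < s w"
    if z: "z \<in> hplane" and w: "w \<in> hplane" for z w
  proof -
    show s: "0 < s w" using root_pos[OF w] by (simp add: s_def)
    have l: "lift w = (1 / s w) *\<^sub>R (1, w)" by (simp add: lift_def s_def)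
    have m: "- mink (lift z) (lift w) = x z w / s w"
      unfolding l mink_linear x_def by simp
    then have "1 \<le> x z w / s w"
      using mink_hyperboloid_le[OF lift_hyperboloid[OF z] lift_hyperboloid[OF w]] by linarith
    then have le: "s w \<le> x z w" using s by (simp add: le_divide_eq)
    then have "(s w)\<^sup>2 \<le> (x z w)\<^sup>2" using s by (intro power_mono) auto
    then show "0 < f z w" using le s unfolding f_def by (intro add_pos_nonneg) auto
    show "hdist z w = ln (f z w / s w)"
      unfolding hdist_lift m f_def using s le by (rule arcosh_scaled)
  qed
  have "((\<lambda>w. ln (f z w / f q w)) \<longlongrightarrow> ln (2 * ideal_height \<xi> z / (2 * ideal_height \<xi> q))) ?F"
    using ideal_height_pos[OF z xi] ideal_height_pos[OF q xi]
    by (intro tendsto_intros flim z q) auto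
  moreover have "\<forall>\<^sub>F w in ?F. ln (f z w / f q w) = hdist z w - hdist q w"
  proof (rule eventually_at_topological[THEN iffD2], intro exI[of _ UNIV] conjI ballI impI)
    fix w assume w: "w \<in> hplane"
    show "ln (f z w / f q w) = hdist z w - hdist q w"
      unfolding dist(1)[OF z w] dist(1)[OF q w]
      using dist(2,3)[OF z w] dist(2,3)[OF q w] by (simp add: ln_div)
  qed auto
  ultimately have "((\<lambda>w. hdist z w - hdist q w) \<longlongrightarrow> ln (ideal_height \<xi> z / ideal_height \<xi> q)) ?F"
    by (simp add: Lim_transform_eventually)
  moreover have "\<not> trivial_limit ?F"
  proof -
    have "\<xi> \<in> closure hplane" using xi by (simp add: hplane_def)
    moreover have "\<xi> \<notin> hplane" using xi by (simp add: hplane_def)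
    ultimately show ?thesis by (simp add: trivial_limit_within closure_def)
  qed
  ultimately show ?thesis unfolding busemann_def by (rule tendsto_Lim[rotated])
qed

lemma horocycle_represents:
  assumes xi: "cmod \<xi> = 1" and q: "q \<in> hplane"
  shows "represents (Horocycle \<xi> q) ((1 / ideal_height \<xi> q) *\<^sub>R (1, \<xi>)) 1"
proof -
  note pos = ideal_height_pos[OF _ xi]
  have m: "mink (lift z) ((1 / ideal_height \<xi> q) *\<^sub>R (1, \<xi>)) = - (ideal_height \<xi> z / ideal_height \<xi> q)" for z
    unfolding mink_linear by (simp add: ideal_height_def)
  have eq: "busemann \<xi> q z = 0 \<longleftrightarrow> ideal_height \<xi> z / ideal_height \<xi> q = 1"
     "busemann \<xi> q z \<le> 0 \<longleftrightarrow> ideal_height \<xi> z / ideal_height \<xi> q \<le> 1" if z: "z \<in> hplane" for z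
    unfolding busemann_eq[OF xi q z] using pos[OF z] pos[OF q] by simp_all
  have foot: "foot N 1 X = N" for N X by (simp add: foot_def)
  have kl: "klein ((1 / ideal_height \<xi> q) *\<^sub>R (1, \<xi>)) = \<xi>"
    using pos[OF q] by (subst klein_scale) (auto simp: klein_def)
  have nn: "mink ((1 / ideal_height \<xi> q) *\<^sub>R (1, \<xi>)) ((1 / ideal_height \<xi> q) *\<^sub>R (1, \<xi>)) = 0"
    unfolding mink_linear mink_homogeneous using xi by (simp add: dot_square_norm)
  show ?thesis
    unfolding represents_def gcurve.simps convex_side.simps edge_end.simps hcurve_def hside_def m foot kl nn
    using pos[OF q] eq by auto
qed

text \<open>The geodesic orthogonal to the spacelike vector \<open>n\<close>.\<close>

definition axis_of :: "real \<times> complex \<Rightarrow> complex set" where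
  "axis_of n = {z \<in> hplane. mink (lift z) n = 0}"

lemma axis_of_minus [simp]: "axis_of (- n) = axis_of n"
  by (simp add: axis_of_def)

lemma axis_of_iff: "z \<in> axis_of n \<longleftrightarrow> z \<in> hplane \<and> snd n \<bullet> z = fst n"
  using root_pos[of z] by (auto simp: axis_of_def mink_lift)

lemma klein_in_axis: "Y \<in> hyperboloid \<Longrightarrow> mink Y n = 0 \<Longrightarrow> klein Y \<in> axis_of n"
  by (simp add: axis_of_def)

lemma hyperboloid_normalize:
  assumes "mink V V < 0" "0 < fst V"
  shows "(1 / sqrt (- mink V V)) *\<^sub>R V \<in> hyperboloid"
  using assms by (simp add: hyperboloid_def)

text \<open>The hyperbolic cosine of the distance is \<open>sqrt (1 + m\<^sup>2)\<close> with \<open>m = mink (lift z) n\<close>. It is attained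
  at the projection \<open>Y\<close> of \<open>lift z\<close> to the plane orthogonal to \<open>n\<close>.\<close>

lemma hdist_set_axis:
  assumes n: "mink n n = 1" and z: "z \<in> hplane"
  shows "hdist_set z (axis_of n) = arcosh (sqrt (1 + (mink (lift z) n)\<^sup>2))"
proof -
  define X m V s where "X = lift z" and "m = mink X n" and "V = X - m *\<^sub>R n" and "s = sqrt (1 + m\<^sup>2)"
  have X: "X \<in> hyperboloid" using z by (simp add: X_def lift_hyperboloid)
  have s: "1 \<le> s" "s * s = 1 + m\<^sup>2" by (simp_all add: s_def)
  have VV: "mink V V = - (s * s)"
    using hyperboloidD(1)[OF X] n by (simp add: V_def s m_def mink_commute[of n X] power2_eq_square)
  have VX: "mink V X = - (s * s)"
    using hyperboloidD(1)[OF X] by (simp add: V_def s m_def mink_commute[of n X] power2_eq_square)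
  have "0 < fst V"
    by (rule future_if_mink_neg[OF X]) (use VV VX s(2) zero_le_power2[of m] in linarith)+
  define Y where "Y = (1 / s) *\<^sub>R V"
  have Y: "Y \<in> hyperboloid" "mink Y n = 0"
  proof -
    have "mink Y Y = -1" unfolding Y_def mink_linear VV using s(1) by simp
    moreover have "0 < fst Y" using \<open>0 < fst V\<close> s(1) by (simp add: Y_def)
    ultimately show "Y \<in> hyperboloid" by (simp add: hyperboloid_def)
    show "mink Y n = 0" using n by (simp add: Y_def V_def m_def)
  qed
  have XY: "mink X Y = - s" unfolding Y_def mink_linear mink_commute[of X] VX using s(1) by simp
  show ?thesis
    unfolding hdist_set_def
  proof (rule cInf_eq_minimum)
    show "arcosh (sqrt (1 + (mink (lift z) n)\<^sup>2)) \<in> hdist z ` axis_of n"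
      using klein_in_axis[OF Y] by (intro image_eqI[of _ _ "klein Y"])
        (simp_all add: hdist_lift Y XY[unfolded X_def] s_def m_def X_def)
    fix x assume "x \<in> hdist z ` axis_of n"
    then obtain w where w: "w \<in> hplane" "mink (lift w) n = 0" "x = hdist z w" by (auto simp: axis_of_def)
    have "mink X (lift w) = mink V (lift w)"
      using w by (simp add: V_def mink_commute[of n "lift w"])
    also have "\<dots> = s * mink Y (lift w)" using s by (simp add: Y_def)
    also have "\<dots> \<le> s * (- 1)"
      using s mink_hyperboloid_le[OF Y(1) lift_hyperboloid[OF w(1)]] by (intro mult_left_mono) auto
    finally have "s \<le> - mink X (lift w)" by simp
    then have "arcosh s \<le> arcosh (- mink X (lift w))"
      using s arcosh_less_iff_real[of "- mink X (lift w)" s] by (auto simp: not_less[symmetric])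
    then show "arcosh (sqrt (1 + (mink (lift z) n)\<^sup>2)) \<le> x"
      by (simp add: w hdist_lift s_def m_def X_def)
  qed
qed

text \<open>For \<open>k < 1\<close> the rational parametrization covers the curve, and its domain is an interval.\<close>

lemma connected_hcurve:
  assumes k: "0 < k" "k < 1" and N: "mink N N = 1 - k\<^sup>2"
  shows "connected (hcurve N k)"
proof (cases "hcurve N k = {}")
  case False
  then obtain t where t: "t \<in> hplane" "mink (lift t) N = - k" by (auto simp: hcurve_def)
  define X \<nu> where "X = lift t" and "\<nu> = N - k *\<^sub>R X"
  have X: "X \<in> hyperboloid" using t by (simp add: X_def lift_hyperboloid)
  have tX: "mink X N = - k" "mink N X = - k" using t by (simp_all add: X_def mink_commute[of N])
  have fr: "frame X \<nu> (lcross X \<nu>)"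
    using hyperboloidD(1)[OF X] N tX
    by (intro frame_exists[OF X]) (simp_all add: \<nu>_def algebra_simps power2_eq_square)
  have NX: "N = k *\<^sub>R X + \<nu>" by (simp add: \<nu>_def)
  define J where "J = {u. 0 < arc_denom k u}"
  have "is_interval J"
    unfolding is_interval_1 J_def mem_Collect_eq
  proof (intro ballI allI impI, elim conjE, simp only: mem_Collect_eq)
    fix a b x assume ab: "0 < arc_denom k a" "0 < arc_denom k b" "a \<le> x" "x \<le> b"
    have k1: "k\<^sup>2 - 1 \<le> 0" using k by (simp add: power_le_one)
    have "x\<^sup>2 \<le> max (a\<^sup>2) (b\<^sup>2)"
    proof (cases "0 \<le> x")
      case True
      then have "x\<^sup>2 \<le> b\<^sup>2" using ab by (intro power_mono) auto
      then show ?thesis by simp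
    next
      case False
      then have "(- x)\<^sup>2 \<le> (- a)\<^sup>2" using ab by (intro power_mono) auto
      then show ?thesis by simp
    qed
    then have "(k\<^sup>2 - 1) * max (a\<^sup>2) (b\<^sup>2) \<le> (k\<^sup>2 - 1) * x\<^sup>2" using k1 by (rule mult_left_mono_neg)
    then show "0 < arc_denom k x" using ab by (auto simp: arc_denom_def max_def split: if_splits)
  qed
  then have "connected J" by (simp add: is_interval_connected)
  moreover have "continuous_on J (\<lambda>u. klein (arc_point k X \<nu> (lcross X \<nu>) u))"
    by (rule continuous_on_klein_arc_point[OF fr NX]) (simp add: J_def)
  ultimately have "connected ((\<lambda>u. klein (arc_point k X \<nu> (lcross X \<nu>) u)) ` J)"
    by (rule connected_continuous_image[rotated])
  moreover have "hcurve N k = (\<lambda>u. klein (arc_point k X \<nu> (lcross X \<nu>) u)) ` J"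
  proof
    show "(\<lambda>u. klein (arc_point k X \<nu> (lcross X \<nu>) u)) ` J \<subseteq> hcurve N k"
      using arc_point_hyperboloid[OF fr NX] mink_arc_point_frame(3)[OF fr NX]
      by (auto simp: hcurve_def J_def)
    show "hcurve N k \<subseteq> (\<lambda>u. klein (arc_point k X \<nu> (lcross X \<nu>) u)) ` J"
    proof
      fix z assume z: "z \<in> hcurve N k"
      then have z': "z \<in> hplane" "mink (lift z) N = - k" by (auto simp: hcurve_def)
      show "z \<in> (\<lambda>u. klein (arc_point k X \<nu> (lcross X \<nu>) u)) ` J"
      proof (rule arc_point_surj[OF fr NX lift_hyperboloid[OF z'(1)] z'(2)], goal_cases)
        case 1
        then have "arc_param k X (lcross X \<nu>) (lift z) \<in> J" by (simp add: J_def)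
        moreover have "z = klein (arc_point k X \<nu> (lcross X \<nu>) (arc_param k X (lcross X \<nu>) (lift z)))"
          using 1(3) klein_lift[OF z'(1)] by metis
        ultimately show ?case by blast
      next
        case 2
        then show ?case using k power_le_one[of k 2] by simp
      qed
    qed
  qed
  ultimately show ?thesis by simp
qed simp

lemma open_halfplane_klein: "open {z \<in> hplane. mink (lift z) N < 0}" "open {z \<in> hplane. 0 < mink (lift z) N}"
proof -
  have "{z \<in> hplane. mink (lift z) N < 0} = hplane \<inter> {z. snd N \<bullet> z < fst N}"
    using root_pos by (auto simp: mink_lift divide_less_0_iff hplane_iff)
  moreover have "{z \<in> hplane. 0 < mink (lift z) N} = hplane \<inter> {z. snd N \<bullet> z > fst N}"
    using root_pos by (auto simp: mink_lift zero_less_divide_iff hplane_iff)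
  ultimately show "open {z \<in> hplane. mink (lift z) N < 0}" "open {z \<in> hplane. 0 < mink (lift z) N}"
    by (auto simp: hplane_def intro!: open_Int open_halfspace_lt open_halfspace_gt)
qed

text \<open>Separation by open sets makes each of two connected pieces a full component.\<close>

lemma components_two:
  fixes P Q :: "'a::topological_space set"
  assumes "connected P" "connected Q" "P \<noteq> {}" "Q \<noteq> {}"
    and U: "open U" "open V" "P \<subseteq> U" "Q \<subseteq> V" "U \<inter> V = {}"
  shows "components (P \<union> Q) = {P, Q}"
proof -
  have key: "A \<in> components (A \<union> B)"
    if "connected A" "A \<noteq> {}" "open W" "open W'" "A \<subseteq> W" "B \<subseteq> W'" "W \<inter> W' = {}"
    for A B W W' :: "'a set"
    unfolding in_components_maximal
  proof (intro conjI allI impI)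
    fix D assume D: "D \<noteq> {} \<and> A \<subseteq> D \<and> D \<subseteq> A \<union> B \<and> connected D"
    have "W \<inter> D = {} \<or> W' \<inter> D = {}"
      by (rule connectedD[of D]) (use D that in auto)
    then show "D = A" using D that by blast
  qed (use that in auto)
  have "P \<in> components (P \<union> Q)" using key[of P U V Q] assms by auto
  moreover have "Q \<in> components (P \<union> Q)"
    using key[of Q V U P] assms by (auto simp: Un_commute)
  moreover have "C = P \<or> C = Q" if C: "C \<in> components (P \<union> Q)" for C
  proof -
    obtain x where "x \<in> C" "x \<in> P \<union> Q"
      using in_components_nonempty[OF C] in_components_subset[OF C] by blast
    then show ?thesis using components_nonoverlap[OF C] calculation by blast
  qed
  ultimately show ?thesis by blast
qed

lemma hcurve_nonempty:
  assumes n: "mink n n = 1" and A: "axis_of n \<noteq> {}"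
  shows "hcurve ((1 / cosh r) *\<^sub>R n) (tanh r) \<noteq> {}"
proof -
  obtain a where a: "a \<in> hplane" "mink (lift a) n = 0" using A by (auto simp: axis_of_def)
  define X where "X = cosh r *\<^sub>R lift a - sinh r *\<^sub>R n"
  note la = lift_hyperboloid[OF a(1)]
  have "X \<in> hyperboloid"
  proof (rule hyperboloidI[OF la])
    have na: "mink n (lift a) = 0" using a(2) by (simp add: mink_commute)
    show "mink X X = -1" using hyperboloidD(1)[OF la] a n na hyperbolic_pythagoras[of r]
      by (simp add: X_def power2_eq_square)
    show "mink X (lift a) < 0" using hyperboloidD(1)[OF la] na
      by (simp add: X_def)
  qed
  then have "klein X \<in> hcurve ((1 / cosh r) *\<^sub>R n) (tanh r)"
    using a n by (simp add: hcurve_def X_def tanh_def)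
  then show ?thesis by blast
qed

text \<open>The points at distance \<open>r\<close> from the axis satisfy \<open>mink (lift z) n = - sinh r\<close> or
  \<open>mink (lift z) n = sinh r\<close>; the two half-planes bounded by the axis separate the solutions.\<close>

lemma hypercycle_components:
  assumes n: "mink n n = 1" and A: "axis_of n \<noteq> {}" and r: "0 < r"
  shows "components {z \<in> hplane. hdist_set z (axis_of n) = r} =
    {hcurve ((1 / cosh r) *\<^sub>R n) (tanh r), hcurve ((1 / cosh r) *\<^sub>R - n) (tanh r)}"
proof -
  have c: "0 < cosh r" "0 < sinh r" using r by auto
  have iff: "hdist_set z (axis_of n) = r \<longleftrightarrow> mink (lift z) n = - sinh r \<or> mink (lift z) n = sinh r"
    if z: "z \<in> hplane" for z
  proof -
    define m where "m = mink (lift z) n"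
    have "arcosh (sqrt (1 + m\<^sup>2)) = r \<longleftrightarrow> sqrt (1 + m\<^sup>2) = cosh r"
      using r by (metis arcosh_cosh_real cosh_arcosh_real less_imp_le real_sqrt_ge_1_iff le_add_same_cancel1 zero_le_power2)
    also have "\<dots> \<longleftrightarrow> 1 + m\<^sup>2 = (cosh r)\<^sup>2"
      using c by (metis less_imp_le real_sqrt_pow2 real_sqrt_unique add_nonneg_nonneg zero_le_one zero_le_power2)
    also have "\<dots> \<longleftrightarrow> m\<^sup>2 = (sinh r)\<^sup>2" by (auto simp: cosh_square_eq)
    also have "\<dots> \<longleftrightarrow> m = - sinh r \<or> m = sinh r" by (auto simp: power2_eq_iff)
    finally show ?thesis unfolding hdist_set_axis[OF n z] m_def .
  qed
  have "{z \<in> hplane. hdist_set z (axis_of n) = r} =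
     hcurve ((1 / cosh r) *\<^sub>R n) (tanh r) \<union> hcurve ((1 / cosh r) *\<^sub>R - n) (tanh r)"
    using iff c by (auto simp: hcurve_def tanh_def divide_eq_eq)
  moreover have "components (hcurve ((1 / cosh r) *\<^sub>R n) (tanh r) \<union> hcurve ((1 / cosh r) *\<^sub>R - n) (tanh r)) =
    {hcurve ((1 / cosh r) *\<^sub>R n) (tanh r), hcurve ((1 / cosh r) *\<^sub>R - n) (tanh r)}"
  proof (rule components_two[OF _ _ _ _ open_halfplane_klein[of n]])
    note nn = sech_square[of r]
    have t: "0 < tanh r" "tanh r < 1" using r by (simp_all add: tanh_real_lt_1)
    show "connected (hcurve ((1 / cosh r) *\<^sub>R n) (tanh r))" "connected (hcurve ((1 / cosh r) *\<^sub>R - n) (tanh r))"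
      using nn n by (auto intro!: connected_hcurve[OF t])
    show "hcurve ((1 / cosh r) *\<^sub>R n) (tanh r) \<noteq> {}" by (rule hcurve_nonempty[OF n A])
    show "hcurve ((1 / cosh r) *\<^sub>R - n) (tanh r) \<noteq> {}" using hcurve_nonempty[of "- n" r] n A by simp
    show "hcurve ((1 / cosh r) *\<^sub>R n) (tanh r) \<subseteq> {z \<in> hplane. mink (lift z) n < 0}"
      "hcurve ((1 / cosh r) *\<^sub>R - n) (tanh r) \<subseteq> {z \<in> hplane. 0 < mink (lift z) n}"
      using c t by (auto simp: hcurve_def field_simps intro: mult_pos_pos)
  qed auto
  ultimately show ?thesis by simp
qed

text \<open>Multiplied by \<open>sqrt (1 - (cmod z)\<^sup>2)\<close>, the inequality compares an affine function with a multiple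
  of that root, which is a concave function by the reversed Cauchy-Schwarz inequality.\<close>

lemma convex_hside_interior: "convex {z \<in> hplane. - k < mink (lift z) N}" if k: "0 < k"
proof (rule convexI)
  fix x y and u v :: real
  assume x: "x \<in> {z \<in> hplane. - k < mink (lift z) N}" and y: "y \<in> {z \<in> hplane. - k < mink (lift z) N}"
    and uv: "0 \<le> u" "0 \<le> v" "u + v = 1"
  define s where "s = (\<lambda>z. sqrt (1 - (cmod z)\<^sup>2))"
  define z where "z = u *\<^sub>R x + v *\<^sub>R y"
  have xy: "x \<in> hplane" "y \<in> hplane" using x y by auto
  have z: "z \<in> hplane" 
    using convexD[OF convex_ball[of 0 1], of x y u v] xy uv by (simp add: hplane_def z_def)
  have s: "0 < s x" "0 < s y" "0 < s z" using xy z root_pos by (auto simp: s_def)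
  have l: "(1, w) = s w *\<^sub>R lift w" if "w \<in> hplane" for w
    using root_pos[OF that] by (simp add: lift_def s_def)
  have sz: "(s w)\<^sup>2 = - mink (1, w) (1, w)" if "w \<in> hplane" for w
    using root_pos[OF that] by (simp add: s_def mink_homogeneous dot_square_norm)
  have comb: "(1, z) = (u * s x) *\<^sub>R lift x + (v * s y) *\<^sub>R lift y"
    using uv by (simp add: z_def l[OF xy(1), symmetric] l[OF xy(2), symmetric] flip: scaleR_scaleR)
  have m: "mink (lift x) (lift y) \<le> -1" by (intro mink_hyperboloid_le lift_hyperboloid xy)
  have "(u * s x + v * s y)\<^sup>2 \<le> (s z)\<^sup>2"
  proof -
    have "(s z)\<^sup>2 = (u * s x)\<^sup>2 + (v * s y)\<^sup>2 - 2 * (u * s x) * (v * s y) * mink (lift x) (lift y)"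
      unfolding sz[OF z] comb using hyperboloidD(1)[OF lift_hyperboloid[OF xy(1)]]
        hyperboloidD(1)[OF lift_hyperboloid[OF xy(2)]]
      by (simp add: mink_commute[of "lift y" "lift x"] power2_eq_square algebra_simps)
    moreover have "0 \<le> (u * s x) * (v * s y) * (-1 - mink (lift x) (lift y))"
      using m uv s by (intro mult_nonneg_nonneg) auto
    ultimately show ?thesis by (simp add: power2_eq_square algebra_simps)
  qed
  then have le: "u * s x + v * s y \<le> s z" using s by (meson less_imp_le power2_le_imp_le)
  have "- k * s z \<le> - k * (u * s x + v * s y)" using le k by (intro mult_left_mono_neg) auto
  also have "\<dots> = u * (s x * - k) + v * (s y * - k)" by (simp add: algebra_simps)
  also have "\<dots> < u * (s x * mink (lift x) N) + v * (s y * mink (lift y) N)"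
  proof -
    have "- k < mink (lift x) N" "- k < mink (lift y) N" using x y by auto
    then have a: "s x * - k < s x * mink (lift x) N" "s y * - k < s y * mink (lift y) N"
      using s by (blast intro: mult_strict_left_mono)+
    show ?thesis
    proof (cases "u = 0")
      case False
      then have "u * (s x * - k) < u * (s x * mink (lift x) N)"
        by (intro mult_strict_left_mono[OF a(1)]) (use uv False in auto)
      moreover have "v * (s y * - k) \<le> v * (s y * mink (lift y) N)"
        by (intro mult_left_mono[OF less_imp_le[OF a(2)]] uv)
      ultimately show ?thesis by linarith
    qed (use a uv in simp)
  qed
  also have "\<dots> = mink (1, z) N" unfolding comb by simp
  also have "\<dots> = s z * mink (lift z) N" using arg_cong[OF l[OF z], of "\<lambda>V. mink V N"] by (simp only: mink_linear)
  finally have "s z * - k < s z * mink (lift z) N" by (simp add: mult.commute)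
  then have "- k < mink (lift z) N" by (rule mult_less_cancel_left_pos[OF s(3), THEN iffD1])
  then show "u *\<^sub>R x + v *\<^sub>R y \<in> {z \<in> hplane. - k < mink (lift z) N}"
    using z by (simp add: z_def[symmetric])
qed

text \<open>The metric of the Klein model is the Minkowski form on the tangent plane at \<open>lift p\<close>. Tangent
  vectors of the disk correspond to vectors without time coordinate, projected along \<open>lift p\<close>.\<close>

lemma hinner_frame:
  assumes p: "p \<in> hplane" and fr: "frame (lift p) n \<tau>"
  shows "hinner p u v = (mink (0, u) n * mink (0, v) n + mink (0, u) \<tau> * mink (0, v) \<tau>) / (1 - (cmod p)\<^sup>2)"
proof -
  define s where "s = 1 - (cmod p)\<^sup>2"
  have s: "0 < s" using p by (simp add: s_def hplane_iff)
  have m: "mink (0, w) (lift p) = (p \<bullet> w) / sqrt s" for w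
    unfolding lift_def mink_linear by (simp add: mink_def s_def inner_commute)
  have "mink (0, u) (0, v) = mink (0, u) (- mink (0, v) (lift p) *\<^sub>R lift p + mink (0, v) n *\<^sub>R n + mink (0, v) \<tau> *\<^sub>R \<tau>)"
    using frame_expand[OF fr, of "(0, v)"] by simp
  also have "\<dots> = - (p \<bullet> u) * (p \<bullet> v) / s + mink (0, u) n * mink (0, v) n + mink (0, u) \<tau> * mink (0, v) \<tau>"
    using s by (simp add: m)
  finally have "u \<bullet> v + (p \<bullet> u) * (p \<bullet> v) / s = mink (0, u) n * mink (0, v) n + mink (0, u) \<tau> * mink (0, v) \<tau>"
    by (simp add: mink_def)
  moreover have "hinner p u v = (u \<bullet> v + (p \<bullet> u) * (p \<bullet> v) / s) / s"
    unfolding hinner_def s_def[symmetric] using s by (simp add: add_divide_distrib power2_eq_square)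
  ultimately show ?thesis by (simp add: s_def)
qed

text \<open>In the frame at \<open>p\<close> given by \<open>n\<close> and the direction \<open>\<tau>\<close> of the axis, orthogonality says that the
  \<open>\<tau>\<close>-component of \<open>lift t\<close> vanishes. Then \<open>p\<close> is the projection of \<open>lift t\<close> along \<open>n\<close>.\<close>

lemma hypercycle_edge_end:
  assumes n: "mink n n = 1" and r: "0 < r" and t: "t \<in> hcurve ((1 / cosh r) *\<^sub>R n) (tanh r)"
  shows "(p \<in> axis_of n \<and> (\<forall>a\<in>axis_of n. hinner p (a - p) (t - p) = 0)) \<longleftrightarrow>
     p = klein (foot ((1 / cosh r) *\<^sub>R n) (tanh r) (lift t))"
proof -
  define X where "X = lift t"
  have tp: "t \<in> hplane" and c: "0 < cosh r" using t by (auto simp: hcurve_def)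
  have X: "X \<in> hyperboloid" using tp by (simp add: X_def lift_hyperboloid)
  have Xn: "mink X n = - sinh r" "mink n X = - sinh r"
    using t divide_eq_neg_iff(1)[OF c] by (auto simp: hcurve_def X_def tanh_def mink_commute[of n "lift t"])
  define Z where "Z = X + sinh r *\<^sub>R n"
  have Z: "mink Z n = 0" "mink Z Z = - (cosh r)\<^sup>2" "mink Z X = - (cosh r)\<^sup>2"
    using Xn n hyperboloidD(1)[OF X] cosh_square_eq[of r]
    by (simp_all add: Z_def power2_eq_square)
  have fZ: "0 < fst Z" by (rule future_if_mink_neg[OF X]) (use Z c in auto)
  have foot: "klein (foot ((1 / cosh r) *\<^sub>R n) (tanh r) (lift t)) = klein Z"
  proof -
    have t1: "0 < tanh r" "tanh r < 1" using r by (simp_all add: tanh_real_lt_1)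
    then have "min (tanh r) (1 / tanh r) = tanh r" by (intro min_reciprocal) auto
    then have "foot ((1 / cosh r) *\<^sub>R n) (tanh r) X = (1 - (tanh r)\<^sup>2) *\<^sub>R X + (tanh r / cosh r) *\<^sub>R n"
      by (simp add: foot_def algebra_simps power2_eq_square)
    also have "1 - (tanh r)\<^sup>2 = 1 / (cosh r)\<^sup>2"
      using sech_square[of r] by (simp add: power2_eq_square)
    also have "tanh r / cosh r = (1 / (cosh r)\<^sup>2) * sinh r" by (simp add: tanh_def power2_eq_square)
    finally have "foot ((1 / cosh r) *\<^sub>R n) (tanh r) X = (1 / (cosh r)\<^sup>2) *\<^sub>R Z"
      by (simp add: Z_def scaleR_add_right)
    then show ?thesis using c by (simp add: X_def klein_scale)
  qed
  have perp: "(\<forall>a\<in>axis_of n. hinner p (a - p) (t - p) = 0) \<longleftrightarrow> p = klein Z" if p: "p \<in> axis_of n"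
  proof -
    have pp: "p \<in> hplane" "mink (lift p) n = 0" using p by (auto simp: axis_of_def)
    note lp = lift_hyperboloid[OF pp(1)]
    define \<tau> where "\<tau> = lcross (lift p) n"
    have fr: "frame (lift p) n \<tau>" unfolding \<tau>_def by (rule frame_exists[OF lp pp(2) n])
    have hom: "(1, w) = sqrt (1 - (cmod w)\<^sup>2) *\<^sub>R lift w" if "w \<in> hplane" for w
      using root_pos[OF that] by (simp add: lift_def)
    have diff: "mink (0, w - p) V = sqrt (1 - (cmod w)\<^sup>2) * mink (lift w) V - sqrt (1 - (cmod p)\<^sup>2) * mink (lift p) V"
      if "w \<in> hplane" for w V
    proof -
      have "(0::real, w - p) = (1, w) - (1, p)" by simp
      then show ?thesis unfolding hom[OF that] hom[OF pp(1)] by (simp only: mink_linear)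
    qed
    have h: "hinner p (a - p) (t - p) = 0 \<longleftrightarrow> mink (lift a) \<tau> * mink X \<tau> = 0" if a: "a \<in> axis_of n" for a
    proof -
      have a': "a \<in> hplane" "mink (lift a) n = 0" using a by (auto simp: axis_of_def)
      have "mink (0, a - p) n = 0" using diff[OF a'(1)] a' pp by simp
      moreover have "mink (0, a - p) \<tau> = sqrt (1 - (cmod a)\<^sup>2) * mink (lift a) \<tau>"
        using diff[OF a'(1)] frameD[OF fr] by simp
      moreover have "mink (0, t - p) \<tau> = sqrt (1 - (cmod t)\<^sup>2) * mink X \<tau>"
        using diff[OF tp] frameD[OF fr] by (simp add: X_def)
      ultimately show ?thesis
        unfolding hinner_frame[OF pp(1) fr]
        using root_pos[OF a'(1)] root_pos[OF tp] root_pos[OF pp(1)] by auto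
    qed
    \<comment> \<open>A second point of the axis, which tests the \<open>\<tau>\<close>-component.\<close>
    define B where "B = sqrt 2 *\<^sub>R lift p + \<tau>"
    have B: "B \<in> hyperboloid"
      by (rule hyperboloidI[OF lp]) (simp_all add: B_def frameD[OF fr])
    have "klein B \<in> axis_of n" by (rule klein_in_axis[OF B]) (simp add: B_def frameD[OF fr])
    moreover have "mink B \<tau> \<noteq> 0" by (simp add: B_def frameD[OF fr])
    ultimately have "(\<forall>a\<in>axis_of n. hinner p (a - p) (t - p) = 0) \<longleftrightarrow> mink X \<tau> = 0"
      using h lift_klein[OF B] by (metis mult_eq_0_iff)
    also have "\<dots> \<longleftrightarrow> p = klein Z"
    proof
      assume "mink X \<tau> = 0"
      then have "Z = - mink X (lift p) *\<^sub>R lift p"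
        unfolding Z_def by (subst frame_expand[OF fr, of X]) (simp add: Xn)
      moreover have "mink X (lift p) \<noteq> 0" using mink_hyperboloid_le[OF X lp] by linarith
      ultimately have "klein Z = klein (lift p)" by (simp add: klein_scale del: scaleR_minus_left)
      then show "p = klein Z" using pp by simp
    next
      assume "p = klein Z"
      then have "Z = fst Z *\<^sub>R (1, p)" using scaled_klein[of Z] fZ by simp
      then have "Z = (fst Z * sqrt (1 - (cmod p)\<^sup>2)) *\<^sub>R lift p" unfolding hom[OF pp(1)] by simp
      from arg_cong[OF this, of "\<lambda>V. mink V \<tau>"]
      have "mink Z \<tau> = (fst Z * sqrt (1 - (cmod p)\<^sup>2)) * mink (lift p) \<tau>" by (simp only: mink_linear)
      then show "mink X \<tau> = 0" using frameD[OF fr] by (simp add: Z_def)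
    qed
    finally show ?thesis .
  qed
  have "klein Z \<in> axis_of n"
  proof -
    have "klein Z = klein ((1 / sqrt (- mink Z Z)) *\<^sub>R Z)" using Z c by (simp add: klein_scale)
    also have "\<dots> \<in> axis_of n"
      by (rule klein_in_axis[OF hyperboloid_normalize]) (use Z c fZ in auto)
    finally show ?thesis .
  qed
  then show ?thesis unfolding foot using perp by blast
qed

text \<open>The complement of the curve splits into the open sets \<open>U\<close> and \<open>W\<close>. As \<open>U\<close> is convex, hence
  connected, and contains the axis, it is the component that the convex side is made of.\<close>

lemma hypercycle_represents:
  assumes n: "mink n n = 1" and A: "axis_of n \<noteq> {}" and r: "0 < r"
  defines "N \<equiv> (1 / cosh r) *\<^sub>R n" and "k \<equiv> tanh r"
  shows "represents (Hypercycle (axis_of n) r (hcurve N k)) N k"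
proof -
  have c: "0 < cosh r" by simp
  have k: "0 < k" "k < 1" using r by (simp_all add: k_def tanh_real_lt_1)
  have NN: "mink N N = 1 - k\<^sup>2"
    using n sech_square[of r] by (simp add: N_def k_def)
  define U where "U = {z \<in> hplane. - k < mink (lift z) N}"
  define W where "W = {z \<in> hplane. mink (lift z) N < - k}"
  have AU: "axis_of n \<subseteq> U" using k by (auto simp: axis_of_def U_def N_def)
  have split: "hplane - hcurve N k = U \<union> W" "U \<inter> W = {}" by (auto simp: U_def W_def hcurve_def)
  have cont: "continuous_on hplane (\<lambda>z. mink (lift z) N)"
    by (intro continuous_on_mink continuous_on_lift continuous_on_const)
  have op: "open hplane" by (simp add: hplane_def)
  have opUW: "open U" "open W"
    unfolding U_def W_def Collect_conj_eq Collect_mem_eq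
    using continuous_open_preimage[OF cont op, of "{- k<..}"] continuous_open_preimage[OF cont op, of "{..<- k}"]
    by (auto simp: vimage_def Int_def)
  have conU: "connected U" unfolding U_def by (intro convex_connected convex_hside_interior k)
  have comp: "U \<in> components (hplane - hcurve N k)"
    unfolding in_components_maximal split
  proof (intro conjI allI impI)
    show "U \<noteq> {}" using A AU by blast
    fix D assume D: "D \<noteq> {} \<and> U \<subseteq> D \<and> D \<subseteq> U \<union> W \<and> connected D"
    have "U \<inter> D = {} \<or> W \<inter> D = {}"
      by (rule connectedD[of D]) (use D opUW split in auto)
    then show "D = U" using D \<open>U \<noteq> {}\<close> by blast
  qed (use conU in auto)
  have "{D \<in> components (hplane - hcurve N k). axis_of n \<subseteq> D} = {U}"
    using comp AU A components_nonoverlap[OF comp] by blast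
  then have cs: "convex_side (Hypercycle (axis_of n) r (hcurve N k)) = hside N k"
    by (auto simp: hside_def hcurve_def U_def)
  show ?thesis
    unfolding represents_def
    using k NN cs hypercycle_edge_end[OF n r] by (simp add: N_def[symmetric] k_def[symmetric])
qed

lemma perpendicular_multiple:
  fixes v n :: complex assumes "n \<bullet> v = 0" "n \<noteq> 0"
  shows "v = ((v \<bullet> (\<i> * n)) / (n \<bullet> n)) *\<^sub>R (\<i> * n)"
proof -
  have "(n \<bullet> n) *\<^sub>R v = (v \<bullet> (\<i> * n)) *\<^sub>R (\<i> * n) + (n \<bullet> v) *\<^sub>R n"
    by (simp add: complex_eq_iff inner_complex_def algebra_simps)
  then have "(n \<bullet> n) *\<^sub>R v = (v \<bullet> (\<i> * n)) *\<^sub>R (\<i> * n)" using assms by simp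
  moreover have "v = (1 / (n \<bullet> n)) *\<^sub>R ((n \<bullet> n) *\<^sub>R v)" using assms(2) by simp
  ultimately show ?thesis by simp
qed

text \<open>A point of the line through \<open>\<xi>\<close> and \<open>\<zeta>\<close> is at distance less than \<open>1\<close> from the origin exactly if it
  lies strictly between them, by the quadratic formula for its norm.\<close>

lemma open_segment_axis:
  assumes ideal: "cmod \<xi> = 1" "cmod \<zeta> = 1" "\<xi> \<noteq> \<zeta>" and n: "snd n \<bullet> \<xi> = fst n" "snd n \<bullet> \<zeta> = fst n" "snd n \<noteq> 0"
  shows "open_segment \<xi> \<zeta> = axis_of n"
proof -
  have norm: "(cmod ((1 - s) *\<^sub>R \<xi> + s *\<^sub>R \<zeta>))\<^sup>2 = 1 - s * (1 - s) * (cmod (\<zeta> - \<xi>))\<^sup>2" for s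
  proof -
    have "\<xi> \<bullet> \<xi> = 1" "\<zeta> \<bullet> \<zeta> = 1" using ideal by (simp_all add: dot_square_norm)
    then show ?thesis unfolding power2_norm_eq_inner
      by (simp add: inner_add_left inner_add_right inner_diff_left inner_diff_right
          inner_commute[of \<zeta> \<xi>] algebra_simps)
  qed
  have d: "0 < (cmod (\<zeta> - \<xi>))\<^sup>2" using ideal by simp
  show ?thesis
  proof (intro set_eqI iffI)
    fix z assume "z \<in> open_segment \<xi> \<zeta>"
    then obtain s where s: "0 < s" "s < 1" "z = (1 - s) *\<^sub>R \<xi> + s *\<^sub>R \<zeta>"
      using ideal by (auto simp: in_segment)
    have "0 < s * (1 - s) * (cmod (\<zeta> - \<xi>))\<^sup>2" using s d by simp
    then have "z \<in> hplane" unfolding hplane_iff s(3) norm by linarith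
    moreover have "snd n \<bullet> z = fst n" using n by (simp add: s(3) inner_add_right algebra_simps)
    ultimately show "z \<in> axis_of n" by (simp add: axis_of_iff)
  next
    fix z assume "z \<in> axis_of n"
    then have z: "(cmod z)\<^sup>2 < 1" "snd n \<bullet> z = fst n" by (auto simp: axis_of_iff hplane_iff)
    obtain a where a: "z - \<xi> = a *\<^sub>R (\<i> * snd n)"
      using perpendicular_multiple[of "snd n" "z - \<xi>"] n z by (auto simp: inner_diff_right)
    obtain b where b: "\<zeta> - \<xi> = b *\<^sub>R (\<i> * snd n)"
      using perpendicular_multiple[of "snd n" "\<zeta> - \<xi>"] n by (auto simp: inner_diff_right)
    have "b \<noteq> 0" using b ideal by auto
    define s where "s = a / b"
    have "z - \<xi> = s *\<^sub>R (\<zeta> - \<xi>)" unfolding a b using \<open>b \<noteq> 0\<close> by (simp add: s_def)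
    then have zs: "z = (1 - s) *\<^sub>R \<xi> + s *\<^sub>R \<zeta>" by (simp add: algebra_simps)
    have "0 < s * (1 - s) * (cmod (\<zeta> - \<xi>))\<^sup>2" using z(1) unfolding zs norm by simp
    then have "0 < s * (1 - s)" using d by (simp add: zero_less_mult_iff)
    then have "0 < s" "s < 1" by (auto simp: zero_less_mult_iff)
    then show "z \<in> open_segment \<xi> \<zeta>" using zs ideal by (auto simp: in_segment)
  qed
qed

lemma complete_geodesic_axis:
  assumes "complete_geodesic A"
  obtains n where "mink n n = 1" "A = axis_of n" "A \<noteq> {}"
proof -
  obtain \<xi> \<zeta> where xz: "cmod \<xi> = 1" "cmod \<zeta> = 1" "\<xi> \<noteq> \<zeta>" "A = open_segment \<xi> \<zeta>"
    using assms by (auto simp: complete_geodesic_def ideal_points_def)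
  define w where "w = \<i> * (\<zeta> - \<xi>)"
  define m where "m = (\<xi> \<bullet> w, w)"
  have nz: "1 - \<xi> \<bullet> \<zeta> \<noteq> 0"
  proof
    assume "1 - \<xi> \<bullet> \<zeta> = 0"
    moreover have "(\<xi> - \<zeta>) \<bullet> (\<xi> - \<zeta>) = \<xi> \<bullet> \<xi> + \<zeta> \<bullet> \<zeta> - 2 * (\<xi> \<bullet> \<zeta>)"
      by (simp add: inner_diff_left inner_diff_right inner_commute[of \<zeta> \<xi>])
    ultimately have "(\<xi> - \<zeta>) \<bullet> (\<xi> - \<zeta>) = 0" using xz by (simp only: dot_square_norm) simp
    then show False using xz by simp
  qed
  have mm: "mink m m = (1 - \<xi> \<bullet> \<zeta>)\<^sup>2"
  proof -
    have u: "(Re \<xi>)\<^sup>2 + (Im \<xi>)\<^sup>2 = 1" "(Re \<zeta>)\<^sup>2 + (Im \<zeta>)\<^sup>2 = 1" using xz by (simp_all add: cmod_def)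
    have "mink m m = (Re \<xi>)\<^sup>2 + (Im \<xi>)\<^sup>2 + ((Re \<zeta>)\<^sup>2 + (Im \<zeta>)\<^sup>2) - 2 * (\<xi> \<bullet> \<zeta>)
        - ((((Re \<xi>)\<^sup>2 + (Im \<xi>)\<^sup>2) * ((Re \<zeta>)\<^sup>2 + (Im \<zeta>)\<^sup>2)) - (\<xi> \<bullet> \<zeta>)\<^sup>2)"
      by (simp add: m_def w_def mink_def inner_complex_def power2_eq_square algebra_simps)
    also have "\<dots> = (1 - \<xi> \<bullet> \<zeta>)\<^sup>2" unfolding u by (simp add: power2_eq_square algebra_simps)
    finally show ?thesis .
  qed
  define n where "n = (1 / (1 - \<xi> \<bullet> \<zeta>)) *\<^sub>R m"
  have "mink n n = 1" using nz mm by (simp add: n_def power2_eq_square)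
  moreover have "A = axis_of n"
    unfolding xz(4)
  proof (rule open_segment_axis[OF xz(1-3)])
    show "snd n \<noteq> 0" using nz xz by (simp add: n_def m_def w_def)
    show "snd n \<bullet> \<xi> = fst n" by (simp add: n_def m_def inner_commute)
    have "w \<bullet> \<zeta> = \<xi> \<bullet> w" by (simp add: w_def inner_complex_def algebra_simps)
    then show "snd n \<bullet> \<zeta> = fst n" by (simp add: n_def m_def)
  qed
  moreover have "A \<noteq> {}" using xz by simp
  ultimately show thesis using that by blast
qed

lemma axis_complete_geodesic:
  assumes n: "mink n n = 1" shows "complete_geodesic (axis_of n)"
proof -
  define v where "v = snd n"
  define c where "c = 1 / (v \<bullet> v)"
  have vv: "v \<bullet> v = 1 + (fst n)\<^sup>2" using n by (simp add: mink_def v_def power2_eq_square)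
  then have v0: "v \<bullet> v \<noteq> 0" by (smt (verit) zero_le_power2)
  have vn: "v \<noteq> 0" using v0 by auto
  define \<xi> where "\<xi> = c *\<^sub>R (fst n *\<^sub>R v + \<i> * v)"
  define \<zeta> where "\<zeta> = c *\<^sub>R (fst n *\<^sub>R v - \<i> * v)"
  have i: "v \<bullet> (\<i> * v) = 0" "(\<i> * v) \<bullet> v = 0" "(\<i> * v) \<bullet> (\<i> * v) = v \<bullet> v"
    by (simp_all add: inner_complex_def)
  have "\<xi> \<bullet> \<xi> = c * c * ((fst n)\<^sup>2 * (v \<bullet> v) + v \<bullet> v)" "\<zeta> \<bullet> \<zeta> = c * c * ((fst n)\<^sup>2 * (v \<bullet> v) + v \<bullet> v)"
    by (simp_all add: \<xi>_def \<zeta>_def inner_add_left inner_add_right inner_diff_left inner_diff_right i power2_eq_square algebra_simps)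
  moreover have "c * c * ((fst n)\<^sup>2 * (v \<bullet> v) + v \<bullet> v) = 1"
  proof -
    have "(fst n)\<^sup>2 * (v \<bullet> v) + v \<bullet> v = (v \<bullet> v) * (v \<bullet> v)" by (simp add: vv algebra_simps)
    then show ?thesis using v0 by (simp add: c_def)
  qed
  ultimately have "cmod \<xi> = 1" "cmod \<zeta> = 1" by (simp_all add: norm_eq_sqrt_inner)
  then have ideal: "\<xi> \<in> ideal_points" "\<zeta> \<in> ideal_points" "cmod \<xi> = 1" "cmod \<zeta> = 1"
    by (simp_all add: ideal_points_def)
  have ne: "\<xi> \<noteq> \<zeta>"
  proof
    assume "\<xi> = \<zeta>"
    then have "c *\<^sub>R (\<i> * v) = 0" by (simp add: \<xi>_def \<zeta>_def algebra_simps)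
    then show False using vn v0 by (simp add: c_def)
  qed
  have "v \<bullet> \<xi> = fst n" "v \<bullet> \<zeta> = fst n"
    using v0 by (simp_all add: \<xi>_def \<zeta>_def inner_add_right inner_diff_right i c_def)
  then have "axis_of n = open_segment \<xi> \<zeta>"
    using open_segment_axis[OF ideal(3,4) ne, of n] vn by (simp add: v_def)
  then show ?thesis unfolding complete_geodesic_def using ideal ne by blast
qed

lemma valid_represented:
  assumes "gcircle_valid C" shows "\<exists>N. represents C N (geod_curvature C)"
proof (cases C)
  case (Circle c r)
  then have "represents C ((1 / sinh r) *\<^sub>R lift c) (geod_curvature C)"
    using assms circle_represents by simp
  then show ?thesis by blast
next
  case (Horocycle \<xi> q)
  then have "represents C ((1 / ideal_height \<xi> q) *\<^sub>R (1, \<xi>)) (geod_curvature C)"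
    using assms horocycle_represents[of \<xi> q] by (simp add: ideal_points_def)
  then show ?thesis by blast
next
  case (Hypercycle A r D)
  then have h: "complete_geodesic A" "0 < r" "D \<in> components {z \<in> hplane. hdist_set z A = r}" using assms by auto
  obtain n where n: "mink n n = 1" "A = axis_of n" "A \<noteq> {}" using complete_geodesic_axis[OF h(1)] .
  then have "D = hcurve ((1 / cosh r) *\<^sub>R n) (tanh r) \<or> D = hcurve ((1 / cosh r) *\<^sub>R - n) (tanh r)"
    using h(3) hypercycle_components[OF n(1) _ h(2)] by auto
  then show ?thesis
  proof
    assume "D = hcurve ((1 / cosh r) *\<^sub>R n) (tanh r)"
    then have "represents C ((1 / cosh r) *\<^sub>R n) (geod_curvature C)"
      using hypercycle_represents[OF n(1) _ h(2)] n by (simp add: Hypercycle)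
    then show ?thesis by blast
  next
    assume "D = hcurve ((1 / cosh r) *\<^sub>R - n) (tanh r)"
    then have "represents C ((1 / cosh r) *\<^sub>R - n) (geod_curvature C)"
      using hypercycle_represents[of "- n" r] n h(2) by (simp add: Hypercycle)
    then show ?thesis by blast
  qed
qed

lemma represented_exists:
  assumes k: "0 < k" and N: "mink N N = 1 - k\<^sup>2" "1 \<le> k \<Longrightarrow> 0 < fst N"
    and X: "X \<in> hyperboloid" "mink X N = - k"
  shows "\<exists>C. gcircle_valid C \<and> geod_curvature C = k \<and> represents C N k"
proof -
  consider "1 < k" | "k = 1" | "k < 1" by linarith
  then show ?thesis
  proof cases
    case 1
    then have k2: "0 < k\<^sup>2 - 1" by (simp add: one_less_power)
    define r where "r = arsinh (1 / sqrt (k\<^sup>2 - 1))"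
    have sr: "sinh r = 1 / sqrt (k\<^sup>2 - 1)" by (simp add: r_def)
    have cr: "cosh r = k / sqrt (k\<^sup>2 - 1)"
    proof -
      have "cosh r = sqrt ((1 / sqrt (k\<^sup>2 - 1))\<^sup>2 + 1)" by (simp add: r_def cosh_arsinh_real)
      also have "(1 / sqrt (k\<^sup>2 - 1))\<^sup>2 + 1 = k\<^sup>2 / (k\<^sup>2 - 1)" using k2 by (simp add: power_divide field_simps)
      finally show ?thesis using k by (simp add: real_sqrt_divide)
    qed
    have r: "0 < r" using sr k2 sinh_real_pos_iff[of r] by simp
    have f: "0 < fst N" "mink N N < 0" using N 1 k2 by auto
    define c where "c = klein N"
    have c: "c \<in> hplane" unfolding c_def by (rule klein_hplane[OF f(2,1)])
    have "lift c = (1 / sqrt (- mink N N)) *\<^sub>R N"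
      using lift_klein[OF hyperboloid_normalize[OF f(2,1)]] f by (simp add: klein_scale c_def)
    then have "(1 / sinh r) *\<^sub>R lift c = N" using N k2 by (simp add: sr)
    then have "represents (Circle c r) N (cosh r / sinh r)" using circle_represents[OF c r] by simp
    moreover have "cosh r / sinh r = k" using sr cr k2 by simp
    ultimately show ?thesis using c r by (intro exI[of _ "Circle c r"]) simp
  next
    case 2
    then have f: "0 < fst N" "mink N N = 0" using N by auto
    define \<xi> where "\<xi> = klein N"
    have N1: "N = fst N *\<^sub>R (1, \<xi>)" using scaled_klein[of N] f by (simp add: \<xi>_def)
    have "mink N N = fst N * (fst N * mink (1, \<xi>) (1, \<xi>))"
      using arg_cong2[OF N1 N1, of mink] by (simp only: mink_linear)
    then have "mink (1, \<xi>) (1, \<xi>) = 0" using f by simp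
    then have "(cmod \<xi>)\<^sup>2 = 1" by (simp add: mink_homogeneous dot_square_norm)
    then have xi: "cmod \<xi> = 1" using norm_ge_zero[of \<xi>] by (auto simp: power2_eq_1_iff)
    define q where "q = klein X"
    have q: "q \<in> hplane" "lift q = X" using X by (simp_all add: q_def)
    have "fst N * mink X (1, \<xi>) = - 1" using arg_cong[OF N1, of "mink X"] X(2) 2 by (simp only: mink_linear)
    then have "ideal_height \<xi> q = 1 / fst N" using f by (simp add: ideal_height_def q field_simps)
    then have ih: "1 / ideal_height \<xi> q = fst N" using f by simp
    have "represents (Horocycle \<xi> q) N 1"
      using horocycle_represents[OF xi q(1)] unfolding ih N1[symmetric] .
    then show ?thesis using 2 q xi by (intro exI[of _ "Horocycle \<xi> q"]) (simp add: ideal_points_def)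
  next
    case 3
    then have k2: "0 < 1 - k\<^sup>2" using k by (simp add: power_less_one_iff)
    obtain r where kr: "tanh r = k"
    proof -
      have "((\<lambda>x. tanh x) \<longlongrightarrow> (1::real)) at_top" by (rule tanh_real_at_top)
      then have "\<forall>\<^sub>F x in at_top. k < tanh x" using 3 by (rule order_tendstoD)
      then obtain b where "k < tanh b" "0 \<le> b"
        by (metis eventually_at_top_linorder linorder_le_cases)
      moreover have "continuous_on {0..b} (tanh :: real \<Rightarrow> real)" by (intro continuous_intros) auto
      ultimately show thesis using IVT'[of tanh 0 k b] k that by auto
    qed
    have r: "0 < r" using kr k by (metis tanh_real_pos_iff)
    have cr: "(cosh r)\<^sup>2 = 1 / (1 - k\<^sup>2)"
    proof -
      have "1 - k\<^sup>2 = 1 / (cosh r)\<^sup>2" using sech_square[of r] kr by (simp add: power2_eq_square)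
      then show ?thesis by simp
    qed
    define n where "n = cosh r *\<^sub>R N"
    have n: "mink n n = 1"
    proof -
      have "mink n n = (cosh r)\<^sup>2 * mink N N" by (simp add: n_def power2_eq_square)
      then show ?thesis unfolding cr N using k2 by simp
    qed
    have N1: "N = (1 / cosh r) *\<^sub>R n" by (simp add: n_def)
    have geo: "complete_geodesic (axis_of n)" by (rule axis_complete_geodesic[OF n])
    have ne: "axis_of n \<noteq> {}" using geo by (auto simp: complete_geodesic_def)
    have "hcurve N k \<in> components {z \<in> hplane. hdist_set z (axis_of n) = r}"
      unfolding hypercycle_components[OF n ne r] N1 kr by simp
    then show ?thesis
      using geo r kr hypercycle_represents[OF n ne r] N1
      by (intro exI[of _ "Hypercycle (axis_of n) r (hcurve N k)"]) auto
  qed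
qed

section \<open>External tangency\<close>

lemma normal_vector:
  assumes X: "X \<in> hyperboloid" and N: "mink N N = 1 - k\<^sup>2" "mink X N = - k"
  shows "mink X (N - k *\<^sub>R X) = 0" "mink (N - k *\<^sub>R X) (N - k *\<^sub>R X) = 1"
  using hyperboloidD(1)[OF X] N by (simp_all add: mink_commute[of N X] algebra_simps power2_eq_square)

lemma normal_frame:
  assumes X: "X \<in> hyperboloid" and N: "mink N N = 1 - k\<^sup>2" "mink X N = - k"
  shows "frame X (N - k *\<^sub>R X) (lcross X (N - k *\<^sub>R X))"
  using frame_exists[OF X] normal_vector[OF X N] by blast

text \<open>A defining function of the curve on the disk, positive inside. Its gradient at a point of the
  curve is the spatial part of the unit normal \<open>N - k X\<close>.\<close>

definition curve_defect :: "real \<times> complex \<Rightarrow> real \<Rightarrow> complex \<Rightarrow> real" where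
  "curve_defect N k z = snd N \<bullet> z - fst N + k * sqrt (1 - (cmod z)\<^sup>2)"

lemma curve_defect_eq:
  assumes "z \<in> hplane"
  shows "curve_defect N k z = sqrt (1 - (cmod z)\<^sup>2) * (mink (lift z) N + k)"
  using root_pos[OF assms] by (simp add: curve_defect_def mink_lift distrib_left mult.commute)

lemma curve_defect_iff:
  assumes "z \<in> hplane"
  shows "curve_defect N k z = 0 \<longleftrightarrow> z \<in> hcurve N k"
    "0 < curve_defect N k z \<longleftrightarrow> - k < mink (lift z) N"
  unfolding curve_defect_eq[OF assms] using root_pos[OF assms] assms
  by (auto simp: hcurve_def zero_less_mult_iff)

lemma curve_defect_derivative:
  assumes "t \<in> hplane"
  shows "(curve_defect N k has_derivative (\<lambda>w. snd (N - k *\<^sub>R lift t) \<bullet> w)) (at t)"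
proof -
  have s: "0 < sqrt (1 - t \<bullet> t)" using root_pos[OF assms] by (simp add: power2_norm_eq_inner)
  have "((\<lambda>z. snd N \<bullet> z - fst N + k * sqrt (1 - z \<bullet> z)) has_derivative
      (\<lambda>w. snd N \<bullet> w - 0 + k * ((0 - (t \<bullet> w + w \<bullet> t)) * (inverse (sqrt (1 - t \<bullet> t)) / 2)))) (at t)"
    using s by (auto intro!: derivative_eq_intros simp: mult.commute)
  moreover have "(\<lambda>w. snd N \<bullet> w - 0 + k * ((0 - (t \<bullet> w + w \<bullet> t)) * (inverse (sqrt (1 - t \<bullet> t)) / 2)))
      = (\<lambda>w. snd (N - k *\<^sub>R lift t) \<bullet> w)"
  proof (rule ext)
    fix w
    show "snd N \<bullet> w - 0 + k * ((0 - (t \<bullet> w + w \<bullet> t)) * (inverse (sqrt (1 - t \<bullet> t)) / 2))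
        = snd (N - k *\<^sub>R lift t) \<bullet> w"
      by (simp add: lift_def inner_diff_left inner_commute[of w t] power2_norm_eq_inner inverse_eq_divide)
  qed
  ultimately show ?thesis unfolding curve_defect_def[abs_def] power2_norm_eq_inner by simp
qed

lemma curve_secants_orthogonal:
  assumes "t \<in> hcurve N k"
  shows "((\<lambda>z. (snd (N - k *\<^sub>R lift t) \<bullet> (z - t)) / cmod (z - t)) \<longlongrightarrow> 0) (at t within hcurve N k)"
proof -
  have t: "t \<in> hplane" using assms by (simp add: hcurve_def)
  have "(curve_defect N k has_derivative (\<lambda>w. snd (N - k *\<^sub>R lift t) \<bullet> w)) (at t within hcurve N k)"
    using curve_defect_derivative[OF t] has_derivative_at_withinI by blast
  then have lim: "((\<lambda>z. (1 / norm (z - t)) *\<^sub>R (curve_defect N k z - (curve_defect N k t + snd (N - k *\<^sub>R lift t) \<bullet> (z - t)))) \<longlongrightarrow> 0)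
      (at t within hcurve N k)"
    unfolding has_derivative_within by blast
  have ev: "\<forall>\<^sub>F z in at t within hcurve N k.
      - ((1 / norm (z - t)) *\<^sub>R (curve_defect N k z - (curve_defect N k t + snd (N - k *\<^sub>R lift t) \<bullet> (z - t))))
      = (snd (N - k *\<^sub>R lift t) \<bullet> (z - t)) / cmod (z - t)"
  proof (rule eventually_at_topological[THEN iffD2], intro exI[of _ UNIV] conjI ballI impI)
    fix z assume "z \<in> hcurve N k"
    then have "curve_defect N k z = 0" "curve_defect N k t = 0"
      using assms curve_defect_iff(1) by (auto simp: hcurve_def)
    then show "- ((1 / norm (z - t)) *\<^sub>R (curve_defect N k z - (curve_defect N k t + snd (N - k *\<^sub>R lift t) \<bullet> (z - t))))
      = (snd (N - k *\<^sub>R lift t) \<bullet> (z - t)) / cmod (z - t)" by simp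
  qed auto
  show ?thesis using Lim_transform_eventually[OF tendsto_minus[OF lim] ev] by simp
qed

lemma curve_not_isolated:
  assumes k: "0 < k" and N: "mink N N = 1 - k\<^sup>2" and t: "t \<in> hcurve N k"
  shows "\<not> trivial_limit (at t within hcurve N k)"
proof -
  define X \<nu> \<tau> where "X = lift t" and "\<nu> = N - k *\<^sub>R X" and "\<tau> = lcross X \<nu>"
  have t': "t \<in> hplane" "mink X N = - k" using t by (auto simp: hcurve_def X_def)
  have X: "X \<in> hyperboloid" using t' by (simp add: X_def lift_hyperboloid)
  have fr: "frame X \<nu> \<tau>" unfolding \<nu>_def \<tau>_def by (rule normal_frame[OF X N t'(2)])
  have NX: "N = k *\<^sub>R X + \<nu>" by (simp add: \<nu>_def)
  have pos: "0 < arc_denom k u" if "u \<in> {-1<..<1}" for u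
  proof -
    have "\<bar>u\<bar> < 1" using that by auto
    then have "u\<^sup>2 < 1" by (simp add: abs_square_less_1)
    moreover have "0 \<le> k\<^sup>2 * u\<^sup>2" by simp
    ultimately show ?thesis unfolding arc_denom_def left_diff_distrib by linarith
  qed
  define c where "c = (\<lambda>u. klein (arc_point k X \<nu> \<tau> u))"
  have c0: "c 0 = t" using t' by (simp add: c_def arc_point_def X_def)
  have cont: "continuous_on {-1<..<1} c"
    unfolding c_def by (rule continuous_on_klein_arc_point[OF fr NX]) (use pos in auto)
  have "t islimpt hcurve N k"
    unfolding islimpt_approachable
  proof (intro allI impI)
    fix e :: real assume "0 < e"
    have "(0::real) \<in> {-1<..<1}" by simp
    then obtain d where d: "0 < d" "\<And>u. u \<in> {-1<..<1} \<Longrightarrow> dist u 0 < d \<Longrightarrow> dist (c u) (c 0) < e"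
      using cont \<open>0 < e\<close> unfolding continuous_on_iff by metis
    define u where "u = min (1/2) (d/2)"
    have u: "u \<in> {-1<..<1}" "dist u 0 < d" "u \<noteq> 0" using d(1) by (auto simp: u_def min_def)
    have "c u \<in> hcurve N k"
      using arc_point_hyperboloid[OF fr NX pos[OF u(1)]] mink_arc_point_frame(3)[OF fr NX]
      by (simp add: c_def hcurve_def)
    moreover have "c u \<noteq> t"
    proof
      assume "c u = t"
      then have "lift (c u) = X" by (simp add: X_def)
      then have "arc_point k X \<nu> \<tau> u = X"
        using arc_point_hyperboloid[OF fr NX pos[OF u(1)]] by (simp add: c_def)
      then have "u = arc_param k X \<tau> X"
        using arc_param_arc_point[OF fr NX pos[OF u(1)]] by simp
      then show False using u(3) frameD[OF fr] by (simp add: arc_param_def)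
    qed
    moreover have "dist (c u) t < e" using d(2)[OF u(1,2)] c0 by simp
    ultimately show "\<exists>z\<in>hcurve N k. z \<noteq> t \<and> dist z t < e" by blast
  qed
  then show ?thesis by (simp add: trivial_limit_within)
qed

text \<open>Cramer's rule in the plane: a vector that is almost orthogonal to two independent vectors is
  small.\<close>

lemma planar_expansion:
  fixes a b e :: complex
  shows "(Re a * Im b - Im a * Re b) *\<^sub>R e = \<i> * ((b \<bullet> e) *\<^sub>R a - (a \<bullet> e) *\<^sub>R b)"
  by (simp add: complex_eq_iff inner_complex_def algebra_simps)

text \<open>The unit secants at \<open>t\<close> become orthogonal to the gradient \<open>a\<close> of the defining function and, by
  assumption, to \<open>\<i> u\<close>. As they have length \<open>1\<close>, \<open>planar_expansion\<close> makes \<open>a\<close> and \<open>\<i> u\<close> dependent.\<close>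

lemma tangent_direction_orthogonal:
  assumes k: "0 < k" and N: "mink N N = 1 - k\<^sup>2" and tan: "tangent_direction (hcurve N k) t u"
  shows "snd (N - k *\<^sub>R lift t) \<bullet> u = 0"
proof -
  define a b where "a = snd (N - k *\<^sub>R lift t)" and "b = \<i> * u"
  let ?F = "at t within hcurve N k"
  have t: "t \<in> hcurve N k" and lim: "((\<lambda>z. Im (cnj u * (z - t)) / cmod (z - t)) \<longlongrightarrow> 0) ?F"
    using tan by (auto simp: tangent_direction_def)
  have b: "Im (cnj u * w) = b \<bullet> w" for w by (simp add: b_def inner_complex_def algebra_simps)
  have la: "((\<lambda>z. (a \<bullet> (z - t)) / cmod (z - t)) \<longlongrightarrow> 0) ?F"
    unfolding a_def by (rule curve_secants_orthogonal[OF t])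
  have lb: "((\<lambda>z. (b \<bullet> (z - t)) / cmod (z - t)) \<longlongrightarrow> 0) ?F" using lim unfolding b .
  define D where "D = Re a * Im b - Im a * Re b"
  have "((\<lambda>z. cmod (\<i> * (((b \<bullet> (z - t)) / cmod (z - t)) *\<^sub>R a - ((a \<bullet> (z - t)) / cmod (z - t)) *\<^sub>R b)))
      \<longlongrightarrow> cmod (\<i> * (0 *\<^sub>R a - 0 *\<^sub>R b))) ?F"
    by (intro tendsto_intros la lb)
  moreover have "\<forall>\<^sub>F z in ?F. cmod (\<i> * (((b \<bullet> (z - t)) / cmod (z - t)) *\<^sub>R a - ((a \<bullet> (z - t)) / cmod (z - t)) *\<^sub>R b)) = \<bar>D\<bar>"
  proof (rule eventually_at_topological[THEN iffD2], intro exI[of _ UNIV] conjI ballI impI)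
    fix z assume z: "z \<noteq> t"
    have "\<i> * (((b \<bullet> (z - t)) / cmod (z - t)) *\<^sub>R a - ((a \<bullet> (z - t)) / cmod (z - t)) *\<^sub>R b)
        = (1 / cmod (z - t)) *\<^sub>R (\<i> * ((b \<bullet> (z - t)) *\<^sub>R a - (a \<bullet> (z - t)) *\<^sub>R b))"
      by (simp add: complex_eq_iff diff_divide_distrib)
    also have "\<dots> = (1 / cmod (z - t)) *\<^sub>R (D *\<^sub>R (z - t))" unfolding D_def planar_expansion ..
    finally show "cmod (\<i> * (((b \<bullet> (z - t)) / cmod (z - t)) *\<^sub>R a - ((a \<bullet> (z - t)) / cmod (z - t)) *\<^sub>R b)) = \<bar>D\<bar>"
      using z by (simp del: scaleR_scaleR)
  qed auto
  ultimately have "((\<lambda>z. \<bar>D\<bar>) \<longlongrightarrow> 0) ?F" by (simp add: Lim_transform_eventually)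
  then have "\<bar>D\<bar> = 0"
    using curve_not_isolated[OF k N t] by (simp add: tendsto_const_iff)
  then have "D = 0" by simp
  then show ?thesis by (simp add: D_def a_def b_def inner_complex_def algebra_simps)
qed

lemma tangent_directionI:
  assumes t: "t \<in> hcurve N k" and u: "u \<noteq> 0" "snd (N - k *\<^sub>R lift t) \<bullet> u = 0" and nz: "snd (N - k *\<^sub>R lift t) \<noteq> 0"
  shows "tangent_direction (hcurve N k) t u"
proof -
  define a where "a = snd (N - k *\<^sub>R lift t)"
  obtain c where c: "u = c *\<^sub>R (\<i> * a)"
    using perpendicular_multiple[of a u] u nz by (auto simp: a_def)
  have eq: "Im (cnj u * (z - t)) / cmod (z - t) = - c * ((a \<bullet> (z - t)) / cmod (z - t))" for z
    unfolding c by (simp add: inner_complex_def algebra_simps)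
  have "((\<lambda>z. - c * ((a \<bullet> (z - t)) / cmod (z - t))) \<longlongrightarrow> - c * 0) (at t within hcurve N k)"
    unfolding a_def by (intro tendsto_intros curve_secants_orthogonal[OF t])
  then have "((\<lambda>z. Im (cnj u * (z - t)) / cmod (z - t)) \<longlongrightarrow> 0) (at t within hcurve N k)"
    unfolding eq by (simp only: mult_zero_right)
  then show ?thesis using t u unfolding tangent_direction_def by blast
qed

lemma tangent_vector_fst:
  assumes t: "t \<in> hplane" and "mink (lift t) V = 0" shows "fst V = snd V \<bullet> t"
  using assms root_pos[OF t] by (simp add: mink_lift)

lemma interior_hside: "{z \<in> hplane. - k < mink (lift z) N} \<subseteq> interior (hside N k)"
proof (rule interior_maximal)
  have cont: "continuous_on hplane (\<lambda>z. mink (lift z) N)"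
    by (intro continuous_on_mink continuous_on_lift continuous_on_const)
  have "open (hplane \<inter> (\<lambda>z. mink (lift z) N) -` {- k<..})"
    by (rule continuous_open_preimage[OF cont]) (auto simp: hplane_def)
  then show "open {z \<in> hplane. - k < mink (lift z) N}" by (simp add: vimage_def Int_def)
qed (auto simp: hside_def)

lemma enters_interior:
  assumes t: "t \<in> hcurve N k" and a: "a = snd (N - k *\<^sub>R lift t)" "a \<noteq> 0"
  shows "\<forall>\<^sub>F e in at_right 0. t + e *\<^sub>R a \<in> interior (hside N k)"
proof -
  have tp: "t \<in> hplane" using t by (simp add: hcurve_def)
  have outer: "(curve_defect N k has_derivative (\<lambda>w. a \<bullet> w)) (at (t + 0 *\<^sub>R a))"
    using curve_defect_derivative[OF tp] a by simp
  have inner: "((\<lambda>e. t + e *\<^sub>R a) has_derivative (\<lambda>h. h *\<^sub>R a)) (at (0::real))"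
    by (auto intro!: derivative_eq_intros)
  have "((\<lambda>e. curve_defect N k (t + e *\<^sub>R a)) has_derivative (\<lambda>h. a \<bullet> (h *\<^sub>R a))) (at 0)"
    using diff_chain_at[OF inner outer] unfolding o_def .
  then have "((\<lambda>e. curve_defect N k (t + e *\<^sub>R a)) has_real_derivative a \<bullet> a) (at 0)"
    by (simp add: has_field_derivative_def mult.commute[of _ "a \<bullet> a"])
  from DERIV_pos_inc_right[OF this] obtain d where d: "0 < d"
    "\<And>h. 0 < h \<Longrightarrow> h < d \<Longrightarrow> curve_defect N k t < curve_defect N k (t + h *\<^sub>R a)"
    using a by auto
  have "((\<lambda>e. t + e *\<^sub>R a) \<longlongrightarrow> t + 0 *\<^sub>R a) (at_right 0)" by (intro tendsto_intros)
  then have "\<forall>\<^sub>F e in at_right 0. t + e *\<^sub>R a \<in> hplane"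
    using tp by (intro topological_tendstoD) (auto simp: hplane_def)
  moreover have "\<forall>\<^sub>F e in at_right 0. e \<in> {0<..<d}" using d(1) by (rule eventually_at_right_real)
  ultimately show ?thesis
  proof eventually_elim
    case (elim e)
    then have "0 < curve_defect N k (t + e *\<^sub>R a)"
      using d(2)[of e] curve_defect_iff(1)[OF tp, of N k] t by auto
    then show ?case using curve_defect_iff(2) elim interior_hside by blast
  qed
qed

text \<open>The common tangent makes the unit normals \<open>\<nu>\<close> and \<open>\<nu>'\<close> of the two curves equal up to sign. If they
  were equal, moving from \<open>t\<close> in their direction would lead into the interior of both convex sides.
  Hence \<open>N - k X\<close> and \<open>N' - k' X\<close> are opposite.\<close>

lemma externally_tangent_normals:
  assumes C: "represents C N k" and C': "represents C' N' k'" and ext: "externally_tangent C C' t"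
  shows "t \<in> hplane" "N + N' = (k + k') *\<^sub>R lift t"
proof -
  have k: "0 < k" "0 < k'" and NN: "mink N N = 1 - k\<^sup>2" "mink N' N' = 1 - k'\<^sup>2"
    using C C' by (auto simp: represents_def)
  obtain u where u: "tangent_direction (hcurve N k) t u" "tangent_direction (hcurve N' k') t u"
    and disj: "interior (hside N k) \<inter> interior (hside N' k') = {}"
    using ext C C' by (auto simp: externally_tangent_def represents_def)
  have t: "t \<in> hcurve N k" "t \<in> hcurve N' k'" "u \<noteq> 0" using u by (auto simp: tangent_direction_def)
  show tp: "t \<in> hplane" using t by (simp add: hcurve_def)
  have m: "mink (lift t) N = - k" "mink (lift t) N' = - k'" using t by (auto simp: hcurve_def)
  define \<nu> \<nu>' where "\<nu> = N - k *\<^sub>R lift t" and "\<nu>' = N' - k' *\<^sub>R lift t"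
  note lt = lift_hyperboloid[OF tp]
  have nu: "mink (lift t) \<nu> = 0" "mink \<nu> \<nu> = 1" "mink (lift t) \<nu>' = 0" "mink \<nu>' \<nu>' = 1"
    unfolding \<nu>_def \<nu>'_def using normal_vector[OF lt NN(1) m(1)] normal_vector[OF lt NN(2) m(2)] by auto
  have fs: "fst \<nu> = snd \<nu> \<bullet> t" "fst \<nu>' = snd \<nu>' \<bullet> t"
    using tangent_vector_fst[OF tp] nu by auto
  have "snd \<nu> \<bullet> u = 0" "snd \<nu>' \<bullet> u = 0"
    unfolding \<nu>_def \<nu>'_def using tangent_direction_orthogonal[OF k(1) NN(1) u(1)]
      tangent_direction_orthogonal[OF k(2) NN(2) u(2)] by auto
  then obtain c c' where c: "snd \<nu> = c *\<^sub>R (\<i> * u)" "snd \<nu>' = c' *\<^sub>R (\<i> * u)"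
    using perpendicular_multiple[of u "snd \<nu>"] perpendicular_multiple[of u "snd \<nu>'"] t(3)
    by (auto simp: inner_commute)
  define W where "W = ((\<i> * u) \<bullet> t, \<i> * u)"
  have W: "\<nu> = c *\<^sub>R W" "\<nu>' = c' *\<^sub>R W"
    using fs c by (auto simp: W_def prod_eq_iff)
  have cc: "c * c * mink W W = 1" "c' * c' * mink W W = 1" using nu(2,4) unfolding W by simp_all
  then have "c * c = c' * c'" by (metis mult_right_cancel mult_zero_right zero_neq_one)
  then have "c' = c \<or> c' = - c" by (metis square_eq_iff)
  moreover have "c' \<noteq> c"
  proof
    assume "c' = c"
    then have eq: "\<nu>' = \<nu>" by (simp add: W)
    have "c \<noteq> 0" using cc by auto
    then have a: "snd \<nu> \<noteq> 0" using c t(3) by simp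
    have "\<forall>\<^sub>F e in at_right 0. t + e *\<^sub>R snd \<nu> \<in> interior (hside N k)"
      by (rule enters_interior[OF t(1)]) (use a in \<open>auto simp: \<nu>_def\<close>)
    moreover have "\<forall>\<^sub>F e in at_right 0. t + e *\<^sub>R snd \<nu> \<in> interior (hside N' k')"
      by (rule enters_interior[OF t(2)]) (use a eq in \<open>auto simp: \<nu>'_def\<close>)
    ultimately have "\<forall>\<^sub>F e in at_right (0::real). False"
      by eventually_elim (use disj in blast)
    then show False by (simp add: trivial_limit_at_right_real)
  qed
  ultimately have "\<nu>' = - \<nu>" by (simp add: W)
  then show "N + N' = (k + k') *\<^sub>R lift t"
    unfolding \<nu>_def \<nu>'_def by (simp add: algebra_simps)
qed

text \<open>On both convex sides the sum of the two defining inequalities gives \<open>mink (lift z) X \<ge> -1\<close>, which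
  holds for \<open>z = klein X\<close> only. So the two sides meet in a single point.\<close>

lemma externally_tangentI:
  assumes C: "represents C N k" and C': "represents C' N' k'"
    and X: "X \<in> hyperboloid" "N + N' = (k + k') *\<^sub>R X" "mink X N = - k" "mink X N' = - k'"
  shows "externally_tangent C C' (klein X)"
proof -
  have k: "0 < k" "0 < k'" and NN: "mink N N = 1 - k\<^sup>2" "mink N' N' = 1 - k'\<^sup>2"
    using C C' by (auto simp: represents_def)
  define t where "t = klein X"
  have t: "t \<in> hplane" "lift t = X" using X(1) by (auto simp: t_def)
  have on: "t \<in> hcurve N k" "t \<in> hcurve N' k'" using t X by (auto simp: hcurve_def)
  define \<nu> where "\<nu> = N - k *\<^sub>R X"
  have \<nu>': "N' - k' *\<^sub>R X = - \<nu>" using X(2) by (simp add: \<nu>_def algebra_simps)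
  have nu: "mink X \<nu> = 0" "mink \<nu> \<nu> = 1" unfolding \<nu>_def using normal_vector[OF X(1) NN(1) X(3)] by auto
  have a: "snd \<nu> \<noteq> 0"
  proof
    assume "snd \<nu> = 0"
    moreover from this have "fst \<nu> = 0" using tangent_vector_fst[OF t(1)] nu(1) t(2) by simp
    ultimately show False using nu(2) by (simp add: mink_def)
  qed
  have perp: "snd \<nu> \<bullet> (\<i> * snd \<nu>) = 0" by (simp add: inner_complex_def)
  have "tangent_direction (hcurve N k) t (\<i> * snd \<nu>)"
    by (rule tangent_directionI[OF on(1)]) (use a perp in \<open>auto simp: t(2) \<nu>_def[symmetric]\<close>)
  moreover have "tangent_direction (hcurve N' k') t (\<i> * snd \<nu>)"
    by (rule tangent_directionI[OF on(2)]) (use a perp in \<open>auto simp: t(2) \<nu>'\<close>)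
  moreover have "interior (hside N k) \<inter> interior (hside N' k') = {}"
  proof -
    have "hside N k \<inter> hside N' k' \<subseteq> {t}"
    proof
      fix z assume z: "z \<in> hside N k \<inter> hside N' k'"
      then have zp: "z \<in> hplane" by (simp add: hside_def)
      have "- (k + k') \<le> mink (lift z) (N + N')" using z by (simp add: hside_def)
      then have "(k + k') * (-1) \<le> (k + k') * mink (lift z) X" unfolding X(2) by simp
      then have "-1 \<le> mink (lift z) X" using k by (subst (asm) mult_le_cancel_left_pos) auto
      then have "mink (lift z) X = -1"
        using mink_hyperboloid_le[OF lift_hyperboloid[OF zp] X(1)] by linarith
      then have "lift z = X" by (rule mink_hyperboloid_eq[OF lift_hyperboloid[OF zp] X(1)])
      then show "z \<in> {t}" using klein_lift[OF zp] by (simp add: t_def)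
    qed
    then have "interior (hside N k \<inter> hside N' k') \<subseteq> interior {t}" by (rule interior_mono)
    then show ?thesis by (simp add: interior_Int)
  qed
  ultimately show ?thesis
    using C C' unfolding externally_tangent_def represents_def t_def[symmetric] by auto
qed

section \<open>Circle packed triangles\<close>

text \<open>The point of tangency of two curves; see \<open>externally_tangent_normals\<close>.\<close>

definition touch :: "real \<times> complex \<Rightarrow> real \<Rightarrow> real \<times> complex \<Rightarrow> real \<Rightarrow> real \<times> complex" where
  "touch N k N' k' = (1 / (k + k')) *\<^sub>R (N + N')"

lemma touch_commute: "touch N k N' k' = touch N' k' N k"
  by (simp add: touch_def add.commute)

text \<open>External tangency in terms of inner products, which depend on the curvatures alone.\<close>

definition tangent_pair :: "real \<times> complex \<Rightarrow> real \<Rightarrow> real \<times> complex \<Rightarrow> real \<Rightarrow> bool" where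
  "tangent_pair N k N' k' \<longleftrightarrow> 0 < k \<and> 0 < k' \<and> mink N N = 1 - k\<^sup>2 \<and> mink N' N' = 1 - k'\<^sup>2 \<and>
     mink N N' = - 1 - k * k' \<and> touch N k N' k' \<in> hyperboloid"

lemma tangent_pair_commute: "tangent_pair N k N' k' \<longleftrightarrow> tangent_pair N' k' N k"
  by (auto simp: tangent_pair_def touch_commute[of N k] mink_commute[of N N'] mult.commute)

lemma tangent_pairI:
  assumes "0 < k" "0 < k'" "mink N N = 1 - k\<^sup>2" "mink N' N' = 1 - k'\<^sup>2"
    and X: "X \<in> hyperboloid" "N + N' = (k + k') *\<^sub>R X"
  shows "tangent_pair N k N' k'" "touch N k N' k' = X"
proof -
  show tX: "touch N k N' k' = X" using assms by (simp add: touch_def)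
  have "mink (N + N') (N + N') = - (k + k')\<^sup>2"
    unfolding X(2) mink_linear(5,6) hyperboloidD(1)[OF X(1)] by (simp add: power2_eq_square algebra_simps)
  then have "mink N N' = - 1 - k * k'"
    using assms(3,4) by (simp add: mink_commute[of N' N] power2_eq_square algebra_simps)
  then show "tangent_pair N k N' k'" using assms tX by (simp add: tangent_pair_def)
qed

lemma tangent_pairD:
  assumes "tangent_pair N k N' k'"
  defines "X \<equiv> touch N k N' k'"
  shows "0 < k" "0 < k'" "mink N N = 1 - k\<^sup>2" "mink N' N' = 1 - k'\<^sup>2"
    "mink N N' = - 1 - k * k'" "mink N' N = - 1 - k * k'" "X \<in> hyperboloid"
    "N + N' = (k + k') *\<^sub>R X" "mink X N = - k" "mink X N' = - k'"
proof -
  show k: "0 < k" "0 < k'" and m: "mink N N = 1 - k\<^sup>2" "mink N' N' = 1 - k'\<^sup>2"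
    "mink N N' = - 1 - k * k'" "mink N' N = - 1 - k * k'" and "X \<in> hyperboloid"
    using assms by (auto simp: tangent_pair_def mink_commute[of N' N])
  show "N + N' = (k + k') *\<^sub>R X" using k by (simp add: X_def touch_def)
  have "mink X N = (1 - k\<^sup>2 + (- 1 - k * k')) / (k + k')" "mink X N' = ((- 1 - k * k') + (1 - k'\<^sup>2)) / (k + k')"
    by (simp_all add: X_def touch_def m)
  moreover have "1 - k\<^sup>2 + (- 1 - k * k') = - k * (k + k')" "(- 1 - k * k') + (1 - k'\<^sup>2) = - k' * (k + k')"
    by (simp_all add: power2_eq_square algebra_simps)
  ultimately show "mink X N = - k" "mink X N' = - k'" using k by simp_all
qed

definition tangent_vectors where
  "tangent_vectors N1 k1 N2 k2 N3 k3 \<longleftrightarrow>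
     tangent_pair N1 k1 N2 k2 \<and> tangent_pair N2 k2 N3 k3 \<and> tangent_pair N3 k3 N1 k1"

lemma foot_properties:
  assumes "tangent_pair N k N' k'"
  defines "X \<equiv> touch N k N' k'"
  shows "0 < fst (foot N k X)" "0 \<le> 1 - min k (1 / k) * k"
    "foot N k X = (1 - min k (1 / k) * k) *\<^sub>R X + min k (1 / k) *\<^sub>R N" "0 < min k (1 / k)"
proof -
  note t = tangent_pairD[OF assms(1), folded X_def]
  define \<rho> where "\<rho> = min k (1 / k)"
  show \<rho>: "0 < min k (1 / k)" using t by simp
  have \<rho>1: "\<rho> \<le> 1" using t(1) by (cases "k \<le> 1") (auto simp: \<rho>_def min_reciprocal)
  have "\<rho> \<le> 1 / k" by (simp add: \<rho>_def)
  then show "0 \<le> 1 - min k (1 / k) * k" using t(1) by (simp add: \<rho>_def[symmetric] le_divide_eq)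
  show "foot N k X = (1 - min k (1 / k) * k) *\<^sub>R X + min k (1 / k) *\<^sub>R N"
    by (simp add: foot_def algebra_simps)
  note nu = normal_vector[OF t(7,3,9)]
  have "mink (foot N k X) X = -1"
    using nu hyperboloidD(1)[OF t(7)] unfolding foot_def mink_linear(1,5)
    by (simp add: mink_commute[of "N - k *\<^sub>R X" X] del: mink_linear(3,4))
  moreover have "mink (foot N k X) (foot N k X) = - 1 + \<rho>\<^sup>2"
    using nu hyperboloidD(1)[OF t(7)] unfolding foot_def mink_linear(1,2,5,6) \<rho>_def[symmetric]
    by (simp add: mink_commute[of "N - k *\<^sub>R X" X] power2_eq_square del: mink_linear(3,4))
  moreover have "\<rho>\<^sup>2 \<le> 1" using \<rho> \<rho>1 by (simp add: \<rho>_def power_le_one)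
  ultimately show "0 < fst (foot N k X)" by (intro future_if_mink_neg[OF t(7)]) auto
qed

text \<open>Segments of the Klein model are the projections of planar cones.\<close>

lemma homogeneous_segment:
  assumes "(1, z) = a *\<^sub>R P + b *\<^sub>R Q" "0 \<le> a" "0 \<le> b" "0 < fst P" "0 < fst Q"
  shows "z \<in> closed_segment (klein P) (klein Q)"
proof -
  define \<alpha> \<beta> where "\<alpha> = a * fst P" and "\<beta> = b * fst Q"
  have f: "1 = \<alpha> + \<beta>" "z = a *\<^sub>R snd P + b *\<^sub>R snd Q"
    using arg_cong[OF assms(1), of fst] arg_cong[OF assms(1), of snd] by (simp_all add: \<alpha>_def \<beta>_def)
  have "z = \<alpha> *\<^sub>R klein P + \<beta> *\<^sub>R klein Q" using f(2) assms by (simp add: \<alpha>_def \<beta>_def klein_def)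
  moreover have "0 \<le> \<alpha>" "0 \<le> \<beta>" using assms by (auto simp: \<alpha>_def \<beta>_def)
  then have "0 \<le> \<beta>" "\<beta> \<le> 1" "\<alpha> = 1 - \<beta>" using f(1) by linarith+
  ultimately show ?thesis unfolding in_segment by blast
qed

lemma vertex_bound:
  assumes k: "0 < k" "0 < k'" and ab: "0 \<le> a" "0 \<le> (b::real)" and le: "b * (1 - k'\<^sup>2) - a * (1 + k * k') \<le> 0"
  shows "b - a \<le> min k' (1 / k') * (a * k + b * k')"
proof (cases "k' \<le> 1")
  case True
  then show ?thesis using k le by (simp add: min_reciprocal power2_eq_square algebra_simps)
next
  case False
  then have "min k' (1 / k') * (a * k + b * k') = a * k / k' + b"
    using k by (simp add: min_reciprocal add_divide_distrib)
  moreover have "0 \<le> a * k / k'" using k ab by simp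
  ultimately show ?thesis using ab by linarith
qed

text \<open>Writing \<open>N = k X + \<nu>\<close> and \<open>N' = k' X - \<nu>\<close>, the edge is the cone spanned by \<open>X + \<rho> \<nu>\<close> and \<open>X - \<rho>' \<nu>\<close>.
  The sign conditions say that \<open>z\<close> does not lie beyond the axis of a hypercycle, and a center is
  not passed because the coefficients \<open>a\<close> and \<open>b\<close> are nonnegative.\<close>

lemma edge_segment:
  assumes t: "tangent_pair N k N' k'" and z: "(1, z) = a *\<^sub>R N + b *\<^sub>R N'" "0 \<le> a" "0 \<le> b"
    and le: "mink (1, z) N \<le> 0" "mink (1, z) N' \<le> 0"
  shows "z \<in> closed_segment (klein (foot N k (touch N k N' k'))) (klein (foot N' k' (touch N k N' k')))"
proof -
  define X where "X = touch N k N' k'"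
  note t' = tangent_pairD[OF t, folded X_def]
  have sw: "touch N' k' N k = X" by (simp add: X_def touch_commute)
  note f1 = foot_properties[OF t, folded X_def]
  note f2 = foot_properties[OF t[unfolded tangent_pair_commute[of N]], unfolded sw]
  define \<rho> \<rho>' \<nu> where "\<rho> = min k (1 / k)" and "\<rho>' = min k' (1 / k')" and "\<nu> = N - k *\<^sub>R X"
  have NX: "N = k *\<^sub>R X + \<nu>" "N' = k' *\<^sub>R X - \<nu>"
    using t'(8) by (simp_all add: \<nu>_def algebra_simps)
  have foot: "foot N k X = X + \<rho> *\<^sub>R \<nu>" "foot N' k' X = X - \<rho>' *\<^sub>R \<nu>"
    by (simp add: foot_def \<rho>_def \<nu>_def) (simp add: foot_def \<rho>'_def NX(2))
  define S where "S = a * k + b * k'"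
  have r: "0 < \<rho>" "0 < \<rho>'" using f1(4) f2(4) by (simp_all add: \<rho>_def \<rho>'_def)
  have "b * (1 - k'\<^sup>2) - a * (1 + k * k') \<le> 0" "a * (1 - k\<^sup>2) - b * (1 + k' * k) \<le> 0"
    using le unfolding z(1) by (simp_all add: t' algebra_simps)
  then have "b - a \<le> \<rho>' * (a * k + b * k')" "a - b \<le> \<rho> * (b * k' + a * k)"
    unfolding \<rho>_def \<rho>'_def using t'(1,2) z(2,3) by (blast intro: vertex_bound)+
  then have nn: "0 \<le> (a - b + \<rho>' * S) / (\<rho> + \<rho>')" "0 \<le> (\<rho> * S - (a - b)) / (\<rho> + \<rho>')"
    using r by (simp_all add: S_def add.commute)
  have "(1, z) = S *\<^sub>R X + (a - b) *\<^sub>R \<nu>" unfolding z(1) NX S_def by (simp add: algebra_simps)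
  also have "\<dots> = ((a - b + \<rho>' * S) / (\<rho> + \<rho>')) *\<^sub>R foot N k X + ((\<rho> * S - (a - b)) / (\<rho> + \<rho>')) *\<^sub>R foot N' k' X"
  proof -
    have "(a - b + \<rho>' * S) / (\<rho> + \<rho>') + (\<rho> * S - (a - b)) / (\<rho> + \<rho>') = (S * (\<rho> + \<rho>')) / (\<rho> + \<rho>')"
      unfolding add_divide_distrib[symmetric] by (simp add: algebra_simps)
    then have 1: "(a - b + \<rho>' * S) / (\<rho> + \<rho>') + (\<rho> * S - (a - b)) / (\<rho> + \<rho>') = S" using r by simp
    have "(a - b + \<rho>' * S) / (\<rho> + \<rho>') * \<rho> - (\<rho> * S - (a - b)) / (\<rho> + \<rho>') * \<rho>' = ((a - b) * (\<rho> + \<rho>')) / (\<rho> + \<rho>')"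
      unfolding times_divide_eq_left diff_divide_distrib[symmetric] by (simp add: algebra_simps)
    then have 2: "(a - b + \<rho>' * S) / (\<rho> + \<rho>') * \<rho> - (\<rho> * S - (a - b)) / (\<rho> + \<rho>') * \<rho>' = a - b" using r by simp
    have "A *\<^sub>R (X + \<rho> *\<^sub>R \<nu>) + B *\<^sub>R (X - \<rho>' *\<^sub>R \<nu>) = (A + B) *\<^sub>R X + (A * \<rho> - B * \<rho>') *\<^sub>R \<nu>" for A B
      by (simp add: algebra_simps)
    then show ?thesis unfolding foot 1 2 by (simp only: 1 2)
  qed
  finally show ?thesis
    unfolding X_def[symmetric] using nn f1(1) f2(1) by (rule homogeneous_segment)
qed

lemma touch_in_edge:
  assumes t: "tangent_pair N k N' k'"
  shows "klein (touch N k N' k') \<in> closed_segment (klein (foot N k (touch N k N' k'))) (klein (foot N' k' (touch N k N' k')))"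
proof (rule edge_segment[OF t])
  define X where "X = touch N k N' k'"
  note t' = tangent_pairD[OF t, folded X_def]
  have f: "0 < fst X" using hyperboloidD(2)[OF t'(7)] .
  have h: "(1, klein X) = (1 / fst X) *\<^sub>R X" using f by (simp add: klein_def prod_eq_iff)
  define c where "c = 1 / fst X / (k + k')"
  show "(1, klein (touch N k N' k')) = c *\<^sub>R N + c *\<^sub>R N'"
    unfolding X_def[symmetric] h by (subst (2) X_def) (simp add: touch_def c_def scaleR_add_right)
  show "0 \<le> c" "0 \<le> c" using f t'(1,2) by (auto simp: c_def)
  show "mink (1, klein (touch N k N' k')) N \<le> 0" "mink (1, klein (touch N k N' k')) N' \<le> 0"
    unfolding X_def[symmetric] h mink_linear t' using f t'(1,2) by simp_all
qed

text \<open>Both endpoints are positive multiples of vectors \<open>(1 + k l) N + (1 - k\<^sup>2) M\<close>, where \<open>M\<close> and \<open>l\<close>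
  belong to one of the other two circles. The equation \<open>mink (1, z) N = 0\<close> determines \<open>a\<close> such that
  \<open>(1, z)\<close> is a nonnegative combination of them.\<close>

lemma vertex_segment:
  assumes t: "tangent_pair N k N' k'" "tangent_pair N k N'' k''" and k: "k < 1"
    and z: "(1, z) = a *\<^sub>R N + b *\<^sub>R N' + c *\<^sub>R N''" "0 \<le> b" "0 \<le> c" "mink (1, z) N = 0"
  shows "z \<in> closed_segment (klein (foot N k (touch N k N' k'))) (klein (foot N k (touch N k N'' k'')))"
proof -
  note t1 = tangent_pairD[OF t(1)] and t2 = tangent_pairD[OF t(2)]
  have k2: "0 < 1 - k\<^sup>2" using k t1(1) by (simp add: power_less_one_iff)
  have foot: "foot N k (touch N k M l) = (1 / (k + l)) *\<^sub>R ((1 + k * l) *\<^sub>R N + (1 - k\<^sup>2) *\<^sub>R M)"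
    if "0 < l" for M l
  proof -
    define q where "q = 1 / (k + l)"
    have "q * (k + l) = 1" using that t1(1) by (simp add: q_def)
    then have "k = q * (k * k) + q * (k * l)" by (metis (no_types) distrib_left mult.assoc mult.commute mult.right_neutral)
    have "foot N k (touch N k M l) = ((1 - k\<^sup>2) * q + k) *\<^sub>R N + ((1 - k\<^sup>2) * q) *\<^sub>R M"
      using k t1(1) by (simp add: foot_def touch_def q_def[symmetric] min_reciprocal algebra_simps power2_eq_square)
    also have "(1 - k\<^sup>2) * q + k = q * (1 + k * l)"
      by (subst (2) \<open>k = _\<close>) (simp add: algebra_simps power2_eq_square)
    finally show ?thesis by (simp add: q_def[symmetric] scaleR_add_right mult.commute)
  qed
  have aeq: "a * (1 - k\<^sup>2) = b * (1 + k * k') + c * (1 + k * k'')"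
    using z(4) unfolding z(1) by (simp add: t1 t2 algebra_simps)
  have a: "a = (b / (1 - k\<^sup>2)) * (1 + k * k') + (c / (1 - k\<^sup>2)) * (1 + k * k'')"
  proof -
    have "a = (b * (1 + k * k') + c * (1 + k * k'')) / (1 - k\<^sup>2)"
      using k2 aeq by (simp only: eq_divide_eq) auto
    then show ?thesis by (simp add: add_divide_distrib)
  qed
  have bc: "(b / (1 - k\<^sup>2)) * (1 - k\<^sup>2) = b" "(c / (1 - k\<^sup>2)) * (1 - k\<^sup>2) = c" using k2 by simp_all
  have cancel: "(s * (k + l)) *\<^sub>R (1 / (k + l)) *\<^sub>R V = s *\<^sub>R V" if "0 < l" for s l and V :: "real \<times> complex"
    using that t1(1) by simp
  have "(1, z) = (b / (1 - k\<^sup>2) * (k + k')) *\<^sub>R foot N k (touch N k N' k')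
      + (c / (1 - k\<^sup>2) * (k + k'')) *\<^sub>R foot N k (touch N k N'' k'')"
    unfolding foot[OF t1(2)] foot[OF t2(2)] cancel[OF t1(2)] cancel[OF t2(2)]
    unfolding z(1) scaleR_add_right scaleR_scaleR bc
    by (subst a) (simp add: scaleR_add_left)
  then show ?thesis
    by (rule homogeneous_segment) (use z k2 t1 t2 foot_properties(1)[OF t(1)] foot_properties(1)[OF t(2)] in auto)
qed

text \<open>All coordinates in the frame at the first point of tangency follow from the inner products of
  \<open>N\<^sub>1\<close>, \<open>N\<^sub>2\<close>, \<open>N\<^sub>3\<close>; the determinant of the three vectors is \<open>2 m\<close> up to sign, which makes them a
  basis, with dual basis \<open>W\<^sub>1\<close>, \<open>W\<^sub>2\<close>, \<open>W\<^sub>3\<close>. The sign of \<open>\<tau>\<close> is chosen such that the arc starts towards the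
  third circle; the next point of tangency then has the parameter \<open>1 / m\<close>. With \<open>v = u m\<close> the
  coordinates of the arc with respect to \<open>N\<^sub>1\<close>, \<open>N\<^sub>2\<close>, \<open>N\<^sub>3\<close> are polynomials with nonnegative Bernstein
  coefficients on \<open>{0..1}\<close>, up to a positive factor.\<close>

lemma triangle_frame:
  assumes tv: "tangent_vectors N1 k1 N2 k2 N3 k3"
  defines "X \<equiv> touch N1 k1 N2 k2" and "m \<equiv> sqrt (1 + sigma2 k1 k2 k3)"
  defines "\<nu> \<equiv> N1 - k1 *\<^sub>R X"
  obtains \<tau> W1 W2 W3 where "frame X \<nu> \<tau>"
    "\<And>Z. Z = mink Z W1 *\<^sub>R N1 + mink Z W2 *\<^sub>R N2 + mink Z W3 *\<^sub>R N3"
    "mink N1 W2 = 0" "mink N2 W2 = 1" "mink N3 W2 = 0"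
    "touch N3 k3 N1 k1 = arc_point k1 X \<nu> \<tau> (1 / m)"
    "\<And>u. 0 < u \<Longrightarrow> u < 1 / m \<Longrightarrow> 0 < mink (arc_point k1 X \<nu> \<tau> u) W1 \<and>
      0 < mink (arc_point k1 X \<nu> \<tau> u) W2 \<and> 0 < mink (arc_point k1 X \<nu> \<tau> u) W3"
proof -
  have tp: "tangent_pair N1 k1 N2 k2" "tangent_pair N2 k2 N3 k3" "tangent_pair N3 k3 N1 k1"
    using tv by (auto simp: tangent_vectors_def)
  note t12 = tangent_pairD[OF tp(1), folded X_def]
  note t23 = tangent_pairD[OF tp(2)] and t31 = tangent_pairD[OF tp(3)]
  define d where "d = k1 + k2"
  have d: "0 < d" using t12 by (simp add: d_def)
  have s: "0 < sigma2 k1 k2 k3" using t12 t23 by (simp add: sigma2_def add_pos_pos)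
  have m: "1 < m" "m\<^sup>2 = 1 + sigma2 k1 k2 k3" using s by (simp_all add: m_def)
  define p x y where "p = k3 + 2 / d" and "x = (k1 - k2) / d" and "y = 2 * m / d"
  have y: "0 < y" using m d by (simp add: y_def)
  have pd: "p * d = k3 * d + 2" "x * d = k1 - k2" "y * d = 2 * m" using d by (simp_all add: p_def x_def y_def distrib_right)
  define \<tau>0 where "\<tau>0 = lcross X \<nu>"
  have fr0: "frame X \<nu> \<tau>0" unfolding \<nu>_def \<tau>0_def by (rule normal_frame[OF t12(7,3,9)])
  have NX: "N1 = k1 *\<^sub>R X + \<nu>" "N2 = k2 *\<^sub>R X - \<nu>" using t12(8) by (simp_all add: \<nu>_def algebra_simps)
  have N3X: "mink N3 X = - p"
  proof -
    have "mink N3 X * d = mink N3 (N1 + N2)" unfolding t12(8) by (simp add: d_def)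
    also have "\<dots> = - p * d" using pd(1) by (simp add: t31 t23 d_def algebra_simps)
    finally show ?thesis using d mult_right_cancel[of d "mink N3 X" "- p"] by blast
  qed
  have N3\<nu>: "mink N3 \<nu> = x"
  proof -
    have e: "mink N3 \<nu> = - 1 - k3 * k1 + k1 * p" by (simp add: \<nu>_def t31 N3X)
    have "mink N3 \<nu> * d = - d - k3 * k1 * d + k1 * (p * d)" unfolding e by (simp add: algebra_simps)
    also have "\<dots> = x * d" unfolding pd by (simp add: d_def algebra_simps)
    finally show ?thesis using d mult_right_cancel[of d "mink N3 \<nu>" x] by blast
  qed
  have N3\<tau>: "(mink N3 \<tau>0)\<^sup>2 = y\<^sup>2"
  proof -
    have "mink N3 N3 = mink N3 (- mink N3 X *\<^sub>R X + mink N3 \<nu> *\<^sub>R \<nu> + mink N3 \<tau>0 *\<^sub>R \<tau>0)"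
      using frame_expand[OF fr0, of N3] by simp
    also have "\<dots> = - p\<^sup>2 + x\<^sup>2 + (mink N3 \<tau>0)\<^sup>2"
      by (simp add: N3X N3\<nu> power2_eq_square)
    finally have e: "(mink N3 \<tau>0)\<^sup>2 = 1 - k3\<^sup>2 + p\<^sup>2 - x\<^sup>2" using t31(3) by simp
    have "(mink N3 \<tau>0)\<^sup>2 * d\<^sup>2 = d\<^sup>2 - k3\<^sup>2 * d\<^sup>2 + (p * d)\<^sup>2 - (x * d)\<^sup>2"
      unfolding e by (simp add: algebra_simps power_mult_distrib)
    also have "\<dots> = 4 * m\<^sup>2" unfolding pd m(2) by (simp add: d_def sigma2_def power2_eq_square algebra_simps)
    also have "\<dots> = y\<^sup>2 * d\<^sup>2" unfolding power_mult_distrib[symmetric] pd by (simp add: power_mult_distrib)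
    finally show ?thesis using d by simp
  qed
  define \<tau> where "\<tau> = (if mink N3 \<tau>0 = y then \<tau>0 else - \<tau>0)"
  have fr: "frame X \<nu> \<tau>" using fr0 frame_minus by (auto simp: \<tau>_def)
  have N3y: "mink N3 \<tau> = y" using N3\<tau> by (auto simp: \<tau>_def power2_eq_iff)
  have N3: "N3 = p *\<^sub>R X + x *\<^sub>R \<nu> + y *\<^sub>R \<tau>"
    using frame_expand[OF fr, of N3] unfolding N3X N3\<nu> N3y by simp
  define q where "q = 1 / (d * y)"
  have q: "0 < q" "q * (d * y) = 1" using d y by (simp_all add: q_def)
  define W1 W2 W3 where "W1 = q *\<^sub>R (- y *\<^sub>R X + (k2 * y) *\<^sub>R \<nu> - (p + k2 * x) *\<^sub>R \<tau>)"
    and "W2 = q *\<^sub>R (- y *\<^sub>R X - (k1 * y) *\<^sub>R \<nu> - (p - k1 * x) *\<^sub>R \<tau>)"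
    and "W3 = (1 / y) *\<^sub>R \<tau>"
  have W: "mink Z W1 = q * (- y * mink Z X + k2 * y * mink Z \<nu> - (p + k2 * x) * mink Z \<tau>)"
    "mink Z W2 = q * (- y * mink Z X - k1 * y * mink Z \<nu> - (p - k1 * x) * mink Z \<tau>)"
    "mink Z W3 = mink Z \<tau> / y" for Z
    by (simp_all add: W1_def W2_def W3_def)
  show thesis
  proof (rule that[OF fr, of W1 W2 W3])
    show "Z = mink Z W1 *\<^sub>R N1 + mink Z W2 *\<^sub>R N2 + mink Z W3 *\<^sub>R N3" for Z
    proof -
      define \<alpha> \<beta> \<gamma> where "\<alpha> = - mink Z X" and "\<beta> = mink Z \<nu>" and "\<gamma> = mink Z \<tau>"
      define a b c where "a = mink Z W1" and "b = mink Z W2" and "c = mink Z W3"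
      have abc: "a = q * (y * \<alpha> + k2 * y * \<beta> - (p + k2 * x) * \<gamma>)"
        "b = q * (y * \<alpha> - k1 * y * \<beta> - (p - k1 * x) * \<gamma>)" "c = \<gamma> / y"
        unfolding a_def b_def c_def W by (simp_all add: \<alpha>_def \<beta>_def \<gamma>_def)
      have cy: "c * y = \<gamma>" using y by (simp add: abc)
      have 1: "k1 * a + k2 * b + p * c = \<alpha>"
      proof -
        have "k1 * a + k2 * b = q * (d * y) * \<alpha> - q * d * p * \<gamma>"
          unfolding abc d_def by (simp add: algebra_simps)
        also have "q * d * p * \<gamma> = q * (d * y) * (p * c)" by (simp add: cy[symmetric])
        finally show ?thesis unfolding q(2) by simp
      qed
      have 2: "a - b + x * c = \<beta>"
      proof -
        have "a - b = q * (d * y) * \<beta> - q * d * x * \<gamma>"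
          unfolding abc d_def by (simp add: algebra_simps)
        also have "q * d * x * \<gamma> = q * (d * y) * (x * c)" by (simp add: cy[symmetric])
        finally show ?thesis unfolding q(2) by simp
      qed
      have "a *\<^sub>R N1 + b *\<^sub>R N2 + c *\<^sub>R N3 = (k1 * a + k2 * b + p * c) *\<^sub>R X + (a - b + x * c) *\<^sub>R \<nu> + (c * y) *\<^sub>R \<tau>"
        unfolding NX N3 by (simp add: algebra_simps)
      also have "\<dots> = \<alpha> *\<^sub>R X + \<beta> *\<^sub>R \<nu> + \<gamma> *\<^sub>R \<tau>" unfolding 1 2 cy ..
      also have "\<dots> = Z" using frame_expand[OF fr, of Z] by (simp add: \<alpha>_def \<beta>_def \<gamma>_def)
      finally show ?thesis by (simp add: a_def b_def c_def)
    qed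
    have Nc: "mink N1 X = - k1" "mink N1 \<nu> = 1" "mink N1 \<tau> = 0" "mink N2 X = - k2" "mink N2 \<nu> = - 1" "mink N2 \<tau> = 0"
      unfolding NX by (simp_all add: frameD[OF fr])
    show "mink N1 W2 = 0" unfolding W Nc by simp
    have "mink N2 W2 = q * (d * y)" unfolding W Nc by (simp add: d_def algebra_simps)
    then show "mink N2 W2 = 1" unfolding q(2) .
    show "mink N3 W2 = 0" unfolding W N3X N3\<nu> N3y by (simp add: algebra_simps)
    show "touch N3 k3 N1 k1 = arc_point k1 X \<nu> \<tau> (1 / m)"
    proof -
      define e where "e = k1 + k3"
      have e: "0 < e" using t31 by (simp add: e_def)
      have m0: "0 < m" using m(1) by simp
      have den: "arc_denom k1 (1 / m) = d * e / m\<^sup>2"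
      proof -
        have "m\<^sup>2 + (k1\<^sup>2 - 1) = d * e" unfolding m(2) by (simp add: sigma2_def d_def e_def power2_eq_square algebra_simps)
        then show ?thesis using m(1) unfolding arc_denom_def by (simp add: field_simps)
      qed
      have c1: "2 * (1 / m) / arc_denom k1 (1 / m) = y / e"
        unfolding den using m0 d e by (simp add: y_def power2_eq_square)
      have c2: "2 * (1 / m)\<^sup>2 / arc_denom k1 (1 / m) = 2 / (d * e)"
        unfolding den using m0 d e by (simp add: power2_eq_square)
      have r1: "1 + 2 / (d * e) = (1 / e) * (k1 + p)"
        using d e by (simp add: p_def e_def divide_simps) (simp add: e_def algebra_simps)
      have r2: "2 / (d * e) * k1 = (1 / e) * (1 + x)"
        using d e by (simp add: x_def divide_simps) (simp add: d_def algebra_simps)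
      have "arc_point k1 X \<nu> \<tau> (1 / m) = (1 + 2 / (d * e)) *\<^sub>R X + (2 / (d * e) * k1) *\<^sub>R \<nu> + (y / e) *\<^sub>R \<tau>"
        unfolding arc_point_def c1 c2 by (simp add: algebra_simps)
      also have "\<dots> = (1 / e) *\<^sub>R ((k1 *\<^sub>R X + \<nu>) + (p *\<^sub>R X + x *\<^sub>R \<nu> + y *\<^sub>R \<tau>))"
      proof -
        have eq: "(k1 *\<^sub>R X + \<nu>) + (p *\<^sub>R X + x *\<^sub>R \<nu> + y *\<^sub>R \<tau>) = (k1 + p) *\<^sub>R X + (1 + x) *\<^sub>R \<nu> + y *\<^sub>R \<tau>"
          by (simp add: algebra_simps)
        show ?thesis unfolding eq r1 r2 by (simp add: scaleR_add_right)
      qed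
      also have "\<dots> = touch N3 k3 N1 k1"
        unfolding NX(1)[symmetric] N3[symmetric] touch_def e_def by (simp add: add.commute)
      finally show ?thesis ..
    qed
    show "0 < mink (arc_point k1 X \<nu> \<tau> u) W1 \<and> 0 < mink (arc_point k1 X \<nu> \<tau> u) W2 \<and> 0 < mink (arc_point k1 X \<nu> \<tau> u) W3"
      if u: "0 < u" "u < 1 / m" for u
    proof -
      define A v where "A = arc_denom k1 u" and "v = u * m"
      have v: "0 < v" "v < 1" using u m by (simp_all add: v_def field_simps)
      have "u\<^sup>2 < 1"
      proof -
        have "1 / m < 1" using m(1) by simp
        then have "u < 1" using u(2) by linarith
        then show ?thesis using u(1) by (simp add: power_less_one_iff)
      qed
      then have A: "0 < A" using zero_le_power2[of "k1 * u"]
        unfolding A_def arc_denom_def power_mult_distrib left_diff_distrib by linarith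
      have coords: "mink (arc_point k1 X \<nu> \<tau> u) X = - 1 - 2 * u\<^sup>2 / A"
        "mink (arc_point k1 X \<nu> \<tau> u) \<nu> = 2 * u\<^sup>2 * k1 / A"
        "mink (arc_point k1 X \<nu> \<tau> u) \<tau> = 2 * u / A"
        by (simp_all add: arc_point_def frameD[OF fr] A_def)
      have two_u: "(p - k1 * x) * (2 * u) * m = y * (u * (k3 * d + 2 - k1 * (k1 - k2)))"
        "(p + k2 * x) * (2 * u) * m = y * (u * (k3 * d + 2 + k2 * (k1 - k2)))"
      proof -
        have "(p - k1 * x) * (2 * u) * m = u * (p * d - k1 * (x * d)) * (2 * m / d)" using d by (simp add: field_simps)
        then show "(p - k1 * x) * (2 * u) * m = y * (u * (k3 * d + 2 - k1 * (k1 - k2)))"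
          unfolding pd y_def[symmetric] by (simp add: algebra_simps)
        have "(p + k2 * x) * (2 * u) * m = u * (p * d + k2 * (x * d)) * (2 * m / d)" using d by (simp add: field_simps)
        then show "(p + k2 * x) * (2 * u) * m = y * (u * (k3 * d + 2 + k2 * (k1 - k2)))"
          unfolding pd y_def[symmetric] by (simp add: algebra_simps)
      qed
      \<comment> \<open>Up to positive factors, the coordinates along \<open>N2\<close> and \<open>N1\<close> are polynomials in \<open>v\<close> that are visibly positive.\<close>
      have w2: "mink (arc_point k1 X \<nu> \<tau> u) W2 * (A * m\<^sup>2) = q * y * ((1 - v) * (m\<^sup>2 + (k1\<^sup>2 - 1) * v))"
      proof -
        have "mink (arc_point k1 X \<nu> \<tau> u) W2 * (A * m\<^sup>2)
          = q * m\<^sup>2 * (y * (A + 2 * u\<^sup>2) - k1 * y * (2 * u\<^sup>2 * k1) - (p - k1 * x) * (2 * u))"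
          unfolding W coords using A by (simp add: field_simps)
        also have "\<dots> = q * (m\<^sup>2 * (y * (A + 2 * u\<^sup>2) - k1 * y * (2 * u\<^sup>2 * k1)) - m * ((p - k1 * x) * (2 * u) * m))"
          by (simp add: power2_eq_square algebra_simps)
        also have "\<dots> = q * y * (m\<^sup>2 * (A + 2 * u\<^sup>2 - 2 * u\<^sup>2 * k1\<^sup>2) - v * (k3 * d + 2 - k1 * (k1 - k2)))"
          unfolding two_u by (simp add: v_def power2_eq_square algebra_simps)
        also have "m\<^sup>2 * (A + 2 * u\<^sup>2 - 2 * u\<^sup>2 * k1\<^sup>2) = m\<^sup>2 - (k1\<^sup>2 - 1) * v\<^sup>2"
          by (simp add: A_def arc_denom_def v_def power_mult_distrib algebra_simps)
        also have "k3 * d + 2 - k1 * (k1 - k2) = m\<^sup>2 - (k1\<^sup>2 - 1)"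
          unfolding m(2) by (simp add: sigma2_def d_def power2_eq_square algebra_simps)
        also have "m\<^sup>2 - (k1\<^sup>2 - 1) * v\<^sup>2 - v * (m\<^sup>2 - (k1\<^sup>2 - 1)) = (1 - v) * (m\<^sup>2 + (k1\<^sup>2 - 1) * v)"
          by (simp add: power2_eq_square algebra_simps)
        finally show ?thesis .
      qed
      have w1: "mink (arc_point k1 X \<nu> \<tau> u) W1 * (A * m\<^sup>2)
          = q * y * ((1 - v)\<^sup>2 * m\<^sup>2 + v * (1 - v) * (sigma2 k1 k2 k3 + k2\<^sup>2) + v\<^sup>2 * d\<^sup>2)"
      proof -
        have "mink (arc_point k1 X \<nu> \<tau> u) W1 * (A * m\<^sup>2)
          = q * m\<^sup>2 * (y * (A + 2 * u\<^sup>2) + k2 * y * (2 * u\<^sup>2 * k1) - (p + k2 * x) * (2 * u))"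
          unfolding W coords using A by (simp add: field_simps)
        also have "\<dots> = q * (m\<^sup>2 * (y * (A + 2 * u\<^sup>2) + k2 * y * (2 * u\<^sup>2 * k1)) - m * ((p + k2 * x) * (2 * u) * m))"
          by (simp add: power2_eq_square algebra_simps)
        also have "\<dots> = q * y * (m\<^sup>2 * (A + 2 * u\<^sup>2 + 2 * u\<^sup>2 * (k1 * k2)) - v * (k3 * d + 2 + k2 * (k1 - k2)))"
          unfolding two_u by (simp add: v_def power2_eq_square algebra_simps)
        also have "m\<^sup>2 * (A + 2 * u\<^sup>2 + 2 * u\<^sup>2 * (k1 * k2)) = m\<^sup>2 + (k1\<^sup>2 + 1 + 2 * (k1 * k2)) * v\<^sup>2"
          by (simp add: A_def arc_denom_def v_def power_mult_distrib algebra_simps)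
        also have "k3 * d + 2 + k2 * (k1 - k2) = m\<^sup>2 + 1 - k2\<^sup>2"
          unfolding m(2) by (simp add: sigma2_def d_def power2_eq_square algebra_simps)
        also have "m\<^sup>2 + (k1\<^sup>2 + 1 + 2 * (k1 * k2)) * v\<^sup>2 - v * (m\<^sup>2 + 1 - k2\<^sup>2)
            = (1 - v)\<^sup>2 * m\<^sup>2 + v * (1 - v) * (m\<^sup>2 - 1 + k2\<^sup>2) + v\<^sup>2 * d\<^sup>2"
          by (simp add: d_def power2_eq_square algebra_simps)
        also have "m\<^sup>2 - 1 + k2\<^sup>2 = sigma2 k1 k2 k3 + k2\<^sup>2" unfolding m(2) by simp
        finally show ?thesis .
      qed
      have m2: "1 < m\<^sup>2" using m(2) s by simp
      have "0 < m\<^sup>2 + (k1\<^sup>2 - 1) * v"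
      proof -
        have "0 \<le> k1\<^sup>2 * v" using v by simp
        then show ?thesis using m2 v unfolding left_diff_distrib by linarith
      qed
      then have p2: "0 < mink (arc_point k1 X \<nu> \<tau> u) W2 * (A * m\<^sup>2)"
        unfolding w2 using q(1) y v by simp
      have p1: "0 < mink (arc_point k1 X \<nu> \<tau> u) W1 * (A * m\<^sup>2)"
        unfolding w1 using q(1) y v s d m2 t12(1,2) by (intro mult_pos_pos add_pos_pos) auto
      have Am: "0 < A * m\<^sup>2" using mult_pos_pos[OF A, of "m\<^sup>2"] m2 by linarith
      have "0 < mink (arc_point k1 X \<nu> \<tau> u) W3" unfolding W coords using u A y by simp
      then show ?thesis using zero_less_mult_pos2[OF p1 Am] zero_less_mult_pos2[OF p2 Am] by blast
    qed
  qed
qed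

lemma continuous_on_affine_mink: "continuous_on S (\<lambda>z. mink (1, z) W)"
  by (intro continuous_intros)

lemma mink_klein: "0 < fst V \<Longrightarrow> mink (1, klein V) W = mink V W / fst V"
  by (simp add: mink_def klein_def diff_divide_distrib)

lemma foot_in_halfplane:
  assumes t: "tangent_pair N k N' k'" and W: "0 \<le> mink N W" "0 \<le> mink N' W"
  shows "0 \<le> mink (1, klein (foot N k (touch N k N' k'))) W"
proof -
  note f = foot_properties[OF t] and t' = tangent_pairD[OF t]
  have "0 \<le> mink (touch N k N' k') W" using W t'(1,2) by (simp add: touch_def)
  then have "0 \<le> mink (foot N k (touch N k N' k')) W"
    unfolding f(3) mink_linear using f(2,4) W by (intro add_nonneg_nonneg mult_nonneg_nonneg) auto
  then show ?thesis using f(1) by (simp add: mink_klein)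
qed

text \<open>All corners of the polygon are nonnegative combinations of \<open>N\<^sub>1\<close>, \<open>N\<^sub>2\<close>, \<open>N\<^sub>3\<close>, and no
  point outside a half-plane is enclosed by a polygon inside it.\<close>

lemma packed_triangle_in_halfplane:
  assumes tv: "tangent_vectors N1 k1 N2 k2 N3 k3" and W: "0 \<le> mink N1 W" "0 \<le> mink N2 W" "0 \<le> mink N3 W"
  shows "packed_triangle (klein (foot N1 k1 (touch N1 k1 N2 k2))) (klein (foot N2 k2 (touch N1 k1 N2 k2)))
      (klein (foot N2 k2 (touch N2 k2 N3 k3))) (klein (foot N3 k3 (touch N2 k2 N3 k3)))
      (klein (foot N3 k3 (touch N3 k3 N1 k1))) (klein (foot N1 k1 (touch N3 k3 N1 k1)))
    \<subseteq> {z. 0 \<le> mink (1, z) W}" (is "packed_triangle ?p12 ?p21 ?p23 ?p32 ?p31 ?p13 \<subseteq> ?H")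
proof -
  have tp: "tangent_pair N1 k1 N2 k2" "tangent_pair N2 k2 N3 k3" "tangent_pair N3 k3 N1 k1"
    "tangent_pair N2 k2 N1 k1" "tangent_pair N3 k3 N2 k2" "tangent_pair N1 k1 N3 k3"
    using tv by (auto simp: tangent_vectors_def tangent_pair_commute)
  have p: "?p12 \<in> ?H" "?p21 \<in> ?H" "?p23 \<in> ?H" "?p32 \<in> ?H" "?p31 \<in> ?H" "?p13 \<in> ?H"
    using foot_in_halfplane[OF tp(1)] foot_in_halfplane[OF tp(2)] foot_in_halfplane[OF tp(3)]
      foot_in_halfplane[OF tp(4)] foot_in_halfplane[OF tp(5)] foot_in_halfplane[OF tp(6)] W
    by (simp_all add: touch_commute[of N2 k2 N1 k1] touch_commute[of N3 k3 N2 k2] touch_commute[of N1 k1 N3 k3])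
  have "?H = {z. fst W \<le> snd W \<bullet> z}" by (auto simp: mink_def inner_commute)
  then have conv: "convex ?H" by (metis convex_halfspace_ge)
  have B: "triangle_boundary ?p12 ?p21 ?p23 ?p32 ?p31 ?p13 \<subseteq> ?H"
    unfolding triangle_boundary_def Un_subset_iff
    by (intro conjI closed_segment_subset p conv)
  show ?thesis
    unfolding packed_triangle_def union_with_inside
    using outside_mono[OF B] unfolding outside_convex[OF conv] by blast
qed

lemma represents_edge_end:
  assumes C: "represents C N k" and C': "represents C' N' k'"
    and t: "t \<in> hplane" "N + N' = (k + k') *\<^sub>R lift t" and e: "edge_between C C' t p p'"
  shows "tangent_pair N k N' k'" "touch N k N' k' = lift t"
    "p = klein (foot N k (touch N k N' k'))" "p' = klein (foot N' k' (touch N k N' k'))"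
proof -
  have r: "0 < k" "0 < k'" "mink N N = 1 - k\<^sup>2" "mink N' N' = 1 - k'\<^sup>2"
    using C C' by (auto simp: represents_def)
  show tp: "tangent_pair N k N' k'" "touch N k N' k' = lift t"
    using tangent_pairI[OF r lift_hyperboloid[OF t(1)] t(2)] by auto
  have "t \<in> hcurve N k" "t \<in> hcurve N' k'"
    using tangent_pairD(9,10)[OF tp(1)] t(1) tp(2) by (auto simp: hcurve_def)
  then show "p = klein (foot N k (touch N k N' k'))" "p' = klein (foot N' k' (touch N k N' k'))"
    using e C C' by (auto simp: edge_between_def represents_def tp(2))
qed

text \<open>The curvatures determine all inner products, hence the parameter \<open>1 / m\<close> of the end of the arc. If
  the first circle is compact, it remains to see that the arc does not run the other way round: the
  point antipodal to its start and the second circle lie on different sides of the edge between the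
  first circle and the third.\<close>

lemma packed_arc_length_unique:
  assumes "packed_arc_length k1 k2 k3 l"
  shows "l = arc_integral k1 (1 / sqrt (1 + sigma2 k1 k2 k3))"
proof -
  obtain C1 C2 C3 t12 t23 t31 p12 p21 p23 p32 p31 p13 \<gamma> where
    tt: "tangent_triple C1 C2 C3 t12 t23 t31"
    and kk: "geod_curvature C1 = k1" "geod_curvature C2 = k2" "geod_curvature C3 = k3"
    and e: "edge_between C1 C2 t12 p12 p21" "edge_between C2 C3 t23 p23 p32" "edge_between C3 C1 t31 p31 p13"
    and \<gamma>: "arc \<gamma>" "pathstart \<gamma> = t12" "pathfinish \<gamma> = t31"
      "path_image \<gamma> \<subseteq> gcurve C1 \<inter> packed_triangle p12 p21 p23 p32 p31 p13" "l = hlength \<gamma>"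
    using assms unfolding packed_arc_length_def by blast
  obtain N1 N2 N3 where R: "represents C1 N1 k1" "represents C2 N2 k2" "represents C3 N3 k3"
    using tt valid_represented kk unfolding tangent_triple_def by blast
  have ext: "externally_tangent C1 C2 t12" "externally_tangent C2 C3 t23" "externally_tangent C3 C1 t31"
    using tt by (auto simp: tangent_triple_def)
  note n12 = externally_tangent_normals[OF R(1,2) ext(1)]
    and n23 = externally_tangent_normals[OF R(2,3) ext(2)] and n31 = externally_tangent_normals[OF R(3,1) ext(3)]
  note e12 = represents_edge_end[OF R(1,2) n12 e(1)] and e23 = represents_edge_end[OF R(2,3) n23 e(2)]
    and e31 = represents_edge_end[OF R(3,1) n31 e(3)]
  have tv: "tangent_vectors N1 k1 N2 k2 N3 k3"
    using e12(1) e23(1) e31(1) by (simp add: tangent_vectors_def)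
  define X m where "X = touch N1 k1 N2 k2" and "m = sqrt (1 + sigma2 k1 k2 k3)"
  define \<nu> where "\<nu> = N1 - k1 *\<^sub>R X"
  obtain \<tau> W1 W2 W3 where fr: "frame X \<nu> \<tau>"
    and W: "mink N1 W2 = 0" "mink N2 W2 = 1" "mink N3 W2 = 0"
    and end31: "touch N3 k3 N1 k1 = arc_point k1 X \<nu> \<tau> (1 / m)"
    using triangle_frame[OF tv] unfolding X_def[symmetric] m_def[symmetric] \<nu>_def[symmetric] by metis
  note t12 = tangent_pairD[OF e12(1), folded X_def] and t31 = tangent_pairD[OF e31(1)] and t23 = tangent_pairD[OF e23(1)]
  have s: "0 < sigma2 k1 k2 k3" using t12 t23 by (simp add: sigma2_def add_pos_pos)
  have m: "1 < m" using s by (simp add: m_def)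
  have NX: "N1 = k1 *\<^sub>R X + \<nu>" by (simp add: \<nu>_def)
  have den: "0 < arc_denom k1 (1 / m)"
  proof -
    have "(1 / m)\<^sup>2 < 1" using m by (simp add: power_less_one_iff)
    then show ?thesis using zero_le_power2[of "k1 * (1 / m)"]
      unfolding arc_denom_def power_mult_distrib left_diff_distrib by linarith
  qed
  have "hlength \<gamma> = arc_integral k1 (1 / m)"
  proof (rule hlength_arc_in_hcurve[OF fr NX t12(1) _ den \<gamma>(1)])
    show "0 < 1 / m" using m by simp
    show "path_image \<gamma> \<subseteq> hcurve N1 k1" using \<gamma>(4) R(1) by (auto simp: represents_def)
    show "pathstart \<gamma> = klein X" using \<gamma>(2) e12(2) n12(1) by (simp add: X_def)
    show "pathfinish \<gamma> = klein (arc_point k1 X \<nu> \<tau> (1 / m))"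
      unfolding end31[symmetric] e31(2) using \<gamma>(3) n31(1) by simp
    assume k1: "1 < k1\<^sup>2"
    define V where "V = X + (2 / (k1\<^sup>2 - 1)) *\<^sub>R (X + k1 *\<^sub>R \<nu>)"
    have V: "0 < fst V"
    proof (rule future_if_mink_neg[OF t12(7)])
      define e c where "e = k1\<^sup>2 - 1" and "c = 2 / (k1\<^sup>2 - 1)"
      have "0 < e" using k1 by (simp add: e_def)
      then have c: "0 < c" "c * (k1\<^sup>2 - 1) = 2" unfolding c_def e_def[symmetric] by simp_all
      have V: "V = X + c *\<^sub>R (X + k1 *\<^sub>R \<nu>)" by (simp only: V_def c_def)
      show "mink V X < 0" using c(1) unfolding V by (simp add: frameD[OF fr])
      have "mink V V = - 1 + c * (c * (k1\<^sup>2 - 1) - 2)"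
        unfolding V by (simp add: frameD[OF fr] power2_eq_square algebra_simps)
      then show "mink V V \<le> 0" unfolding c(2) by simp
    qed
    have "mink V W2 < 0"
    proof -
      have "X + k1 *\<^sub>R \<nu> = (1 - k1\<^sup>2) *\<^sub>R X + k1 *\<^sub>R N1" by (simp add: \<nu>_def algebra_simps power2_eq_square)
      then have "mink V W2 = mink X W2 + 2 / (k1\<^sup>2 - 1) * ((1 - k1\<^sup>2) * mink X W2)"
        unfolding V_def by (simp add: W)
      also have "\<dots> = - mink X W2"
      proof -
        define e where "e = k1\<^sup>2 - 1"
        have e: "1 - k1\<^sup>2 = - e" "e \<noteq> 0" using k1 by (simp_all add: e_def)
        show ?thesis unfolding e_def[symmetric] e(1) using e(2) by simp
      qed
      also have "mink X W2 = 1 / (k1 + k2)" by (simp add: X_def touch_def W)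
      finally show ?thesis using t12(1,2) by simp
    qed
    then have "\<not> 0 \<le> mink (1, klein V) W2" using V by (simp add: mink_klein divide_less_0_iff not_le)
    moreover have "path_image \<gamma> \<subseteq> {z. 0 \<le> mink (1, z) W2}"
      using packed_triangle_in_halfplane[OF tv, of W2] \<gamma>(4) W
      unfolding e12(3,4) e23(3,4) e31(3,4) by auto
    ultimately show "klein (X + (2 / (k1\<^sup>2 - 1)) *\<^sub>R (X + k1 *\<^sub>R \<nu>)) \<notin> path_image \<gamma>"
      unfolding V_def[symmetric] by blast
  qed
  then show ?thesis using \<gamma>(5) by (simp add: m_def)
qed

text \<open>The open set \<open>Q\<close> is bounded, because \<open>mink (1, z) (1, z)\<close> is a sum of negative terms, and its frontier
  lies on the edges and vertices. So a component of the complement of the boundary polygon that meets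
  \<open>Q\<close> stays in \<open>Q\<close>. At a frontier point some coordinate vanishes (an edge), or \<open>mink (1, z) N\<^sub>i\<close> does;
  the latter forces \<open>k\<^sub>i < 1\<close> unless a coordinate vanishes as well (a vertex that is a segment).\<close>

lemma polygon_interior_subset:
  fixes N1 N2 N3 :: "real \<times> complex"
  assumes tv: "tangent_vectors N1 k1 N2 k2 N3 k3"
    and dual: "\<And>Z. Z = mink Z W1 *\<^sub>R N1 + mink Z W2 *\<^sub>R N2 + mink Z W3 *\<^sub>R N3"
  defines "Q \<equiv> {z. (0 < mink (1, z) W1 \<and> 0 < mink (1, z) W2 \<and> 0 < mink (1, z) W3) \<and>
     (mink (1, z) N1 < 0 \<and> mink (1, z) N2 < 0 \<and> mink (1, z) N3 < 0)}"
  shows "Q \<subseteq> packed_triangle (klein (foot N1 k1 (touch N1 k1 N2 k2))) (klein (foot N2 k2 (touch N1 k1 N2 k2)))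
      (klein (foot N2 k2 (touch N2 k2 N3 k3))) (klein (foot N3 k3 (touch N2 k2 N3 k3)))
      (klein (foot N3 k3 (touch N3 k3 N1 k1))) (klein (foot N1 k1 (touch N3 k3 N1 k1)))"
    (is "Q \<subseteq> packed_triangle ?p12 ?p21 ?p23 ?p32 ?p31 ?p13")
proof -
  let ?B = "triangle_boundary ?p12 ?p21 ?p23 ?p32 ?p31 ?p13"
  have tp: "tangent_pair N1 k1 N2 k2" "tangent_pair N2 k2 N3 k3" "tangent_pair N3 k3 N1 k1"
    "tangent_pair N2 k2 N1 k1" "tangent_pair N3 k3 N2 k2" "tangent_pair N1 k1 N3 k3"
    using tv by (auto simp: tangent_vectors_def tangent_pair_commute)
  note tc = touch_commute[of N2 k2 N1 k1] touch_commute[of N3 k3 N2 k2] touch_commute[of N1 k1 N3 k3]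
  note c = continuous_on_affine_mink
  have opn: "open Q"
    unfolding Q_def Collect_conj_eq
    by (intro open_Int open_Collect_less c continuous_on_const)
  define P where "P = {z. (0 \<le> mink (1, z) W1 \<and> 0 \<le> mink (1, z) W2 \<and> 0 \<le> mink (1, z) W3) \<and>
     (mink (1, z) N1 \<le> 0 \<and> mink (1, z) N2 \<le> 0 \<and> mink (1, z) N3 \<le> 0)}"
  have "closed P"
    unfolding P_def Collect_conj_eq
    by (intro closed_Int closed_Collect_le c continuous_on_const)
  then have "closure Q \<subseteq> P" by (rule closure_minimal[rotated]) (auto simp: Q_def P_def)
  have "Q \<subseteq> hplane"
  proof
    fix z assume z: "z \<in> Q"
    let ?Z = "(1, z) :: real \<times> complex"
    have "mink ?Z ?Z = mink ?Z (mink ?Z W1 *\<^sub>R N1 + mink ?Z W2 *\<^sub>R N2 + mink ?Z W3 *\<^sub>R N3)"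
      using dual[of ?Z] by simp
    also have "\<dots> = mink ?Z W1 * mink ?Z N1 + mink ?Z W2 * mink ?Z N2 + mink ?Z W3 * mink ?Z N3" by simp
    also have "\<dots> < 0" using z by (intro add_neg_neg mult_pos_neg) (auto simp: Q_def)
    finally show "z \<in> hplane" by (simp add: mink_homogeneous hplane_iff dot_square_norm)
  qed
  then have bdd: "bounded Q" unfolding hplane_def by (rule bounded_subset[OF bounded_ball])
  have frontier: "frontier Q \<subseteq> ?B"
  proof
    fix z assume "z \<in> frontier Q"
    then have z: "z \<in> P" "z \<notin> Q"
      using \<open>closure Q \<subseteq> P\<close> opn by (auto simp: frontier_def interior_open)
    define a b c where "a = mink (1, z) W1" and "b = mink (1, z) W2" and "c = mink (1, z) W3"
    have zz: "(1, z) = a *\<^sub>R N1 + b *\<^sub>R N2 + c *\<^sub>R N3" using dual[of "(1, z)"] by (simp add: a_def b_def c_def)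
    have nn: "0 \<le> a" "0 \<le> b" "0 \<le> c" "mink (1, z) N1 \<le> 0" "mink (1, z) N2 \<le> 0" "mink (1, z) N3 \<le> 0"
      using z(1) by (auto simp: P_def a_def b_def c_def)
    have edges: "z \<in> ?B" if degenerate: "a = 0 \<or> b = 0 \<or> c = 0"
    proof -
      consider "c = 0" | "a = 0" | "b = 0" using degenerate by blast
      then show ?thesis
      proof cases
        case 1
        then have "z \<in> closed_segment ?p12 ?p21"
          using edge_segment[OF tp(1), of z a b] zz nn by simp
        then show ?thesis by (simp add: triangle_boundary_def)
      next
        case 2
        then have "z \<in> closed_segment ?p23 ?p32"
          using edge_segment[OF tp(2), of z b c] zz nn by simp
        then show ?thesis by (simp add: triangle_boundary_def)
      next
        case 3
        then have "z \<in> closed_segment ?p31 ?p13"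
          using edge_segment[OF tp(3), of z c a] zz nn by (simp add: add.commute)
        then show ?thesis by (simp add: triangle_boundary_def)
      qed
    qed
    have large: "b = 0"
      if "1 \<le> k" "0 < k" "0 < l" "0 \<le> a" "0 \<le> b" "0 \<le> c" "a * (1 - k\<^sup>2) + b * (- 1 - k * l) + c * (- 1 - k * l') = 0" "0 < l'"
      for a b c k l l' :: real
    proof -
      have "1 \<le> k\<^sup>2" using that(1) by simp
      then have "a * (1 - k\<^sup>2) \<le> 0" using that by (intro mult_nonneg_nonpos) auto
      moreover have "0 < k * l" "0 < k * l'" using that(2,3,8) by auto
      then have "b * (- 1 - k * l) \<le> 0" "c * (- 1 - k * l') \<le> 0"
        using that(5,6) \<open>0 < k * l\<close> \<open>0 < k * l'\<close> by (intro mult_nonneg_nonpos; linarith)+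
      ultimately have "b * (- 1 - k * l) = 0" using that(7) by linarith
      then show ?thesis using \<open>0 < k * l\<close> by auto
    qed
    have exp: "mink (1, z) N1 = a * (1 - k1\<^sup>2) + b * (- 1 - k1 * k2) + c * (- 1 - k1 * k3)"
      "mink (1, z) N2 = b * (1 - k2\<^sup>2) + c * (- 1 - k2 * k3) + a * (- 1 - k2 * k1)"
      "mink (1, z) N3 = c * (1 - k3\<^sup>2) + a * (- 1 - k3 * k1) + b * (- 1 - k3 * k2)"
      unfolding zz by (simp_all add: tangent_pairD[OF tp(1)] tangent_pairD[OF tp(2)] tangent_pairD[OF tp(3)] mult.commute)
    note k = tangent_pairD(1,2)[OF tp(1)] tangent_pairD(2)[OF tp(2)]
    show "z \<in> ?B"
    proof (cases "a = 0 \<or> b = 0 \<or> c = 0")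
      case False
      then have "mink (1, z) N1 = 0 \<or> mink (1, z) N2 = 0 \<or> mink (1, z) N3 = 0"
        using z(2) nn by (auto simp: Q_def a_def b_def c_def)
      then consider "mink (1, z) N1 = 0" | "mink (1, z) N2 = 0" | "mink (1, z) N3 = 0" by blast
      then show ?thesis
      proof cases
        case 1
        have zero: "a * (1 - k1\<^sup>2) + b * (- 1 - k1 * k2) + c * (- 1 - k1 * k3) = 0"
          using exp(1) 1 by simp
        have "k1 < 1"
          by (rule ccontr) (use large[OF _ k(1,2) nn(1,2,3) zero k(3)] False in auto)
        then have "z \<in> closed_segment ?p12 ?p13"
          using vertex_segment[OF tp(1) tp(6), of z a b c] zz nn 1 by (simp add: tc)
        then show ?thesis by (simp add: triangle_boundary_def closed_segment_commute)
      next
        case 2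
        have zero: "b * (1 - k2\<^sup>2) + c * (- 1 - k2 * k3) + a * (- 1 - k2 * k1) = 0"
          using exp(2) 2 by simp
        have "k2 < 1"
          by (rule ccontr) (use large[OF _ k(2,3) nn(2,3,1) zero k(1)] False in auto)
        then have "z \<in> closed_segment ?p23 ?p21"
          using vertex_segment[OF tp(2) tp(4), of z b c a] zz nn 2 by (simp add: tc ac_simps)
        then show ?thesis by (simp add: triangle_boundary_def closed_segment_commute)
      next
        case 3
        have zero: "c * (1 - k3\<^sup>2) + a * (- 1 - k3 * k1) + b * (- 1 - k3 * k2) = 0"
          using exp(3) 3 by simp
        have "k3 < 1"
          by (rule ccontr) (use large[OF _ k(3,1) nn(3,1,2) zero k(2)] False in auto)
        then have "z \<in> closed_segment ?p31 ?p32"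
          using vertex_segment[OF tp(3) tp(5), of z c a b] zz nn 3 by (simp add: tc ac_simps)
        then show ?thesis by (simp add: triangle_boundary_def closed_segment_commute)
      qed
    qed (rule edges)
  qed
  show ?thesis
  proof
    fix z assume z: "z \<in> Q"
    show "z \<in> packed_triangle ?p12 ?p21 ?p23 ?p32 ?p31 ?p13"
    proof (cases "z \<in> ?B")
      case False
      define K where "K = connected_component_set (- ?B) z"
      have "K \<subseteq> Q"
      proof (rule ccontr)
        assume "\<not> K \<subseteq> Q"
        moreover have "z \<in> K" using False by (simp add: K_def connected_component_refl)
        moreover have "connected K" by (simp add: K_def)
        ultimately have "K \<inter> frontier Q \<noteq> {}"
          using z connected_Int_frontier[of K Q] by blast
        moreover have "K \<subseteq> - ?B" unfolding K_def by (rule connected_component_subset)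
        ultimately show False using frontier by blast
      qed
      then have "bounded K" using bdd bounded_subset by blast
      then have "z \<in> inside ?B" using False by (simp add: inside_def K_def)
      then show ?thesis by (simp add: packed_triangle_def)
    qed (simp add: packed_triangle_def)
  qed
qed

text \<open>The points of the arc lie on the near side of the other two curves, since
  \<open>mink Y (N\<^sub>1 + M) \<le> - (k\<^sub>1 + l)\<close> for any point \<open>Y\<close> of the hyperboloid; so the strict inequalities of
  \<open>polygon_interior_subset\<close> hold between the endpoints.\<close>

lemma packed_arc_exists:
  assumes tv: "tangent_vectors N1 k1 N2 k2 N3 k3"
  obtains \<gamma> where "arc \<gamma>" "pathstart \<gamma> = klein (touch N1 k1 N2 k2)" "pathfinish \<gamma> = klein (touch N3 k3 N1 k1)"
    "path_image \<gamma> \<subseteq> hcurve N1 k1 \<inter> packed_triangle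
      (klein (foot N1 k1 (touch N1 k1 N2 k2))) (klein (foot N2 k2 (touch N1 k1 N2 k2)))
      (klein (foot N2 k2 (touch N2 k2 N3 k3))) (klein (foot N3 k3 (touch N2 k2 N3 k3)))
      (klein (foot N3 k3 (touch N3 k3 N1 k1))) (klein (foot N1 k1 (touch N3 k3 N1 k1)))"
proof -
  let ?T = "packed_triangle
      (klein (foot N1 k1 (touch N1 k1 N2 k2))) (klein (foot N2 k2 (touch N1 k1 N2 k2)))
      (klein (foot N2 k2 (touch N2 k2 N3 k3))) (klein (foot N3 k3 (touch N2 k2 N3 k3)))
      (klein (foot N3 k3 (touch N3 k3 N1 k1))) (klein (foot N1 k1 (touch N3 k3 N1 k1)))"
  have tp: "tangent_pair N1 k1 N2 k2" "tangent_pair N2 k2 N3 k3" "tangent_pair N3 k3 N1 k1"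
    using tv by (auto simp: tangent_vectors_def)
  define X m where "X = touch N1 k1 N2 k2" and "m = sqrt (1 + sigma2 k1 k2 k3)"
  define \<nu> where "\<nu> = N1 - k1 *\<^sub>R X"
  obtain \<tau> W1 W2 W3 where fr: "frame X \<nu> \<tau>"
    and dual: "\<And>Z. Z = mink Z W1 *\<^sub>R N1 + mink Z W2 *\<^sub>R N2 + mink Z W3 *\<^sub>R N3"
    and end31: "touch N3 k3 N1 k1 = arc_point k1 X \<nu> \<tau> (1 / m)"
    and pos: "\<And>u. 0 < u \<Longrightarrow> u < 1 / m \<Longrightarrow> 0 < mink (arc_point k1 X \<nu> \<tau> u) W1 \<and>
      0 < mink (arc_point k1 X \<nu> \<tau> u) W2 \<and> 0 < mink (arc_point k1 X \<nu> \<tau> u) W3"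
    using triangle_frame[OF tv] unfolding X_def[symmetric] m_def[symmetric] \<nu>_def[symmetric] by metis
  note t12 = tangent_pairD[OF tp(1), folded X_def] and t31 = tangent_pairD[OF tp(3)] and t23 = tangent_pairD[OF tp(2)]
  have s: "0 < sigma2 k1 k2 k3" using t12 t23 by (simp add: sigma2_def add_pos_pos)
  have m: "1 < m" using s by (simp add: m_def)
  have NX: "N1 = k1 *\<^sub>R X + \<nu>" by (simp add: \<nu>_def)
  have den: "0 < arc_denom k1 u" if "u \<in> {0..1 / m}" for u
  proof -
    have "1 / m < 1" using m by simp
    then have "u < 1" "0 \<le> u" using that by auto
    then have "u\<^sup>2 < 1" by (simp add: abs_square_less_1)
    then show ?thesis using zero_le_power2[of "k1 * u"]
      unfolding arc_denom_def power_mult_distrib left_diff_distrib by linarith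
  qed
  define \<gamma> where "\<gamma> = (\<lambda>v. klein (arc_point k1 X \<nu> \<tau> (v / m)))"
  have rng: "v / m \<in> {0..1 / m}" if "v \<in> {0..1}" for v using that m by (auto simp: divide_right_mono)
  note hyp = arc_point_hyperboloid[OF fr NX den]
  have "continuous_on {0..1} \<gamma>"
    unfolding \<gamma>_def
    by (rule continuous_on_compose2[OF continuous_on_klein_arc_point[OF fr NX, of "{0..1 / m}"]])
      (use den rng m in \<open>auto intro!: continuous_intros\<close>)
  moreover have "inj_on \<gamma> {0..1}"
  proof (rule inj_onI)
    fix v w assume vw: "v \<in> {0..1}" "w \<in> {0..1}" "\<gamma> v = \<gamma> w"
    then have "arc_point k1 X \<nu> \<tau> (v / m) = arc_point k1 X \<nu> \<tau> (w / m)"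
      using klein_inj_hyperboloid[OF hyp[OF rng] hyp[OF rng]] by (simp add: \<gamma>_def)
    then have "v / m = w / m"
      using arc_param_arc_point[OF fr NX den[OF rng[OF vw(1)]]] arc_param_arc_point[OF fr NX den[OF rng[OF vw(2)]]] by metis
    then show "v = w" using m by simp
  qed
  ultimately have "arc \<gamma>" by (simp add: arc_def path_def)
  moreover have "pathstart \<gamma> = klein (touch N1 k1 N2 k2)"
    by (simp add: pathstart_def \<gamma>_def arc_point_def X_def)
  moreover have "pathfinish \<gamma> = klein (touch N3 k3 N1 k1)"
    by (simp add: pathfinish_def \<gamma>_def end31)
  moreover have on_T: "\<gamma> v \<in> hcurve N1 k1 \<inter> ?T" if v: "v \<in> {0..1}" for v
  proof -
    let ?Y = "arc_point k1 X \<nu> \<tau> (v / m)"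
    have Y: "?Y \<in> hyperboloid" by (rule hyp[OF rng[OF v]])
    have on: "mink ?Y N1 = - k1" by (rule mink_arc_point_frame(3)[OF fr NX])
    have "\<gamma> v \<in> hcurve N1 k1" using Y on by (simp add: \<gamma>_def hcurve_def)
    moreover have "\<gamma> v \<in> ?T"
    proof -
      consider "v = 0" | "v = 1" | "0 < v" "v < 1" using v by fastforce
      then show ?thesis
      proof cases
        case 1
        then have "\<gamma> v = klein (touch N1 k1 N2 k2)" by (simp add: \<gamma>_def arc_point_def X_def)
        then show ?thesis using touch_in_edge[OF tp(1)] by (simp add: packed_triangle_def triangle_boundary_def)
      next
        case 2
        then have "\<gamma> v = klein (touch N3 k3 N1 k1)" by (simp add: \<gamma>_def end31)
        then show ?thesis using touch_in_edge[OF tp(3)] by (simp add: packed_triangle_def triangle_boundary_def)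
      next
        case 3
        then have u: "0 < v / m" "v / m < 1 / m" using m by (auto simp: divide_strict_right_mono)
        have other: "mink ?Y M < 0" if t: "tangent_pair N1 k1 M l" for M l
        proof -
          note t' = tangent_pairD[OF t]
          have "mink ?Y (N1 + M) = (k1 + l) * mink ?Y (touch N1 k1 M l)" unfolding t'(8) by simp
          also have "\<dots> \<le> (k1 + l) * (- 1)"
            using t'(1,2) mink_hyperboloid_le[OF Y t'(7)] by (intro mult_left_mono) auto
          finally show ?thesis using on t'(2) by simp
        qed
        have "mink ?Y N2 < 0" by (rule other[OF tp(1)])
        moreover have "mink ?Y N3 < 0" by (rule other[OF tp(3)[unfolded tangent_pair_commute[of N3]]])
        moreover have "mink ?Y N1 < 0" using on t12(1) by simp
        moreover note pos[OF u]
        ultimately show ?thesis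
          using hyperboloidD(2)[OF Y] by (intro polygon_interior_subset[OF tv dual, THEN subsetD])
            (simp add: \<gamma>_def mink_klein divide_neg_pos)
      qed
    qed
    ultimately show ?thesis by blast
  qed
  moreover have "path_image \<gamma> \<subseteq> hcurve N1 k1 \<inter> ?T"
    unfolding path_image_def by (rule image_subsetI) (rule on_T)
  ultimately show thesis by (intro that[of \<gamma>])
qed

lemma hyperboloid_touchI:
  assumes "0 < k" "0 < k'" "mink N N = 1 - k\<^sup>2" "mink N' N' = 1 - k'\<^sup>2" "mink N N' = - 1 - k * k'" "0 < fst N + fst N'"
  shows "tangent_pair N k N' k'"
proof -
  define K where "K = k + k'"
  have K: "0 < K" using assms by (simp add: K_def)
  have m: "mink (N + N') (N + N') = - (K * K)"
    using assms by (simp add: mink_commute[of N' N] K_def power2_eq_square algebra_simps)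
  have "mink (touch N k N' k') (touch N k N' k') = -1"
    unfolding touch_def mink_linear(5,6) m K_def[symmetric] using K by simp
  then have "touch N k N' k' \<in> hyperboloid" using assms by (simp add: hyperboloid_def touch_def)
  then show ?thesis using assms by (simp add: tangent_pair_def)
qed

text \<open>Put the first point of tangency at the origin and the first two normals on the real axis. The
  third vector is then determined by its inner products up to reflection in the real axis, and the
  orientation requires a negative imaginary part.\<close>

lemma packed_arc_length_exists:
  assumes k: "0 < k1" "0 < k2" "0 < k3"
  shows "\<exists>l. packed_arc_length k1 k2 k3 l"
proof -
  define d m where "d = k1 + k2" and "m = sqrt (1 + sigma2 k1 k2 k3)"
  have d: "0 < d" using k by (simp add: d_def)
  have m: "0 < m" "m\<^sup>2 = 1 + sigma2 k1 k2 k3"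
    using sigma2_nonneg[of k1 k2 k3] k by (simp_all add: m_def add_pos_nonneg)
  define p x y where "p = k3 + 2 / d" and "x = (k1 - k2) / d" and "y = 2 * m / d"
  have pd: "p * d = k3 * d + 2" "x * d = k1 - k2" "y * d = 2 * m" using d by (simp_all add: p_def x_def y_def distrib_right)
  have p: "0 < p" and y: "0 < y" using k d m by (simp_all add: p_def y_def add_pos_pos)
  define N1 N2 N3 where "N1 = (k1, 1 :: complex)" and "N2 = (k2, - 1 :: complex)" and "N3 = (p, Complex x (- y))"
  have n: "mink N1 N1 = 1 - k1\<^sup>2" "mink N2 N2 = 1 - k2\<^sup>2" "mink N1 N2 = - 1 - k1 * k2"
    by (simp_all add: N1_def N2_def mink_def power2_eq_square)
  have cancel: "u = v" if "u * d = v * d" for u v using that d by simp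
  have "mink N3 N3 = 1 - k3\<^sup>2"
  proof -
    have "mink N3 N3 * d\<^sup>2 = (x * d)\<^sup>2 + (y * d)\<^sup>2 - (p * d)\<^sup>2"
      by (simp add: N3_def mink_def inner_complex_def power2_eq_square algebra_simps)
    also have "\<dots> = (1 - k3\<^sup>2) * d\<^sup>2"
      unfolding pd power_mult_distrib m(2) by (simp add: d_def sigma2_def power2_eq_square algebra_simps)
    finally show ?thesis using d by simp
  qed
  moreover have "mink N2 N3 = - 1 - k2 * k3"
  proof (rule cancel)
    have "mink N2 N3 * d = - (x * d) - k2 * (p * d)" by (simp add: N2_def N3_def mink_def inner_complex_def algebra_simps)
    also have "\<dots> = (- 1 - k2 * k3) * d" unfolding pd by (simp add: d_def algebra_simps)
    finally show "mink N2 N3 * d = (- 1 - k2 * k3) * d" .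
  qed
  moreover have "mink N3 N1 = - 1 - k3 * k1"
  proof (rule cancel)
    have "mink N3 N1 * d = x * d - k1 * (p * d)" by (simp add: N1_def N3_def mink_def inner_complex_def algebra_simps)
    also have "\<dots> = (- 1 - k3 * k1) * d" unfolding pd by (simp add: d_def algebra_simps)
    finally show "mink N3 N1 * d = (- 1 - k3 * k1) * d" .
  qed
  moreover have f: "0 < fst N1" "0 < fst N2" "0 < fst N3" using k p by (simp_all add: N1_def N2_def N3_def)
  ultimately have tp: "tangent_pair N1 k1 N2 k2" "tangent_pair N2 k2 N3 k3" "tangent_pair N3 k3 N1 k1"
    using n k by (auto intro!: hyperboloid_touchI add_pos_pos)
  then have tv: "tangent_vectors N1 k1 N2 k2 N3 k3" by (simp add: tangent_vectors_def)
  note t12 = tangent_pairD[OF tp(1)] and t23 = tangent_pairD[OF tp(2)] and t31 = tangent_pairD[OF tp(3)]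
  obtain C1 C2 C3 where C1: "gcircle_valid C1" "geod_curvature C1 = k1" "represents C1 N1 k1"
    and C2: "gcircle_valid C2" "geod_curvature C2 = k2" "represents C2 N2 k2"
    and C3: "gcircle_valid C3" "geod_curvature C3 = k3" "represents C3 N3 k3"
    using represented_exists[OF t12(1,3) f(1) t12(7,9)] represented_exists[OF t23(1,3) f(2) t23(7,9)]
      represented_exists[OF t31(1,3) f(3) t31(7,9)] by blast
  define t where "t = (\<lambda>N k N' k'. klein (touch N k N' k'))"
  have ext: "externally_tangent C C' (t N k N' k')"
    if "represents C N k" "represents C' N' k'" "tangent_pair N k N' k'" for C C' N N' k k'
    unfolding t_def using externally_tangentI[OF that(1,2)] tangent_pairD[OF that(3)] by blast
  have edge: "edge_between C C' (t N k N' k') (klein (foot N k (touch N k N' k'))) (klein (foot N' k' (touch N k N' k')))"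
    if R: "represents C N k" "represents C' N' k'" and tp: "tangent_pair N k N' k'" for C C' N N' k k'
  proof -
    note t' = tangent_pairD[OF tp]
    have "lift (t N k N' k') = touch N k N' k'" using t'(7) by (simp add: t_def)
    moreover from this have "t N k N' k' \<in> hcurve N k" "t N k N' k' \<in> hcurve N' k'"
      using t' by (auto simp: hcurve_def t_def)
    ultimately show ?thesis
      using R touch_in_edge[OF tp] by (simp add: edge_between_def represents_def t_def)
  qed
  have "Im (cnj (t N2 k2 N3 k3 - t N1 k1 N2 k2) * (t N3 k3 N1 k1 - t N1 k1 N2 k2)) > 0"
  proof -
    have 1: "t N1 k1 N2 k2 = 0" by (simp add: t_def touch_def klein_def N1_def N2_def)
    have 2: "t N2 k2 N3 k3 = (1 / (k2 + p)) *\<^sub>R Complex (x - 1) (- y)"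
      using k by (simp add: t_def touch_def klein_def N2_def N3_def complex_eq_iff)
    have 3: "t N3 k3 N1 k1 = (1 / (p + k1)) *\<^sub>R Complex (x + 1) (- y)"
      using k by (simp add: t_def touch_def klein_def N1_def N3_def complex_eq_iff)
    have "Im (cnj (t N2 k2 N3 k3 - t N1 k1 N2 k2) * (t N3 k3 N1 k1 - t N1 k1 N2 k2)) = 2 * y / ((k2 + p) * (p + k1))"
      unfolding 1 2 3 using k p by (simp add: field_simps)
    then show ?thesis using k p y by simp
  qed
  then have tt: "tangent_triple C1 C2 C3 (t N1 k1 N2 k2) (t N2 k2 N3 k3) (t N3 k3 N1 k1)"
    using C1 C2 C3 ext tp by (simp add: tangent_triple_def)
  obtain \<gamma> where "arc \<gamma>" "pathstart \<gamma> = klein (touch N1 k1 N2 k2)" "pathfinish \<gamma> = klein (touch N3 k3 N1 k1)"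
    "path_image \<gamma> \<subseteq> hcurve N1 k1 \<inter> packed_triangle
      (klein (foot N1 k1 (touch N1 k1 N2 k2))) (klein (foot N2 k2 (touch N1 k1 N2 k2)))
      (klein (foot N2 k2 (touch N2 k2 N3 k3))) (klein (foot N3 k3 (touch N2 k2 N3 k3)))
      (klein (foot N3 k3 (touch N3 k3 N1 k1))) (klein (foot N1 k1 (touch N3 k3 N1 k1)))"
    using packed_arc_exists[OF tv] .
  moreover have "gcurve C1 = hcurve N1 k1" using C1(3) by (simp add: represents_def)
  ultimately have "packed_arc_length k1 k2 k3 (hlength \<gamma>)"
    unfolding packed_arc_length_def
    using tt C1(2) C2(2) C3(2) edge[OF C1(3) C2(3) tp(1)] edge[OF C2(3) C3(3) tp(2)] edge[OF C3(3) C1(3) tp(3)]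
    unfolding t_def by blast
  then show ?thesis by blast
qed

lemma total_geod_curvature_eq_turning:
  assumes k: "0 < k1" "0 < k2" "0 < k3"
  shows "total_geod_curvature k1 k2 k3 = turning k1 (sigma2 k1 k2 k3)"
proof -
  have "0 < sigma2 k1 k2 k3" using k by (simp add: sigma2_def add_pos_pos)
  moreover have "(THE l. packed_arc_length k1 k2 k3 l) = arc_integral k1 (1 / sqrt (1 + sigma2 k1 k2 k3))"
    using packed_arc_length_exists[OF k] packed_arc_length_unique by blast
  ultimately show ?thesis
    using turning_eq_arc_integral[of k1 "sigma2 k1 k2 k3"] k
    by (simp add: total_geod_curvature_def arc_integral_def arc_denom_def)
qed

section \<open>The extended homeomorphism\<close>

text \<open>A triangle cell is embedded, so its three corners are distinct, and the orientation enumerates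
  them.\<close>

lemma triangulation_vertices:
  fixes pos :: "'v::finite \<Rightarrow> 'a"
  assumes tri: "simple_triangulation S pos E F" and ori: "surface_orientation pos F nxt"
  shows "finite F" "\<exists>f\<in>F. pos v \<in> f"
    "f \<in> F \<Longrightarrow> card (pos -` f) = 3"
    "f \<in> F \<Longrightarrow> pos v \<in> f \<Longrightarrow> pos -` f = {v, nxt f v, nxt f (nxt f v)} \<and>
      v \<noteq> nxt f v \<and> nxt f v \<noteq> nxt f (nxt f v) \<and> nxt f (nxt f v) \<noteq> v"
proof -
  have T: "triangulation S pos E F" using tri by (simp add: simple_triangulation_def)
  then have inj: "inj pos" and cover: "\<Union>F = topspace S" "range pos \<subseteq> topspace S"
    and cell: "\<And>f. f \<in> F \<Longrightarrow> triangle_cell S pos E f" and "finite F"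
    by (auto simp: triangulation_def)
  then show "finite F" by simp
  have "pos v \<in> \<Union>F" using cover by auto
  then show "\<exists>f\<in>F. pos v \<in> f" by blast
  show c3: "card (pos -` f) = 3" if fF: "f \<in> F" for f
  proof -
    let ?T = "convex hull {0, 1, \<i>}"
    obtain g where g: "embedding_map (top_of_set ?T) S g" "f \<inter> range pos = {g 0, g 1, g \<i>}"
      using cell[OF fF] by (auto simp: triangle_cell_def)
    have "inj_on g ?T" using g(1) by (auto simp: embedding_map_def homeomorphic_map_def homeomorphic_imp_injective_map)
    moreover have "0 \<in> ?T" "1 \<in> ?T" "\<i> \<in> ?T" by (auto intro: hull_inc)
    ultimately have "g 0 \<noteq> g 1" "g 1 \<noteq> g \<i>" "g 0 \<noteq> g \<i>" by (auto simp: inj_on_eq_iff)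
    then have "card (f \<inter> range pos) = 3" unfolding g(2) by simp
    moreover have "card (pos -` f) = card (f \<inter> range pos)"
      using card_image[OF inj_on_subset[OF inj], of "pos -` f"] by (simp add: image_vimage_eq)
    ultimately show ?thesis by simp
  qed
  assume f: "f \<in> F" "pos v \<in> f"
  have eq: "pos -` f = {v, nxt f v, nxt f (nxt f v)}" using ori f by (auto simp: surface_orientation_def)
  have "card {v, nxt f v, nxt f (nxt f v)} = 3" using c3[OF f(1)] eq by simp
  then show "pos -` f = {v, nxt f v, nxt f (nxt f v)} \<and>
      v \<noteq> nxt f v \<and> nxt f v \<noteq> nxt f (nxt f v) \<and> nxt f (nxt f v) \<noteq> v"
    using eq by (auto simp: card_insert_if split: if_splits)
qed

theorem theorem1p2:
  fixes S :: "'a topology" and pos :: "'v::finite \<Rightarrow> 'a"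
    and E F :: "'a set set" and nxt :: "'a set \<Rightarrow> 'v \<Rightarrow> 'v"
  assumes "connected_closed_surface S"
    and "simple_triangulation S pos E F"
    and "surface_orientation pos F nxt"
  shows "\<exists>\<Phi>hat \<Psi>hat.
           (\<forall>k\<in>\<Omega>\<^sub>k. \<Phi>hat k = \<Phi> pos F nxt k) \<and>
           homeomorphism closed_\<Omega>\<^sub>k (hat_\<Omega>\<^sub>T pos F) \<Phi>hat \<Psi>hat \<and>
           (\<forall>I. \<Phi>hat ` bd_\<Omega>\<^sub>k I = bd0_\<Omega>\<^sub>T pos F I)"
proof -
  note vertices = triangulation_vertices[OF assms(2,3)]
  define \<Theta> where "\<Theta> = (\<lambda>k :: real ^ 'v. \<chi> v.
    \<Sum>f\<in>{f \<in> F. v \<in> pos -` f}. turning (k $ v) (elementary2 (pos -` f) k))"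
  have cover: "\<exists>f\<in>F. v \<in> pos -` f" for v using vertices(2) by auto
  note main = turning_map_homeomorphism[of F "\<lambda>f. pos -` f", OF vertices(1,3) cover, folded \<Theta>_def]
  have T: "{t. (\<forall>v. 0 \<le> t $ v) \<and> (\<forall>I. I \<noteq> {} \<longrightarrow>
      (\<Sum>i\<in>I. t $ i) < pi * real (card {f \<in> F. pos -` f \<inter> I \<noteq> {}}))} = hat_\<Omega>\<^sub>T pos F"
  proof -
    have "{f \<in> F. pos -` f \<inter> I \<noteq> {}} = triangles_at pos F I" for I
      by (auto simp: triangles_at_def)
    then show ?thesis by (simp add: hat_\<Omega>\<^sub>T_def \<eta>_def)
  qed
  obtain \<Psi> where hom: "homeomorphism closed_\<Omega>\<^sub>k (hat_\<Omega>\<^sub>T pos F) \<Theta> \<Psi>"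
    using main(1) unfolding T by blast
  have "\<Theta> k = \<Phi> pos F nxt k" if k: "k \<in> \<Omega>\<^sub>k" for k
  proof -
    have kpos: "0 < k $ v" for v using k by (simp add: \<Omega>\<^sub>k_def)
    have "turning (k $ v) (elementary2 (pos -` f) k)
        = total_geod_curvature (k $ v) (k $ nxt f v) (k $ nxt f (nxt f v))"
      if "f \<in> F" "pos v \<in> f" for f v
      using vertices(4)[OF that] elementary2_triple[of v "nxt f v" "nxt f (nxt f v)" k]
        total_geod_curvature_eq_turning[OF kpos kpos kpos] by simp
    then show ?thesis by (simp add: \<Theta>_def \<Phi>_def vec_eq_iff)
  qed
  moreover have "\<Theta> ` bd_\<Omega>\<^sub>k I = bd0_\<Omega>\<^sub>T pos F I" for I
  proof -
    have img: "\<Theta> ` closed_\<Omega>\<^sub>k = hat_\<Omega>\<^sub>T pos F" using hom by (simp add: homeomorphism_def)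
    have zero: "\<Theta> k $ i = 0 \<longleftrightarrow> k $ i = 0" if "k \<in> closed_\<Omega>\<^sub>k" for k i
      using main(2)[OF _ that, of i] unfolding \<Theta>_def by simp
    show ?thesis
      unfolding bd_\<Omega>\<^sub>k_def bd0_\<Omega>\<^sub>T_def img[symmetric] using zero by (auto intro!: imageI)
  qed
  ultimately show ?thesis using hom by blast
qed

end
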